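(* Let $\lambda=\frac12(\sqrt5-1)$. Then, as $n\to\infty$, $$SB_n\sim A\,\frac{\mu^n}{n^6},$$ where $A=\frac{12}{\pi}\,5^{-1/4}\lambda^{-15/2}\approx 94.34$ and $\mu=\lambda^{-5}=(11+5\sqrt5)/2$.
   Context: $SB_n$ is the number of semi-Baxter permutations of size $n$, i.e. permutations $\sigma$ of $\{1,\dots,n\}$ with no indices $i<j$ and $k>j+1$ such that $\sigma_{j+1}<\sigma_i<\sigma_k<\sigma_j$. In the formula for $A$, $\pi$ is the usual constant $3.14159\ldots$. *)

theory Defs
  imports
    Complex_Main
    "HOL-Combinatorics.Permutations"
    "HOL-Library.Landau_Symbols"
begin

text \<open>
  Permutations of \<open>{1..n}\<close> are functions that are the identity outside \<open>{1..n}\<close>, so the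
  occurrence indices have to be confined to \<open>{1..n}\<close> explicitly.
\<close>

definition semi_baxter :: "nat \<Rightarrow> (nat \<Rightarrow> nat) \<Rightarrow> bool" where
  "semi_baxter n \<sigma> \<longleftrightarrow> \<sigma> permutes {1..n} \<and>
     \<not> (\<exists>i j k. 1 \<le> i \<and> i < j \<and> j + 1 < k \<and> k \<le> n \<and>
          \<sigma> (j + 1) < \<sigma> i \<and> \<sigma> i < \<sigma> k \<and> \<sigma> k < \<sigma> j)"

definition SB :: "nat \<Rightarrow> nat" where
  "SB n = card {\<sigma>. semi_baxter n \<sigma>}"

end

theory Submission
  imports Defs "HOL-Probability.Distributions" "HOL-Real_Asymp.Real_Asymp"
begin

text \<open>
  Appending a last value to a semi-Baxter permutation gives a generating tree: a permutation carries
  a label \<open>(h, k)\<close>, the numbers of values at most, respectively above, its last entry that may be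
  appended, and its children carry the labels \<open>(i, k + 1)\<close> for \<open>1 \<le> i \<le> h\<close> and
  \<open>(h + j, k + 1 - j)\<close> for \<open>1 \<le> j \<le> k\<close> (lemmas \<open>labels_append_low\<close> and \<open>labels_append_high\<close>). So the
  semi-Baxter number of size \<open>n + 1\<close> is the number \<open>e n 1 1\<close> of nodes \<open>n\<close> levels below the label \<open>(1, 1)\<close>,
  which is also \<open>e (n + 1) 1 0\<close>.

  Taking differences makes the recursion for \<open>e n h k\<close> local. Its bulk equation has constant
  coefficients and is solved by the plane waves \<open>w^n y^h z^k\<close> with \<open>y = 1 + a\<close>, \<open>z = 1 + b\<close>,
  \<open>d = b - a\<close> and \<open>w = y z b / (a d)\<close>. Two involutions preserve \<open>w\<close>:

    \<open>\<sigma>1: a \<mapsto> a, b \<mapsto> a z / d\<close> (which fixes \<open>y\<close>), and \<open>\<sigma>2: a \<mapsto> d / y, b \<mapsto> b\<close> (which fixes \<open>z\<close>).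

  They generate a dihedral group of order 10, which acts on Laurent monomials in \<open>a, y, b, z, d\<close>.
  As in the reflection principle, an alternating sum over an orbit of this group kills the two
  boundary conditions: the one at \<open>k = 0\<close> involves only functions invariant under \<open>\<sigma>1\<close>, the one at
  \<open>h = 0\<close> only functions invariant under \<open>\<sigma>2\<close>. Hence \<open>e n h k\<close> is an alternating sum of ten residues
  at \<open>a = b = 0\<close> (lemma \<open>descendants_eq_tree_poly\<close>). What makes this rigorous is that the residues
  themselves are compatible with the two substitutions (lemmas \<open>residue_sigma1\<close> and
  \<open>residue_sigma2\<close>); these are binomial identities proved from Pascal's rule.

  Each residue is a single sum of products of three binomial coefficients. At \<open>(h, k) = (1, 0)\<close> the
  ten sums collapse, up to a telescoping sum, to one sum of positive terms (theorem \<open>SB_formula\<close>):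
  the cancellation of order \<open>n^5\<close> is thereby made explicit.

  With \<open>\<lambda> = (sqrt 5 - 1) / 2\<close> one has \<open>1 - \<lambda> = \<lambda>^2\<close> and \<open>1 - \<lambda>^2 = \<lambda>\<close>. Therefore the three binomial
  coefficients in the \<open>j\<close>-th term turn into probabilities of binomial distributions with parameters
  \<open>\<lambda>\<close>, \<open>\<lambda>\<close> and \<open>\<lambda>^2\<close> after multiplication by a power of \<open>\<lambda>\<close> that is the same for all \<open>j\<close>; this is where
  \<open>\<mu> = \<lambda>^(-5)\<close> comes from. All three distributions concentrate at \<open>j = \<lambda> n\<close>, so the local
  limit theorem turns the sum into a Gaussian integral (lemma \<open>pmf_term_sum_limit\<close>), whose value gives
  the constant \<open>A\<close>.
\<close>

section \<open>Semi-Baxter permutations as a generating tree\<close>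

definition lift :: "nat \<Rightarrow> nat \<Rightarrow> nat" where
  "lift a v = (if v \<ge> a then v + 1 else v)"

definition append_value :: "nat \<Rightarrow> nat \<Rightarrow> (nat \<Rightarrow> nat) \<Rightarrow> nat \<Rightarrow> nat" where
  "append_value n a \<sigma> i = (if i = n + 1 then a else if i \<in> {1..n} then lift a (\<sigma> i) else i)"

text \<open>
  A new last entry can only play the part of \<open>\<sigma> k\<close> in the forbidden pattern. So the value \<open>a\<close> may be
  appended unless some descent \<open>\<sigma> j > \<sigma> (j + 1)\<close> of the permutation straddles both an entry to
  its left and, above that entry, the gap just below \<open>a\<close>.
\<close>

definition active :: "nat \<Rightarrow> (nat \<Rightarrow> nat) \<Rightarrow> nat \<Rightarrow> bool" where
  "active n \<sigma> a \<longleftrightarrow> \<not> (\<exists>i j. 1 \<le> i \<and> i < j \<and> j + 1 \<le> n \<and> \<sigma> (j + 1) < \<sigma> i \<and> \<sigma> i < a \<and> a \<le> \<sigma> j)"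

definition low_sites :: "nat \<Rightarrow> (nat \<Rightarrow> nat) \<Rightarrow> nat set" where
  "low_sites n \<sigma> = {a \<in> {1..n + 1}. active n \<sigma> a \<and> a \<le> \<sigma> n}"

definition high_sites :: "nat \<Rightarrow> (nat \<Rightarrow> nat) \<Rightarrow> nat set" where
  "high_sites n \<sigma> = {a \<in> {1..n + 1}. active n \<sigma> a \<and> a > \<sigma> n}"

lemma lift_less_iff [simp]: "lift a x < lift a y \<longleftrightarrow> x < y"
  by (auto simp: lift_def)

lemma lift_less_low: "b \<le> a \<Longrightarrow> lift a x < b \<longleftrightarrow> x < b"
  by (auto simp: lift_def)

lemma le_lift_low: "b \<le> a \<Longrightarrow> b \<le> lift a y \<longleftrightarrow> b \<le> y"
  by (auto simp: lift_def)

lemma lift_less_high: "a \<le> b \<Longrightarrow> lift a x < Suc b \<longleftrightarrow> x < b"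
  by (auto simp: lift_def)

lemma le_lift_high: "a \<le> b \<Longrightarrow> Suc b \<le> lift a y \<longleftrightarrow> b \<le> y"
  by (auto simp: lift_def)

lemma append_value_old: "i \<in> {1..n} \<Longrightarrow> append_value n a \<sigma> i = lift a (\<sigma> i)"
  by (simp add: append_value_def)

lemma append_value_new [simp]: "append_value n a \<sigma> (Suc n) = a"
  by (simp add: append_value_def)

lemma permutes_if_endo:
  assumes "finite S" "inj_on f S" "f ` S \<subseteq> S" "\<And>x. x \<notin> S \<Longrightarrow> f x = x"
  shows "f permutes S"
  using assms endo_inj_surj[of S f] by (intro bij_imp_permutes) (auto simp: bij_betw_def)

lemma append_value_permutes:
  assumes "\<sigma> permutes {1..n}" "a \<in> {1..n + 1}"
  shows "append_value n a \<sigma> permutes {1..n + 1}"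
proof (rule permutes_if_endo)
  have r: "\<sigma> i \<in> {1..n}" if "i \<in> {1..n}" for i
    using permutes_in_image[OF assms(1)] that by blast
  show "append_value n a \<sigma> ` {1..n + 1} \<subseteq> {1..n + 1}"
    using r assms(2) by (force simp: append_value_def lift_def)
  have ne: "lift a v \<noteq> a" for v by (auto simp: lift_def)
  have inj: "x = y" if "lift a (\<sigma> x) = lift a (\<sigma> y)" for x y
  proof -
    have "\<sigma> x = \<sigma> y" using that by (auto simp: lift_def split: if_splits)
    then show ?thesis using permutes_inj[OF assms(1)] by (auto dest: injD)
  qed
  show "inj_on (append_value n a \<sigma>) {1..n + 1}"
    by (rule inj_onI) (auto simp: append_value_def ne ne[symmetric] dest: inj split: if_splits)
qed (auto simp: append_value_def)

text \<open>
  Occurrences that avoid the new entry are those of \<open>\<sigma>\<close>, because \<open>lift a\<close> preserves the order; in the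
  others the new entry is the rightmost one, and these are excluded by \<open>active\<close>.
\<close>

lemma semi_baxter_append_value:
  assumes \<sigma>: "\<sigma> permutes {1..n}" and a: "a \<in> {1..n + 1}"
  shows "semi_baxter (n + 1) (append_value n a \<sigma>) \<longleftrightarrow> semi_baxter n \<sigma> \<and> active n \<sigma> a"
proof -
  let ?\<tau> = "append_value n a \<sigma>"
  have old: "?\<tau> (j + 1) < ?\<tau> i \<and> ?\<tau> i < ?\<tau> k \<and> ?\<tau> k < ?\<tau> j \<longleftrightarrow>
      \<sigma> (j + 1) < \<sigma> i \<and> \<sigma> i < \<sigma> k \<and> \<sigma> k < \<sigma> j"
    if "1 \<le> i" "i < j" "j + 1 < k" "k \<le> n" for i j k
    using that by (simp add: append_value_old)
  have new: "?\<tau> (j + 1) < ?\<tau> i \<and> ?\<tau> i < ?\<tau> (n + 1) \<and> ?\<tau> (n + 1) < ?\<tau> j \<longleftrightarrow>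
      \<sigma> (j + 1) < \<sigma> i \<and> \<sigma> i < a \<and> a \<le> \<sigma> j"
    if "1 \<le> i" "i < j" "j + 1 \<le> n" for i j
    using that by (auto simp: append_value_old) (auto simp: lift_def split: if_splits)
  have "(\<exists>i j k. 1 \<le> i \<and> i < j \<and> j + 1 < k \<and> k \<le> n + 1 \<and> ?\<tau> (j + 1) < ?\<tau> i \<and> ?\<tau> i < ?\<tau> k
      \<and> ?\<tau> k < ?\<tau> j)
    \<longleftrightarrow> (\<exists>i j k. 1 \<le> i \<and> i < j \<and> j + 1 < k \<and> k \<le> n \<and> ?\<tau> (j + 1) < ?\<tau> i \<and> ?\<tau> i < ?\<tau> k \<and> ?\<tau> k < ?\<tau> j)
      \<or> (\<exists>i j. 1 \<le> i \<and> i < j \<and> j + 1 \<le> n \<and> ?\<tau> (j + 1) < ?\<tau> i \<and> ?\<tau> i < ?\<tau> (n + 1) \<and> ?\<tau> (n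
          + 1) < ?\<tau> j)"
    (is "?A \<longleftrightarrow> ?B \<or> ?C")
  proof
    assume ?A
    then obtain i j k where *: "1 \<le> i" "i < j" "j + 1 < k" "k \<le> n + 1" "?\<tau> (j
        + 1) < ?\<tau> i" "?\<tau> i < ?\<tau> k" "?\<tau> k < ?\<tau> j"
      by blast
    show "?B \<or> ?C"
    proof (cases "k = n + 1")
      case True
      then have ?C using * by (metis Suc_eq_plus1 less_Suc_eq_le)
      then show ?thesis ..
    next
      case False
      then have "k \<le> n" using * by simp
      then show ?thesis using * by blast
    qed
  next
    assume "?B \<or> ?C"
    then show ?A
    proof
      assume ?B then show ?A by (meson le_SucI le_add1 le_trans)
    next
      assume ?C then show ?A by (metis Suc_eq_plus1 le_refl less_Suc_eq_le)
    qed
  qed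
  also have "?B \<longleftrightarrow> (\<exists>i j k. 1 \<le> i \<and> i < j \<and> j + 1 < k \<and> k \<le> n \<and> \<sigma> (j + 1) < \<sigma> i \<and> \<sigma> i < \<sigma> k
      \<and> \<sigma> k < \<sigma> j)"
    using old by blast
  also have "?C \<longleftrightarrow> \<not> active n \<sigma> a"
    unfolding active_def not_not using new by blast
  finally show ?thesis
    using append_value_permutes[OF assms] \<sigma> unfolding semi_baxter_def by blast
qed

lemma ex_append_value:
  assumes "\<tau> permutes {1..n + 1}"
  obtains \<sigma> where "\<sigma> permutes {1..n}" "\<tau> (n + 1) \<in> {1..n + 1}" "append_value n (\<tau> (n + 1)) \<sigma> = \<tau>"
proof -
  define a where "a = \<tau> (n + 1)"
  define \<sigma> where "\<sigma> i = (if i \<in> {1..n} then (if \<tau> i > a then \<tau> i - 1 else \<tau> i) else i)" for i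
  have a: "a \<in> {1..n + 1}"
    unfolding a_def using permutes_in_image[OF assms, of "n + 1"] by auto
  have r: "\<tau> i \<in> {1..n + 1}" "\<tau> i \<noteq> a" if "i \<in> {1..n}" for i
    using permutes_in_image[OF assms, of i] that injD[OF permutes_inj[OF assms], of i "n + 1"]
    by (auto simp: a_def)
  have \<sigma>: "\<sigma> permutes {1..n}"
  proof (rule permutes_if_endo)
    show "inj_on \<sigma> {1..n}"
    proof (rule inj_onI)
      fix x y assume xy: "x \<in> {1..n}" "y \<in> {1..n}" "\<sigma> x = \<sigma> y"
      then have "\<tau> x = \<tau> y" using r[of x] r[of y] by (auto simp: \<sigma>_def split: if_splits)
      then show "x = y" using permutes_inj[OF assms] by (auto dest: injD)
    qed
    have "\<sigma> i \<in> {1..n}" if "i \<in> {1..n}" for i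
      using r[OF that] that a by (auto simp: \<sigma>_def)
    then show "\<sigma> ` {1..n} \<subseteq> {1..n}" by blast
  qed (auto simp: \<sigma>_def)
  have "append_value n a \<sigma> i = \<tau> i" for i
  proof (cases "i \<in> {1..n}")
    case True
    then show ?thesis using r[OF True] by (auto simp: append_value_def \<sigma>_def lift_def)
  next
    case False
    then show ?thesis using permutes_not_in[OF assms, of i] by (auto simp: append_value_def a_def)
  qed
  then show thesis using that[OF \<sigma>] a unfolding a_def by blast
qed

lemma semi_baxter_Suc_bij:
  "bij_betw (\<lambda>(\<sigma>, a). append_value n a \<sigma>)
     (SIGMA \<sigma>:{\<sigma>. semi_baxter n \<sigma>}. {a \<in> {1..n + 1}. active n \<sigma> a}) {\<tau>. semi_baxter (n + 1) \<tau>}"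
proof (rule bij_betw_imageI)
  show "inj_on (\<lambda>(\<sigma>, a). append_value n a \<sigma>) (SIGMA \<sigma>:{\<sigma>. semi_baxter n \<sigma>}. {a \<in> {1..n
      + 1}. active n \<sigma> a})"
  proof (rule inj_onI, clarify)
    fix \<sigma> a \<sigma>' a'
    assume s: "semi_baxter n \<sigma>" "semi_baxter n \<sigma>'" and eq: "append_value n a \<sigma>
        = append_value n a' \<sigma>'"
    have aa: "a = a'" using fun_cong[OF eq, of "n + 1"] by simp
    have "\<sigma> i = \<sigma>' i" for i
    proof (cases "i \<in> {1..n}")
      case True
      then show ?thesis using fun_cong[OF eq, of i] aa
        by (auto simp: append_value_old lift_def split: if_splits)
    next
      case False
      then show ?thesis using s permutes_not_in unfolding semi_baxter_def by metis
    qed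
    then show "\<sigma> = \<sigma>' \<and> a = a'" using aa by auto
  qed
  show "(\<lambda>(\<sigma>, a). append_value n a \<sigma>) ` (SIGMA \<sigma>:{\<sigma>. semi_baxter n \<sigma>}. {a \<in> {1..n
      + 1}. active n \<sigma> a}) = {\<tau>. semi_baxter (n + 1) \<tau>}"
  proof (intro equalityI subsetI)
    fix \<tau> assume "\<tau> \<in> (\<lambda>(\<sigma>, a). append_value n a \<sigma>) ` (SIGMA \<sigma>:{\<sigma>. semi_baxter n \<sigma>}. {a \<in> {1..n
        + 1}. active n \<sigma> a})"
    then obtain \<sigma> a where "semi_baxter n \<sigma>" "a \<in> {1..n + 1}" "active n \<sigma> a" "\<tau> = append_value n a \<sigma>"
      by auto
    then show "\<tau> \<in> {\<tau>. semi_baxter (n + 1) \<tau>}"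
      using semi_baxter_append_value[of \<sigma> n a] by (simp add: semi_baxter_def)
  next
    fix \<tau> assume "\<tau> \<in> {\<tau>. semi_baxter (n + 1) \<tau>}"
    then have \<tau>: "semi_baxter (n + 1) \<tau>" by simp
    then obtain \<sigma> where \<sigma>: "\<sigma> permutes {1..n}" "\<tau> (n + 1) \<in> {1..n + 1}" "append_value n (\<tau> (n
        + 1)) \<sigma> = \<tau>"
      using ex_append_value unfolding semi_baxter_def by blast
    then have "semi_baxter n \<sigma> \<and> active n \<sigma> (\<tau> (n + 1))"
      using semi_baxter_append_value[OF \<sigma>(1,2)] \<tau> by simp
    then show "\<tau> \<in> (\<lambda>(\<sigma>, a). append_value n a \<sigma>) ` (SIGMA \<sigma>:{\<sigma>. semi_baxter n \<sigma>}. {a \<in> {1..n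
        + 1}. active n \<sigma> a})"
      using \<sigma> by (intro image_eqI[of _ _ "(\<sigma>, \<tau> (n + 1))"]) auto
  qed
qed

text \<open>
  The descents of the longer permutation are those of \<open>\<sigma>\<close> and possibly one from \<open>\<sigma> n\<close> to the new entry;
  the two clauses treat these cases.
\<close>

lemma active_append_value:
  assumes "1 \<le> n"
  shows "active (n + 1) (append_value n a \<sigma>) b \<longleftrightarrow>
    \<not> (\<exists>i j. 1 \<le> i \<and> i < j \<and> j + 1 \<le> n \<and> \<sigma> (j + 1) < \<sigma> i \<and> lift a (\<sigma> i) < b \<and> b \<le> lift a (\<sigma> j))
    \<and> \<not> (\<exists>i. 1 \<le> i \<and> i < n \<and> a < lift a (\<sigma> i) \<and> lift a (\<sigma> i) < b \<and> b \<le> lift a (\<sigma> n))"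
    (is "_ \<longleftrightarrow> \<not> ?A \<and> \<not> ?B")
proof -
  let ?\<tau> = "append_value n a \<sigma>"
  have "(\<exists>i j. 1 \<le> i \<and> i < j \<and> j + 1 \<le> n + 1 \<and> ?\<tau> (j + 1) < ?\<tau> i \<and> ?\<tau> i < b \<and> b \<le> ?\<tau> j) \<longleftrightarrow>
    (\<exists>i j. 1 \<le> i \<and> i < j \<and> j + 1 \<le> n \<and> ?\<tau> (j + 1) < ?\<tau> i \<and> ?\<tau> i < b \<and> b \<le> ?\<tau> j) \<or>
    (\<exists>i. 1 \<le> i \<and> i < n \<and> ?\<tau> (n + 1) < ?\<tau> i \<and> ?\<tau> i < b \<and> b \<le> ?\<tau> n)" (is "?C \<longleftrightarrow> ?D \<or> ?E")
  proof
    assume ?C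
    then obtain i j where *: "1 \<le> i" "i < j" "j + 1 \<le> n + 1" "?\<tau> (j + 1) < ?\<tau> i" "?\<tau> i < b" "b
        \<le> ?\<tau> j" by blast
    show "?D \<or> ?E"
    proof (cases "j = n")
      case True
      then have ?E using * by blast
      then show ?thesis ..
    next
      case False
      then have "j + 1 \<le> n" using * by simp
      then show ?thesis using * by blast
    qed
  next
    assume "?D \<or> ?E"
    then show ?C
    proof
      assume ?D then show ?C by (meson le_SucI le_add1 le_trans)
    next
      assume ?E then show ?C by blast
    qed
  qed
  moreover have "?D \<longleftrightarrow> ?A"
  proof -
    have "?\<tau> (j + 1) < ?\<tau> i \<and> ?\<tau> i < b \<and> b \<le> ?\<tau> j \<longleftrightarrow>
       \<sigma> (j + 1) < \<sigma> i \<and> lift a (\<sigma> i) < b \<and> b \<le> lift a (\<sigma> j)"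
      if "1 \<le> i" "i < j" "j + 1 \<le> n" for i j
      using that by (simp add: append_value_old)
    then show ?thesis by blast
  qed
  moreover have "?E \<longleftrightarrow> ?B"
  proof -
    have "?\<tau> (n + 1) < ?\<tau> i \<and> ?\<tau> i < b \<and> b \<le> ?\<tau> n \<longleftrightarrow>
       a < lift a (\<sigma> i) \<and> lift a (\<sigma> i) < b \<and> b \<le> lift a (\<sigma> n)"
      if "1 \<le> i" "i < n" for i
      using that by (simp add: append_value_old)
    then show ?thesis by blast
  qed
  ultimately show ?thesis unfolding active_def by blast
qed

lemma active_append_value_low:
  assumes "1 \<le> n" "b \<le> a"
  shows "active (n + 1) (append_value n a \<sigma>) b \<longleftrightarrow> active n \<sigma> b"
proof -
  have "\<not> (a < lift a v \<and> v < b)" for v using assms by (auto simp: lift_def)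
  then show ?thesis
    unfolding active_append_value[OF assms(1)] unfolding active_def
      lift_less_low[OF assms(2)] le_lift_low[OF assms(2)]
    by blast
qed

lemma active_append_value_high:
  assumes "1 \<le> n" "a \<le> b"
  shows "active (n + 1) (append_value n a \<sigma>) (Suc b) \<longleftrightarrow>
    active n \<sigma> b \<and> \<not> (\<exists>i. 1 \<le> i \<and> i < n \<and> a \<le> \<sigma> i \<and> \<sigma> i < b \<and> b \<le> \<sigma> n)"
proof -
  have "a < lift a v \<longleftrightarrow> a \<le> v" for v by (auto simp: lift_def)
  then show ?thesis
    unfolding active_append_value[OF assms(1)] unfolding active_def
      lift_less_high[OF assms(2)] le_lift_high[OF assms(2)] by simp
qed

lemma low_sites_append_value:
  assumes "1 \<le> n" "a \<in> {1..n + 1}"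
  shows "low_sites (n + 1) (append_value n a \<sigma>) = {b \<in> {1..n + 1}. active n \<sigma> b \<and> b \<le> a}"
  using assms active_append_value_low[OF assms(1), of _ a \<sigma>]
  by (auto simp: low_sites_def)

lemma high_sites_append_value:
  assumes "1 \<le> n" "a \<in> {1..n + 1}" 
  shows "high_sites (n + 1) (append_value n a \<sigma>) =
    Suc ` {b \<in> {1..n + 1}. active n \<sigma> b \<and> a \<le> b \<and> \<not> (\<exists>i. 1 \<le> i \<and> i < n \<and> a \<le> \<sigma> i \<and> \<sigma> i < b \<and> b
        \<le> \<sigma> n)}"
    (is "_ = Suc ` ?B")
proof -
  have "c \<in> high_sites (n + 1) (append_value n a \<sigma>) \<longleftrightarrow> c \<in> Suc ` ?B" for c
  proof (cases c)
    case 0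
    then show ?thesis by (auto simp: high_sites_def)
  next
    case (Suc b)
    show ?thesis
    proof (cases "a \<le> b")
      case True
      then show ?thesis using Suc assms active_append_value_high[OF assms(1) True, of \<sigma>]
        by (auto simp: high_sites_def image_iff)
    qed (use Suc in \<open>auto simp: high_sites_def\<close>)
  qed
  then show ?thesis by blast
qed

text \<open>
  A value \<open>a \<le> \<sigma> n\<close> creates a descent. If \<open>a < \<sigma> n\<close>, the old entry of value \<open>a\<close>, now raised to
  \<open>a + 1\<close>, lies to its left and blocks all sites from \<open>a + 2\<close> up to the raised \<open>\<sigma> n\<close>. Of the sites above
  the new last entry there remain \<open>a + 1\<close> and the old high sites.
\<close>

lemma labels_append_low:
  assumes "1 \<le> n" "\<sigma> permutes {1..n}" "a \<in> low_sites n \<sigma>"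
  shows "card (low_sites (n + 1) (append_value n a \<sigma>)) = card {b \<in> low_sites n \<sigma>. b \<le> a}"
    and "card (high_sites (n + 1) (append_value n a \<sigma>)) = card (high_sites n \<sigma>) + 1"
proof -
  have a: "a \<in> {1..n + 1}" "active n \<sigma> a" "a \<le> \<sigma> n" using assms(3) by (auto simp: low_sites_def)
  have "low_sites (n + 1) (append_value n a \<sigma>) = {b \<in> low_sites n \<sigma>. b \<le> a}"
    unfolding low_sites_append_value[OF assms(1) a(1)] using a by (auto simp: low_sites_def)
  then show "card (low_sites (n + 1) (append_value n a \<sigma>)) = card {b \<in> low_sites n \<sigma>. b \<le> a}"
      by simp
  have "(a \<le> b \<and> \<not> (\<exists>i. 1 \<le> i \<and> i < n \<and> a \<le> \<sigma> i \<and> \<sigma> i < b \<and> b \<le> \<sigma> n)) \<longleftrightarrow> b = a \<or> b > \<sigma> n" for b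
  proof
    assume L: "a \<le> b \<and> \<not> (\<exists>i. 1 \<le> i \<and> i < n \<and> a \<le> \<sigma> i \<and> \<sigma> i < b \<and> b \<le> \<sigma> n)"
    show "b = a \<or> b > \<sigma> n"
    proof (rule ccontr)
      assume "\<not> (b = a \<or> b > \<sigma> n)"
      then have b: "a < b" "b \<le> \<sigma> n" using L by auto
      have "\<sigma> n \<in> {1..n}" using permutes_in_image[OF assms(2), of n] assms(1) by auto
      then have "a \<in> {1..n}" using a b by auto
      then obtain i where i: "i \<in> {1..n}" "\<sigma> i = a" using permutes_image[OF assms(2)] by
          (metis imageE)
      moreover have "i \<noteq> n" using i b by auto
      ultimately show False using L b by (metis atLeastAtMost_iff le_refl le_neq_implies_less)
    qed
  qed (use a in auto)
  then have "high_sites (n + 1) (append_value n a \<sigma>) = Suc ` insert a (high_sites n \<sigma>)"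
    unfolding high_sites_append_value[OF assms(1) a(1)] using a
    by (auto simp: high_sites_def)
  moreover have "a \<notin> high_sites n \<sigma>" "finite (high_sites n \<sigma>)" using a by
      (auto simp: high_sites_def)
  ultimately show "card (high_sites (n + 1) (append_value n a \<sigma>)) = card (high_sites n \<sigma>) + 1"
    by (simp add: card_image image_iff)
qed

text \<open>
  A value above \<open>\<sigma> n\<close> creates an ascent and blocks nothing. The site \<open>a\<close> itself splits into a low and a
  high site, hence the \<open>+ 1\<close>.
\<close>

lemma labels_append_high:
  assumes "1 \<le> n" "a \<in> high_sites n \<sigma>"
  shows "card (low_sites (n + 1) (append_value n a \<sigma>)) = card (low_sites n \<sigma>)
      + card {b \<in> high_sites n \<sigma>. b \<le> a}"
    and "card (high_sites (n + 1) (append_value n a \<sigma>)) = card (high_sites n \<sigma>) + 1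
        - card {b \<in> high_sites n \<sigma>. b \<le> a}"
proof -
  have a: "a \<in> {1..n + 1}" "active n \<sigma> a" "a > \<sigma> n" using assms(2) by (auto simp: high_sites_def)
  have fin: "finite (low_sites n \<sigma>)" "finite (high_sites n \<sigma>)" by
      (auto simp: low_sites_def high_sites_def)
  have "low_sites (n + 1) (append_value n a \<sigma>) = low_sites n \<sigma> \<union> {b \<in> high_sites n \<sigma>. b \<le> a}"
    unfolding low_sites_append_value[OF assms(1) a(1)] using a by
        (auto simp: low_sites_def high_sites_def)
  moreover have "low_sites n \<sigma> \<inter> {b \<in> high_sites n \<sigma>. b \<le> a} = {}" by
      (auto simp: low_sites_def high_sites_def)
  ultimately show "card (low_sites (n + 1) (append_value n a \<sigma>)) = card (low_sites n \<sigma>)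
      + card {b \<in> high_sites n \<sigma>. b \<le> a}"
    using fin by (simp add: card_Un_disjoint)
  have "high_sites (n + 1) (append_value n a \<sigma>) = Suc ` {b \<in> high_sites n \<sigma>. a \<le> b}"
    unfolding high_sites_append_value[OF assms(1) a(1)] using a by (auto simp: high_sites_def)
  then have "card (high_sites (n + 1) (append_value n a \<sigma>)) = card {b \<in> high_sites n \<sigma>. a \<le> b}"
    by (simp add: card_image)
  moreover have "card {b \<in> high_sites n \<sigma>. a \<le> b} + card {b \<in> high_sites n \<sigma>. b \<le> a}
     = card ({b \<in> high_sites n \<sigma>. a \<le> b} \<union> {b \<in> high_sites n \<sigma>. b \<le> a}) + card
         ({b \<in> high_sites n \<sigma>. a \<le> b} \<inter> {b \<in> high_sites n \<sigma>. b \<le> a})"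
    using fin by (intro card_Un_Int) auto
  moreover have "{b \<in> high_sites n \<sigma>. a \<le> b} \<union> {b \<in> high_sites n \<sigma>. b \<le> a} = high_sites n \<sigma>" by auto
  moreover have "{b \<in> high_sites n \<sigma>. a \<le> b} \<inter> {b \<in> high_sites n \<sigma>. b \<le> a} = {a}" using assms(2)
      by auto
  ultimately show "card (high_sites (n + 1) (append_value n a \<sigma>)) = card (high_sites n \<sigma>) + 1
      - card {b \<in> high_sites n \<sigma>. b \<le> a}"
    by simp
qed

text \<open>
  The labels of the children depend on the chosen site only through its rank among the sites of its kind.
\<close>

lemma sum_rank:
  fixes S :: "'a::linorder set"
  assumes "finite S"
  shows "(\<Sum>a\<in>S. f (card {b \<in> S. b \<le> a})) = (\<Sum>i=1..card S. f i)"
  using assms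
proof (induction S rule: finite_linorder_max_induct)
  case (insert m A)
  have "m \<notin> A" using insert by auto
  moreover have "{b \<in> insert m A. b \<le> m} = insert m A" using insert by auto
  moreover have "{b \<in> insert m A. b \<le> a} = {b \<in> A. b \<le> a}" if "a \<in> A" for a
    using insert that by auto
  ultimately show ?case using insert by (simp add: add.commute)
qed simp

fun descendants :: "nat \<Rightarrow> nat \<Rightarrow> nat \<Rightarrow> nat" where
  "descendants 0 h k = 1"
| "descendants (Suc n) h k = (\<Sum>i=1..h. descendants n i (k + 1)) + (\<Sum>j=1..k. descendants n (h + j)
    (k + 1 - j))"

lemma children_sum:
  assumes "1 \<le> n" "semi_baxter n \<sigma>"
  shows "(\<Sum>a\<in>{a \<in> {1..n + 1}. active n \<sigma> a}. descendants m
      (card (low_sites (n + 1) (append_value n a \<sigma>))) (card (high_sites (n + 1)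
          (append_value n a \<sigma>))))
    = descendants (Suc m) (card (low_sites n \<sigma>)) (card (high_sites n \<sigma>))"
proof -
  let ?L = "low_sites n \<sigma>" and ?H = "high_sites n \<sigma>"
  let ?f = "\<lambda>a. descendants m (card (low_sites (n + 1) (append_value n a \<sigma>))) (card (high_sites
      (n + 1) (append_value n a \<sigma>)))"
  have fin: "finite ?L" "finite ?H" by (auto simp: low_sites_def high_sites_def)
  have "{a \<in> {1..n + 1}. active n \<sigma> a} = ?L \<union> ?H" "?L \<inter> ?H = {}"
    by (auto simp: low_sites_def high_sites_def)
  then have "(\<Sum>a\<in>{a \<in> {1..n + 1}. active n \<sigma> a}. ?f a) = (\<Sum>a\<in>?L. ?f a) + (\<Sum>a\<in>?H. ?f a)"
    using fin by (simp add: sum.union_disjoint)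
  also have "(\<Sum>a\<in>?L. ?f a) = (\<Sum>a\<in>?L. descendants m (card {b \<in> ?L. b \<le> a}) (card ?H + 1))"
    using labels_append_low[OF assms(1)] assms(2) by (intro sum.cong) (auto simp: semi_baxter_def)
  also have "\<dots> = (\<Sum>i=1..card ?L. descendants m i (card ?H + 1))"
    by (rule sum_rank[OF fin(1)])
  also have "(\<Sum>a\<in>?H. ?f a) = (\<Sum>a\<in>?H. descendants m (card ?L + card {b \<in> ?H. b \<le> a}) (card ?H + 1
      - card {b \<in> ?H. b \<le> a}))"
    using labels_append_high[OF assms(1)] by (intro sum.cong) auto
  also have "\<dots> = (\<Sum>j=1..card ?H. descendants m (card ?L + j) (card ?H + 1 - j))"
    by (rule sum_rank[OF fin(2)])
  finally show ?thesis by simp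
qed

lemma finite_semi_baxter: "finite {\<sigma>. semi_baxter n \<sigma>}"
  by (rule finite_subset[OF _ finite_permutations[of "{1..n}"]]) (auto simp: semi_baxter_def)

lemma SB_eq_sum_descendants:
  assumes "1 \<le> n"
  shows "SB (n + m) = (\<Sum>\<sigma> | semi_baxter n \<sigma>. descendants m (card (low_sites n \<sigma>)) (card
      (high_sites n \<sigma>)))"
  using assms
proof (induction m arbitrary: n)
  case 0
  then show ?case by (simp add: SB_def)
next
  case (Suc m)
  have "SB (n + Suc m) = (\<Sum>\<tau> | semi_baxter (n + 1) \<tau>. descendants m (card (low_sites (n + 1) \<tau>))
      (card (high_sites (n + 1) \<tau>)))"
    using Suc.IH[of "n + 1"] by simp
  also have "\<dots> = (\<Sum>(\<sigma>, a)\<in>(SIGMA \<sigma>:{\<sigma>. semi_baxter n \<sigma>}. {a \<in> {1..n + 1}. active n \<sigma> a}).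
      descendants m (card (low_sites (n + 1) (append_value n a \<sigma>))) (card (high_sites (n + 1)
          (append_value n a \<sigma>))))"
    by (subst sum.reindex_bij_betw[OF semi_baxter_Suc_bij, symmetric]) (simp add: case_prod_unfold)
  also have "\<dots> = (\<Sum>\<sigma> | semi_baxter n \<sigma>. \<Sum>a\<in>{a \<in> {1..n + 1}. active n \<sigma> a}.
      descendants m (card (low_sites (n + 1) (append_value n a \<sigma>))) (card (high_sites (n + 1)
          (append_value n a \<sigma>))))"
    using finite_semi_baxter by (subst sum.Sigma) auto
  also have "\<dots> = (\<Sum>\<sigma> | semi_baxter n \<sigma>. descendants (Suc m) (card (low_sites n \<sigma>)) (card
      (high_sites n \<sigma>)))"
    using children_sum[OF Suc.prems] by (intro sum.cong) auto
  finally show ?case .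
qed

lemma SB_eq_descendants: "SB (Suc m) = descendants m 1 1"
proof -
  have "{\<sigma>. semi_baxter 1 \<sigma>} = {id}"
    by (auto simp: semi_baxter_def)
  moreover have "low_sites 1 id = {1}" "high_sites 1 id = {2}"
    by (auto simp: low_sites_def high_sites_def active_def)
  ultimately show ?thesis using SB_eq_sum_descendants[of 1 m] by simp
qed

section \<open>A residue symbol and its two symmetries\<close>

text \<open>
  Integer indices, with value 0 below, make Pascal's rule and shifts of summation indices
  hold without exceptions.
\<close>

definition zbinom :: "int \<Rightarrow> int \<Rightarrow> real" where
  "zbinom x k = (if k < 0 then 0 else of_int x gchoose nat k)"

lemma zbinom_neg [simp]: "k < 0 \<Longrightarrow> zbinom x k = 0"
  by (simp add: zbinom_def)

lemma zbinom_0_right [simp]: "zbinom x 0 = 1"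
  by (simp add: zbinom_def)

lemma zbinom_0_left: "zbinom 0 k = (if k = 0 then 1 else 0)"
proof (cases "k > 0")
  case True
  then obtain m where "nat k = Suc m" by (metis gr0_implies_Suc zero_less_nat_eq)
  then show ?thesis using True by (simp add: zbinom_def gbinomial_Suc)
qed (auto simp: zbinom_def)

lemma zbinom_Pascal: "zbinom (x + 1) k = zbinom x k + zbinom x (k - 1)"
proof (cases "k \<ge> 1")
  case True
  then have "nat k = Suc (nat (k - 1))" by simp
  moreover have "(of_int x + 1 :: real) gchoose Suc m = (of_int x gchoose m) +
      (of_int x gchoose Suc m)" for m
    by (rule gbinomial_Suc_Suc)
  ultimately show ?thesis using True by (simp add: zbinom_def)
qed (auto simp: zbinom_def)

lemma zbinom_of_nat: "zbinom (int m) (int k) = real (m choose k)"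
  by (simp add: zbinom_def binomial_gbinomial)

lemma zbinom_eq_0: "0 \<le> x \<Longrightarrow> x < k \<Longrightarrow> zbinom x k = 0"
  using zbinom_of_nat[of "nat x" "nat k"] by simp

lemma zbinom_symmetric: "0 \<le> x \<Longrightarrow> zbinom x (x - k) = zbinom x k"
proof (cases "0 \<le> k \<and> k \<le> x")
  case True
  then obtain i j where ij: "k = int i" "x = int i + int j"
    by (metis nonneg_int_cases zle_iff_zadd)
  then show ?thesis
    using zbinom_of_nat[of "i + j" i] zbinom_of_nat[of "i + j" j] binomial_symmetric[of i "i + j"]
    by simp
qed (auto simp: zbinom_eq_0 not_le)

lemma zbinom_upper_neg:
  "zbinom x k = (-1) powi k * zbinom (k - x - 1) k"
proof (cases "k \<ge> 0")
  case True
  then obtain m where m: "k = int m" by (metis nonneg_int_cases)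
  show ?thesis using gbinomial_negated_upper[of "of_int x :: real" m]
    by (simp add: zbinom_def m power_int_def)
qed simp

text \<open>
  The coefficient of \<open>a^(-1) b^(-1)\<close> in \<open>a^\<alpha> (1 + a)^\<beta> b^\<gamma> (1 + b)^\<delta> (b - a)^\<epsilon>\<close>, where
  \<open>(b - a)^\<epsilon>\<close> is expanded in powers of \<open>a / b\<close>; the summation index is the power of \<open>a / b\<close>. So this is the
  residue of a differential form over a torus \<open>\<bar>a\<bar> < \<bar>b\<bar> < 1\<close>.
\<close>

definition residue :: "int \<Rightarrow> int \<Rightarrow> int \<Rightarrow> int \<Rightarrow> int \<Rightarrow> real" where
  "residue \<alpha> \<beta> \<gamma> \<delta> \<epsilon> = (\<Sum>l\<in>{0..-1-\<alpha>}. (-1) powi l * zbinom \<epsilon> l *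
     zbinom \<beta> (-1-\<alpha>-l) * zbinom \<delta> (l-1-\<gamma>-\<epsilon>))"

lemma residue_superset:
  assumes "finite I" "{0..-1-\<alpha>} \<subseteq> I"
  shows "residue \<alpha> \<beta> \<gamma> \<delta> \<epsilon> = (\<Sum>l\<in>I. (-1) powi l * zbinom \<epsilon> l *
     zbinom \<beta> (-1-\<alpha>-l) * zbinom \<delta> (l-1-\<gamma>-\<epsilon>))"
  unfolding residue_def using assms by (intro sum.mono_neutral_left) (auto simp: not_le)

text \<open>
  The three Pascal rules express \<open>y = 1 + a\<close>, \<open>z = 1 + b\<close> and \<open>d = b - a\<close> under the residue.
\<close>

lemma residue_Pascal_y: "residue \<alpha> (\<beta> + 1) \<gamma> \<delta> \<epsilon> = residue \<alpha> \<beta> \<gamma> \<delta> \<epsilon> + residue (\<alpha> + 1) \<beta> \<gamma> \<delta> \<epsilon>"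
proof -
  let ?I = "{0..-1-\<alpha>}"
  have *: "residue (\<alpha> + 1) \<beta> \<gamma> \<delta> \<epsilon> = (\<Sum>l\<in>?I. (-1) powi l * zbinom \<epsilon> l *
     zbinom \<beta> (-1-(\<alpha>+1)-l) * zbinom \<delta> (l-1-\<gamma>-\<epsilon>))"
    by (rule residue_superset) auto
  have e: "-1-(\<alpha>+1)-l = -1-\<alpha>-l-1" for l by simp
  show ?thesis unfolding * unfolding residue_def e zbinom_Pascal
    by (simp only: distrib_left distrib_right sum.distrib)
qed

lemma residue_Pascal_z: "residue \<alpha> \<beta> \<gamma> (\<delta> + 1) \<epsilon> = residue \<alpha> \<beta> \<gamma> \<delta> \<epsilon> + residue \<alpha> \<beta> (\<gamma> + 1) \<delta> \<epsilon>"
proof -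
  have e: "l-1-(\<gamma>+1)-\<epsilon> = l-1-\<gamma>-\<epsilon>-1" for l by simp
  show ?thesis unfolding residue_def e zbinom_Pascal
    by (simp only: distrib_left distrib_right sum.distrib)
qed

lemma residue_Pascal_d: "residue \<alpha> \<beta> \<gamma> \<delta> (\<epsilon> + 1) = residue \<alpha> \<beta> (\<gamma> + 1) \<delta> \<epsilon> - residue (\<alpha>
    + 1) \<beta> \<gamma> \<delta> \<epsilon>"
proof -
  define f where "f l = (-1) powi l * zbinom \<epsilon> l * zbinom \<beta> (-1-(\<alpha>+1)-l) * zbinom \<delta> (l-1-\<gamma>-\<epsilon>)" for l
  have 1: "residue (\<alpha> + 1) \<beta> \<gamma> \<delta> \<epsilon> = (\<Sum>l\<in>{-1..-2-\<alpha>}. f l)"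
    unfolding f_def by (rule residue_superset) auto
  also have "\<dots> = (\<Sum>l\<in>{0..-1-\<alpha>}. f (l - 1))"
    by (rule sum.reindex_bij_witness[of _ "\<lambda>l. l - 1" "\<lambda>l. l + 1"]) auto
  finally have *: "residue (\<alpha> + 1) \<beta> \<gamma> \<delta> \<epsilon> = (\<Sum>l\<in>{0..-1-\<alpha>}. f (l - 1))" .
  have **: "f (l - 1) = - ((-1) powi l * zbinom \<epsilon> (l - 1) * zbinom \<beta> (-1-\<alpha>-l) * zbinom \<delta>
      (l-1-\<gamma>-(\<epsilon>+1)))" for l
  proof -
    have e: "-1-(\<alpha>+1)-(l-1) = -1-\<alpha>-l" "l-1-1-\<gamma>-\<epsilon> = l-1-\<gamma>-(\<epsilon>+1)" by auto
    have "(-1::real) powi (l - 1) = - ((-1) powi l)"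
      by (simp add: power_int_diff)
    then show ?thesis unfolding f_def e by (simp only: mult_minus_left)
  qed
  have e: "l-1-(\<gamma>+1)-\<epsilon> = l-1-\<gamma>-(\<epsilon>+1)" for l by simp
  show ?thesis unfolding * ** unfolding residue_def e zbinom_Pascal
    by (simp only: distrib_left distrib_right sum.distrib sum_negf minus_minus diff_minus_eq_add)
qed

lemma residue_eq_0: "\<alpha> \<ge> 0 \<Longrightarrow> residue \<alpha> \<beta> \<gamma> \<delta> \<epsilon> = 0"
  by (simp add: residue_def)

lemma residue_eq_0': "\<alpha> + \<gamma> + \<epsilon> + 1 \<ge> 0 \<Longrightarrow> residue \<alpha> \<beta> \<gamma> \<delta> \<epsilon> = 0"
  unfolding residue_def by (intro sum.neutral) auto

lemma zbinom_Vandermonde: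
  assumes "finite I" "{0..M} \<subseteq> I"
  shows "(\<Sum>l\<in>I. zbinom x l * zbinom y (M - l)) = zbinom (x + y) M"
proof (cases "M \<ge> 0")
  case True
  then obtain m where m: "M = int m" by (metis nonneg_int_cases)
  have "(\<Sum>l\<in>I. zbinom x l * zbinom y (M - l)) = (\<Sum>l\<in>{0..M}. zbinom x l * zbinom y (M - l))"
    using assms by (intro sum.mono_neutral_right) (auto simp: not_le)
  also have "\<dots> = (\<Sum>l\<le>m. zbinom x (int l) * zbinom y (int m - int l))"
    unfolding m by (rule sum.reindex_bij_witness[of _ int nat]) auto
  also have "\<dots> = (\<Sum>l\<le>m. (of_int x gchoose l) * (of_int y gchoose (m - l)))"
    by (intro sum.cong) (auto simp: zbinom_def nat_diff_distrib)
  also have "\<dots> = (of_int x + of_int y) gchoose m"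
    using gbinomial_Vandermonde[of "of_int x :: real" "of_int y" m] by (simp add: atMost_atLeast0)
  finally show ?thesis by (simp add: zbinom_def m)
next
  case False
  then have "zbinom x l * zbinom y (M - l) = 0" for l
    by (cases "l < 0") auto
  then show ?thesis using False by (simp only: sum.neutral_const) simp
qed

lemma zbinom_trinomial:
  assumes "s \<ge> 0"
  shows "zbinom (s + l) l * zbinom x (s + l) = zbinom x s * zbinom (x - s) l"
proof (cases "l \<ge> 0")
  case True
  obtain m k where m: "l = int m" "s = int k" using True assms by (metis nonneg_int_cases)
  have "(of_int x gchoose (k + m)) * ((k + m) choose m) = (of_int x gchoose k) * ((of_int x
      - of_nat k :: real) gchoose m)"
    using gbinomial_trinomial_revision[of k "k + m" "of_int x :: real"] 
      binomial_gbinomial[of "k + m" k, where 'a = real] binomial_symmetric[of m "k+m"]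
    by simp
  moreover have "zbinom (int k + int m) (int m) = real ((k+m) choose m)"
    using zbinom_of_nat[of "k + m" m] by simp
  moreover have "zbinom x (int k + int m) = of_int x gchoose (k + m)"
    by (simp add: zbinom_def nat_add_distrib)
  ultimately show ?thesis by (simp add: zbinom_def m mult.commute)
qed simp

lemma powi_minus_one_sq: "(-1::real) powi l * (-1) powi l = 1"
  by (cases "even l") auto

text \<open>
  On the left only one power of \<open>a / b\<close> contributes; on the right a product of two binomial
  coefficients factors out of the sum and Vandermonde's convolution remains.
\<close>

lemma residue_sigma1_base:
  "residue \<alpha> \<beta> \<gamma> 0 \<epsilon> = residue (\<alpha> + \<gamma> + 1 + \<epsilon>) (\<beta> + 1 + \<epsilon>) 0 \<gamma> (- \<gamma> - 2 - \<epsilon>)"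
proof -
  define s where "s = \<gamma> + \<epsilon> + 1"
  define M where "M = -1-\<alpha>-s"
  have eps: "\<epsilon> = s - \<gamma> - 1" by (simp add: s_def)
  have L: "residue \<alpha> \<beta> \<gamma> 0 \<epsilon> = (if s \<ge> 0 then zbinom \<gamma> s * zbinom \<beta> M else 0)"
  proof -
    have "residue \<alpha> \<beta> \<gamma> 0 \<epsilon> = (\<Sum>l\<in>{0..-1-\<alpha>} \<union> {s}. (-1) powi l * zbinom \<epsilon> l *
       zbinom \<beta> (-1-\<alpha>-l) * zbinom 0 (l-1-\<gamma>-\<epsilon>))"
      by (rule residue_superset) auto
    also have "\<dots> = (\<Sum>l\<in>{s}. (-1) powi l * zbinom \<epsilon> l *
       zbinom \<beta> (-1-\<alpha>-l) * zbinom 0 (l-1-\<gamma>-\<epsilon>))"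
      by (rule sum.mono_neutral_right) (auto simp: zbinom_0_left s_def)
    also have "\<dots> = (-1) powi s * zbinom \<epsilon> s * zbinom \<beta> M"
      by (simp add: zbinom_0_left s_def M_def)
    also have "zbinom \<epsilon> s = (-1) powi s * zbinom (s - \<epsilon> - 1) s"
      by (rule zbinom_upper_neg)
    also have "s - \<epsilon> - 1 = \<gamma>" by (simp add: s_def)
    finally show ?thesis using powi_minus_one_sq[of s] by (simp add: mult.assoc[symmetric])
  qed
  have al: "\<alpha> + \<gamma> + 1 + \<epsilon> = -1 - M" "- \<gamma> - 2 - \<epsilon> = - s - 1" "\<beta> + 1 + \<epsilon> = \<beta> + s - \<gamma>"
    by (auto simp: s_def M_def)
  have R0: "residue (-1-M) (\<beta> + s - \<gamma>) 0 \<gamma> (-s-1) = (\<Sum>l\<in>{0..M}. zbinom (s + l) l * 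
      zbinom (\<beta> + s - \<gamma>) (M - l) * zbinom \<gamma> (s + l))"
  proof -
    have "(-1) powi l * zbinom (- s - 1) l = zbinom (s + l) l" for l
      by (subst zbinom_upper_neg) (use powi_minus_one_sq[of l] in \<open>simp add:
          mult.assoc[symmetric] algebra_simps\<close>)
    then show ?thesis unfolding residue_def by (intro sum.cong) (auto simp: algebra_simps)
  qed
  have R: "\<dots> = (if s \<ge> 0 then zbinom \<gamma> s * zbinom \<beta> M else 0)"
  proof (cases "s \<ge> 0")
    case True
    have "zbinom (s + l) l * zbinom (\<beta> + s - \<gamma>) (M - l) * zbinom \<gamma> (s + l)
       = zbinom \<gamma> s * (zbinom (\<gamma> - s) l * zbinom (\<beta> + s - \<gamma>) (M - l))" for l
      using zbinom_trinomial[OF True, of l \<gamma>] by (simp add: mult_ac)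
    then have "(\<Sum>l\<in>{0..M}. zbinom (s + l) l * zbinom (\<beta> + s - \<gamma>) (M - l) * zbinom \<gamma> (s + l))
       = zbinom \<gamma> s * (\<Sum>l\<in>{0..M}. zbinom (\<gamma> - s) l * zbinom (\<beta> + s - \<gamma>) (M - l))"
      by (simp only: sum_distrib_left)
    then show ?thesis using True zbinom_Vandermonde[of "{0..M}" M "\<gamma> - s" "\<beta> + s - \<gamma>"]
      by simp
  next
    case False
    have "zbinom (s + l) l * zbinom (\<beta> + s - \<gamma>) (M - l) * zbinom \<gamma> (s + l) = 0" if "l \<ge> 0" for l
      using that False by (cases "s + l \<ge> 0") (auto simp: zbinom_eq_0)
    then show ?thesis using False by (auto intro!: sum.neutral)
  qed
  show ?thesis unfolding L al R0 R ..
qed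

text \<open>
  The identity \<open>z = 1 + b\<close> becomes \<open>y b / d = 1 + a z / d\<close> under \<open>\<sigma>1\<close>, that is \<open>y b = d + a z\<close>, which follows
  from the Pascal rules.
\<close>

lemma residue_sigma1_step:
  "residue (\<alpha>+\<gamma>+1+\<epsilon>) (\<beta>+(\<delta>+1)+1+\<epsilon>) (\<delta>+1) \<gamma> (-\<gamma>-(\<delta>+1)-2-\<epsilon>)
    = residue (\<alpha>+\<gamma>+1+\<epsilon>) (\<beta>+\<delta>+1+\<epsilon>) \<delta> \<gamma> (-\<gamma>-\<delta>-2-\<epsilon>)
    + residue (\<alpha>+(\<gamma>+1)+1+\<epsilon>) (\<beta>+\<delta>+1+\<epsilon>) \<delta> (\<gamma>+1) (-(\<gamma>+1)-\<delta>-2-\<epsilon>)"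
proof -
  define a b c where "a = \<alpha>+\<gamma>+1+\<epsilon>" and "b = \<beta>+\<delta>+1+\<epsilon>" and "c = -\<gamma>-\<delta>-3-\<epsilon>"
  have e: "\<alpha>+\<gamma>+1+\<epsilon> = a" "\<beta>+(\<delta>+1)+1+\<epsilon> = b + 1" "-\<gamma>-(\<delta>+1)-2-\<epsilon> = c" "\<beta>+\<delta>+1+\<epsilon> = b"
    "-\<gamma>-\<delta>-2-\<epsilon> = c + 1" "-(\<gamma>+1)-\<delta>-2-\<epsilon> = c" "\<alpha>+(\<gamma>+1)+1+\<epsilon> = a + 1"
    by (auto simp: a_def b_def c_def)
  show ?thesis unfolding e residue_Pascal_y residue_Pascal_z residue_Pascal_d by simp
qed

text \<open>
  Invariance under the substitution \<open>\<sigma>1\<close>, which maps the annulus \<open>\<bar>a\<bar> < \<bar>b\<bar> < 1\<close> for \<open>b\<close> to itself up to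
  homotopy and changes the form \<open>da db / (y z b)\<close> by a sign that the reversed orientation undoes. The
  exponents include this form, hence the constants in them. Both sides satisfy the same
  Pascal rule in \<open>\<delta>\<close>. For negative \<open>\<delta>\<close> this rule is used backwards, which raises \<open>\<gamma>\<close>, until both sides
  vanish.
\<close>

lemma residue_sigma1:
  "residue \<alpha> \<beta> \<gamma> \<delta> \<epsilon> = residue (\<alpha>+\<gamma>+1+\<epsilon>) (\<beta>+\<delta>+1+\<epsilon>) \<delta> \<gamma> (-\<gamma>-\<delta>-2-\<epsilon>)"
proof (induction \<delta> arbitrary: \<gamma> rule: int_induct[where k = 0])
  case base
  show ?case using residue_sigma1_base[of \<alpha> \<beta> \<gamma> \<epsilon>] by simp
next
  case (step1 \<delta>)
  show ?case
    using step1.IH[of \<gamma>] step1.IH[of "\<gamma> + 1"] residue_Pascal_z[of \<alpha> \<beta> \<gamma> \<delta> \<epsilon>]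
      residue_sigma1_step[of \<alpha> \<gamma> \<epsilon> \<beta> \<delta>] by linarith
next
  case (step2 \<delta>)
  define P where "P \<gamma> \<delta> \<longleftrightarrow> residue \<alpha> \<beta> \<gamma> \<delta> \<epsilon> = residue (\<alpha>+\<gamma>+1+\<epsilon>) (\<beta>+\<delta>+1+\<epsilon>) \<delta> \<gamma> (-\<gamma>-\<delta>-2-\<epsilon>)" for \<gamma> \<delta>
  have stp: "P \<gamma> (\<delta> - 1)" if "P (\<gamma> + 1) (\<delta> - 1)" for \<gamma>
    using residue_Pascal_z[of \<alpha> \<beta> \<gamma> "\<delta> - 1" \<epsilon>] residue_sigma1_step[of \<alpha> \<gamma> \<epsilon> \<beta> "\<delta>
        - 1"] step2.IH[of \<gamma>] that
    unfolding P_def by simp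
  have big: "P \<gamma> (\<delta> - 1)" if "\<gamma> \<ge> -1-\<alpha>-\<epsilon>" for \<gamma>
    unfolding P_def using that by (simp add: residue_eq_0 residue_eq_0')
  have "P \<gamma> (\<delta> - 1)"
  proof (cases "\<gamma> \<le> -1-\<alpha>-\<epsilon>")
    case True
    then show ?thesis
    proof (induction \<gamma> rule: int_le_induct)
      case base show ?case by (rule big) simp
    next
      case (step i) then show ?case using stp[of "i - 1"] by simp
    qed
  qed (use big in simp)
  then show ?case unfolding P_def .
qed

text \<open>
  Once more only one term survives on the left; the right-hand side reduces to Vandermonde's
  convolution by trinomial revision.
\<close>

lemma residue_sigma2_base:
  assumes "-\<alpha>-\<epsilon>-2 \<ge> 0"
  shows "residue \<alpha> 0 \<gamma> \<delta> \<epsilon> = residue \<epsilon> (-\<alpha>-\<epsilon>-2) \<gamma> (\<delta> + 1 + \<epsilon>) \<alpha>"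
proof -
  define N M where "N = -1-\<alpha>" and "M = -1-\<epsilon>"
  have NM: "N + M \<ge> 0" using assms by (simp add: N_def M_def)
  have al: "\<alpha> = -1-N" "\<epsilon> = -1-M" "-\<alpha>-\<epsilon>-2 = N + M" "\<delta> + 1 + \<epsilon> = \<delta> - M"
    by (auto simp: N_def M_def)
  have L: "residue \<alpha> 0 \<gamma> \<delta> \<epsilon> = zbinom (N + M) N * zbinom \<delta> (N + M - \<gamma>)"
  proof -
    have "residue \<alpha> 0 \<gamma> \<delta> \<epsilon> = (\<Sum>l\<in>{0..-1-\<alpha>} \<union> {N}. (-1) powi l * zbinom \<epsilon> l *
       zbinom 0 (-1-\<alpha>-l) * zbinom \<delta> (l-1-\<gamma>-\<epsilon>))"
      by (rule residue_superset) auto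
    also have "\<dots> = (\<Sum>l\<in>{N}. (-1) powi l * zbinom \<epsilon> l *
       zbinom 0 (-1-\<alpha>-l) * zbinom \<delta> (l-1-\<gamma>-\<epsilon>))"
      by (rule sum.mono_neutral_right) (auto simp: zbinom_0_left N_def)
    also have "\<dots> = (-1) powi N * zbinom \<epsilon> N * zbinom \<delta> (N - 1 - \<gamma> - \<epsilon>)"
      by (simp add: zbinom_0_left N_def)
    also have "zbinom \<epsilon> N = (-1) powi N * zbinom (N - \<epsilon> - 1) N"
      by (rule zbinom_upper_neg)
    also have "N - \<epsilon> - 1 = N + M" by (simp add: M_def)
    also have "N - 1 - \<gamma> - \<epsilon> = N + M - \<gamma>" by (simp add: M_def)
    finally show ?thesis using powi_minus_one_sq[of N] by (simp add: mult.assoc[symmetric])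
  qed
  have R: "residue \<epsilon> (-\<alpha>-\<epsilon>-2) \<gamma> (\<delta> + 1 + \<epsilon>) \<alpha> = (\<Sum>l\<in>{0..M}. zbinom (N + l) l * zbinom (N + M) (N
      + l) * zbinom (\<delta> - M) (l + N - \<gamma>))"
  proof -
    have "(-1) powi l * zbinom (-1-N) l = zbinom (N + l) l" for l
      by (subst zbinom_upper_neg) (use powi_minus_one_sq[of l] in \<open>simp add:
          mult.assoc[symmetric] algebra_simps\<close>)
    moreover have "zbinom (N + M) (M - l) = zbinom (N + M) (N + l)" for l
      using zbinom_symmetric[OF NM, of "N + l"] by (simp add: algebra_simps)
    ultimately show ?thesis unfolding al residue_def by (intro sum.cong) (auto simp: algebra_simps)
  qed
  show ?thesis
  proof (cases "N \<ge> 0 \<and> M \<ge> 0")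
    case True
    have "residue \<epsilon> (-\<alpha>-\<epsilon>-2) \<gamma> (\<delta> + 1 + \<epsilon>) \<alpha> =
        zbinom (N + M) N * (\<Sum>l\<in>{0..M}. zbinom M l * zbinom (\<delta> - M) (l + N - \<gamma>))"
      unfolding R sum_distrib_left
      using True zbinom_trinomial[of N _ "N + M"] by (intro sum.cong) (auto simp: mult_ac)
    also have "(\<Sum>l\<in>{0..M}. zbinom M l * zbinom (\<delta> - M) (l + N - \<gamma>)) =
        (\<Sum>l\<in>{0..M}. zbinom M l * zbinom (\<delta> - M) (N + M - \<gamma> - l))"
      using zbinom_symmetric[of M] True
      by (intro sum.reindex_bij_witness[of _ "\<lambda>l. M - l" "\<lambda>l. M - l"]) (auto simp: algebra_simps)
    also have "\<dots> = (\<Sum>l\<in>{0..M} \<union> {0..N + M - \<gamma>}. zbinom M l * zbinom (\<delta> - M) (N + M - \<gamma> - l))"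
      using True by (intro sum.mono_neutral_left) (auto simp: zbinom_eq_0)
    also have "\<dots> = zbinom \<delta> (N + M - \<gamma>)"
      by (subst zbinom_Vandermonde) auto
    finally show ?thesis unfolding L ..
  next
    case False
    have "zbinom (N + l) l * zbinom (N + M) (N + l) * zbinom (\<delta> - M) (l + N - \<gamma>) = 0"
      if "l \<in> {0..M}" for l
      using that False by (cases "N + l \<ge> 0") (auto simp: zbinom_eq_0)
    then have "(\<Sum>l\<in>{0..M}. zbinom (N + l) l * zbinom (N + M) (N + l) * zbinom (\<delta> - M) (l + N
        - \<gamma>)) = 0"
      by (intro sum.neutral) blast
    moreover have "zbinom (N + M) N = 0"
      using False NM by (cases "N < 0") (auto simp: zbinom_eq_0)
    ultimately show ?thesis unfolding L R by simp
  qed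
qed

text \<open>
  The substitution \<open>\<sigma>2\<close> moves the pole at \<open>a = 0\<close> to the one at \<open>a = b\<close>. The residues in \<open>a\<close> at these
  two points add up to 0 if there is no pole at \<open>a = -1\<close>, where \<open>y = 0\<close>, and none at infinity: these
  are the two assumptions.
\<close>

lemma residue_sigma2:
  assumes "\<beta> \<ge> 0" "-\<alpha>-\<beta>-\<epsilon>-2 \<ge> 0"
  shows "residue \<alpha> \<beta> \<gamma> \<delta> \<epsilon> = residue \<epsilon> (-\<alpha>-\<beta>-\<epsilon>-2) \<gamma> (\<delta> + \<beta> + 1 + \<epsilon>) \<alpha>"
  using assms
proof (induction \<beta> arbitrary: \<alpha> rule: int_ge_induct)
  case base
  then show ?case using residue_sigma2_base[of \<alpha> \<epsilon> \<gamma> \<delta>] by simp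
next
  case (step \<beta>)
  define b where "b = -\<alpha>-(\<beta>+1)-\<epsilon>-2"
  define d where "d = \<delta>+\<beta>+1+\<epsilon>"
  have e: "-\<alpha>-\<beta>-\<epsilon>-2 = b + 1" "-(\<alpha>+1)-\<beta>-\<epsilon>-2 = b" "\<delta>+(\<beta>+1)+1+\<epsilon> = d + 1" "\<delta>+\<beta>+1+\<epsilon> = d"
    by (auto simp: b_def d_def)
  have b: "b \<ge> 0" "b + 1 \<ge> 0" using step.prems by (simp_all add: b_def)
  have "residue \<alpha> \<beta> \<gamma> \<delta> \<epsilon> = residue \<epsilon> (b + 1) \<gamma> d \<alpha>"
    using step.IH[of \<alpha>] b unfolding e by simp
  moreover have "residue (\<alpha> + 1) \<beta> \<gamma> \<delta> \<epsilon> = residue \<epsilon> b \<gamma> d (\<alpha> + 1)"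
    using step.IH[of "\<alpha> + 1"] b unfolding e by simp
  moreover have "residue \<epsilon> (b + 1) \<gamma> d \<alpha> + residue \<epsilon> b \<gamma> d (\<alpha> + 1) = residue \<epsilon> b \<gamma> (d + 1) \<alpha>"
    by (simp add: residue_Pascal_y residue_Pascal_z residue_Pascal_d)
  ultimately show ?case unfolding b_def[symmetric] e using residue_Pascal_y[of \<alpha> \<beta> \<gamma> \<delta> \<epsilon>]
      by linarith
qed

section \<open>Solving the recursion of the tree by reflection\<close>

text \<open>
  The ten monomials are the orbit of \<open>b d / a^3\<close> under the group generated by \<open>\<sigma>1\<close> and \<open>\<sigma>2\<close>,
  listed so that applying \<open>\<sigma>1\<close> and \<open>\<sigma>2\<close> in turn leads from each to the next, and from the last
  back to the first. The orbit is chosen for two features: \<open>y\<close> never occurs with a negative exponent,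
  as \<open>residue_sigma2\<close> requires, and the initial value \<open>tree_poly_0\<close> is 1.
\<close>

definition alt_residue :: "int \<Rightarrow> int \<Rightarrow> int \<Rightarrow> int \<Rightarrow> int \<Rightarrow> real" where
  "alt_residue \<alpha> \<beta> \<gamma> \<delta> \<epsilon> =
     residue (\<alpha> - 3) \<beta> (\<gamma> + 1) \<delta> (\<epsilon> + 1)
     - residue (\<alpha> - 1) (\<beta> + 1) \<gamma> (\<delta> + 1) (\<epsilon> - 2)
     + residue (\<alpha> - 2) (\<beta> + 2) \<gamma> \<delta> (\<epsilon> - 1)
     - residue (\<alpha> - 3) (\<beta> + 1) \<gamma> \<delta> (\<epsilon> + 1)
     + residue (\<alpha> + 1) (\<beta> + 1) \<gamma> (\<delta> + 2) (\<epsilon> - 3)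
     - residue (\<alpha> - 2) \<beta> (\<gamma> + 2) \<delta> (\<epsilon> + 1)
     + residue (\<alpha> + 1) (\<beta> + 1) (\<gamma> + 2) (\<delta> + 1) (\<epsilon> - 2)
     - residue (\<alpha> + 1) \<beta> (\<gamma> + 1) (\<delta> + 2) (\<epsilon> - 1)
     + residue (\<alpha> - 1) \<beta> (\<gamma> + 1) (\<delta> + 1) (\<epsilon> + 1)
     - residue (\<alpha> + 1) (\<beta> + 2) (\<gamma> + 1) (\<delta> + 1) (\<epsilon> - 3)"

lemma residue_cong:
  "\<alpha> = \<alpha>' \<Longrightarrow> \<beta> = \<beta>' \<Longrightarrow> \<gamma> = \<gamma>' \<Longrightarrow> \<delta> = \<delta>' \<Longrightarrow> \<epsilon> = \<epsilon>' \<Longrightarrow>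
    residue \<alpha> \<beta> \<gamma> \<delta> \<epsilon> = residue \<alpha>' \<beta>' \<gamma>' \<delta>' \<epsilon>'"
  by simp

lemma alt_residue_Pascal_y: "alt_residue \<alpha> (\<beta> + 1) \<gamma> \<delta> \<epsilon> = alt_residue \<alpha> \<beta> \<gamma> \<delta> \<epsilon> + alt_residue (\<alpha>
    + 1) \<beta> \<gamma> \<delta> \<epsilon>"
  unfolding alt_residue_def using
    residue_Pascal_y[of "\<alpha> - 3" "\<beta> + 0" "\<gamma> + 1" "\<delta> + 0" "\<epsilon> + 1"]
    residue_Pascal_y[of "\<alpha> - 1" "\<beta> + 1" "\<gamma> + 0" "\<delta> + 1" "\<epsilon> - 2"]
    residue_Pascal_y[of "\<alpha> - 2" "\<beta> + 2" "\<gamma> + 0" "\<delta> + 0" "\<epsilon> - 1"]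
    residue_Pascal_y[of "\<alpha> - 3" "\<beta> + 1" "\<gamma> + 0" "\<delta> + 0" "\<epsilon> + 1"]
    residue_Pascal_y[of "\<alpha> + 1" "\<beta> + 1" "\<gamma> + 0" "\<delta> + 2" "\<epsilon> - 3"]
    residue_Pascal_y[of "\<alpha> - 2" "\<beta> + 0" "\<gamma> + 2" "\<delta> + 0" "\<epsilon> + 1"]
    residue_Pascal_y[of "\<alpha> + 1" "\<beta> + 1" "\<gamma> + 2" "\<delta> + 1" "\<epsilon> - 2"]
    residue_Pascal_y[of "\<alpha> + 1" "\<beta> + 0" "\<gamma> + 1" "\<delta> + 2" "\<epsilon> - 1"]
    residue_Pascal_y[of "\<alpha> - 1" "\<beta> + 0" "\<gamma> + 1" "\<delta> + 1" "\<epsilon> + 1"]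
    residue_Pascal_y[of "\<alpha> + 1" "\<beta> + 2" "\<gamma> + 1" "\<delta> + 1" "\<epsilon> - 3"]
  by (simp add: algebra_simps)

lemma alt_residue_Pascal_z: "alt_residue \<alpha> \<beta> \<gamma> (\<delta> + 1) \<epsilon> = alt_residue \<alpha> \<beta> \<gamma> \<delta> \<epsilon>
    + alt_residue \<alpha> \<beta> (\<gamma> + 1) \<delta> \<epsilon>"
  unfolding alt_residue_def using
    residue_Pascal_z[of "\<alpha> - 3" "\<beta> + 0" "\<gamma> + 1" "\<delta> + 0" "\<epsilon> + 1"]
    residue_Pascal_z[of "\<alpha> - 1" "\<beta> + 1" "\<gamma> + 0" "\<delta> + 1" "\<epsilon> - 2"]
    residue_Pascal_z[of "\<alpha> - 2" "\<beta> + 2" "\<gamma> + 0" "\<delta> + 0" "\<epsilon> - 1"]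
    residue_Pascal_z[of "\<alpha> - 3" "\<beta> + 1" "\<gamma> + 0" "\<delta> + 0" "\<epsilon> + 1"]
    residue_Pascal_z[of "\<alpha> + 1" "\<beta> + 1" "\<gamma> + 0" "\<delta> + 2" "\<epsilon> - 3"]
    residue_Pascal_z[of "\<alpha> - 2" "\<beta> + 0" "\<gamma> + 2" "\<delta> + 0" "\<epsilon> + 1"]
    residue_Pascal_z[of "\<alpha> + 1" "\<beta> + 1" "\<gamma> + 2" "\<delta> + 1" "\<epsilon> - 2"]
    residue_Pascal_z[of "\<alpha> + 1" "\<beta> + 0" "\<gamma> + 1" "\<delta> + 2" "\<epsilon> - 1"]
    residue_Pascal_z[of "\<alpha> - 1" "\<beta> + 0" "\<gamma> + 1" "\<delta> + 1" "\<epsilon> + 1"]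
    residue_Pascal_z[of "\<alpha> + 1" "\<beta> + 2" "\<gamma> + 1" "\<delta> + 1" "\<epsilon> - 3"]
  by (simp add: algebra_simps)

lemma alt_residue_Pascal_d: "alt_residue \<alpha> \<beta> \<gamma> \<delta> (\<epsilon> + 1) = alt_residue \<alpha> \<beta> (\<gamma> + 1) \<delta> \<epsilon>
    - alt_residue (\<alpha> + 1) \<beta> \<gamma> \<delta> \<epsilon>"
  unfolding alt_residue_def using
    residue_Pascal_d[of "\<alpha> - 3" "\<beta> + 0" "\<gamma> + 1" "\<delta> + 0" "\<epsilon> + 1"]
    residue_Pascal_d[of "\<alpha> - 1" "\<beta> + 1" "\<gamma> + 0" "\<delta> + 1" "\<epsilon> - 2"]
    residue_Pascal_d[of "\<alpha> - 2" "\<beta> + 2" "\<gamma> + 0" "\<delta> + 0" "\<epsilon> - 1"]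
    residue_Pascal_d[of "\<alpha> - 3" "\<beta> + 1" "\<gamma> + 0" "\<delta> + 0" "\<epsilon> + 1"]
    residue_Pascal_d[of "\<alpha> + 1" "\<beta> + 1" "\<gamma> + 0" "\<delta> + 2" "\<epsilon> - 3"]
    residue_Pascal_d[of "\<alpha> - 2" "\<beta> + 0" "\<gamma> + 2" "\<delta> + 0" "\<epsilon> + 1"]
    residue_Pascal_d[of "\<alpha> + 1" "\<beta> + 1" "\<gamma> + 2" "\<delta> + 1" "\<epsilon> - 2"]
    residue_Pascal_d[of "\<alpha> + 1" "\<beta> + 0" "\<gamma> + 1" "\<delta> + 2" "\<epsilon> - 1"]
    residue_Pascal_d[of "\<alpha> - 1" "\<beta> + 0" "\<gamma> + 1" "\<delta> + 1" "\<epsilon> + 1"]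
    residue_Pascal_d[of "\<alpha> + 1" "\<beta> + 2" "\<gamma> + 1" "\<delta> + 1" "\<epsilon> - 3"]
  by (simp add: algebra_simps)

text \<open>
  The other factor of the integrand is invariant under \<open>\<sigma>1\<close>, so the ten residues cancel in the five pairs
  that \<open>\<sigma>1\<close> interchanges.
\<close>

lemma alt_residue_sigma1: "alt_residue \<alpha> \<beta> \<gamma> \<gamma> (-1-\<gamma>) = 0"
proof -
  have 1: "residue (\<alpha> - 3) (\<beta>) (\<gamma> + 1) (\<gamma>) ((-1-\<gamma>) + 1) =
      residue (\<alpha> - 1) (\<beta> + 1) (\<gamma>) (\<gamma> + 1) ((-1-\<gamma>) - 2)"
    by (rule trans[OF residue_sigma1 residue_cong]) auto
  have 2: "residue (\<alpha> - 2) (\<beta> + 2) (\<gamma>) (\<gamma>) ((-1-\<gamma>) - 1) =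
      residue (\<alpha> - 3) (\<beta> + 1) (\<gamma>) (\<gamma>) ((-1-\<gamma>) + 1)"
    by (rule trans[OF residue_sigma1 residue_cong]) auto
  have 3: "residue (\<alpha> + 1) (\<beta> + 1) (\<gamma>) (\<gamma> + 2) ((-1-\<gamma>) - 3) =
      residue (\<alpha> - 2) (\<beta>) (\<gamma> + 2) (\<gamma>) ((-1-\<gamma>) + 1)"
    by (rule trans[OF residue_sigma1 residue_cong]) auto
  have 4: "residue (\<alpha> + 1) (\<beta> + 1) (\<gamma> + 2) (\<gamma> + 1) ((-1-\<gamma>) - 2) =
      residue (\<alpha> + 1) (\<beta>) (\<gamma> + 1) (\<gamma> + 2) ((-1-\<gamma>) - 1)"
    by (rule trans[OF residue_sigma1 residue_cong]) auto
  have 5: "residue (\<alpha> - 1) (\<beta>) (\<gamma> + 1) (\<gamma> + 1) ((-1-\<gamma>) + 1) =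
      residue (\<alpha> + 1) (\<beta> + 2) (\<gamma> + 1) (\<gamma> + 1) ((-1-\<gamma>) - 3)"
    by (rule trans[OF residue_sigma1 residue_cong]) auto
  show ?thesis
    unfolding alt_residue_def using 1 2 3 4 5 by simp
qed

text \<open>
  The same cancellation in the pairs that \<open>\<sigma>2\<close> interchanges.
\<close>

lemma alt_residue_sigma2:
  assumes "\<alpha> \<le> -1"
  shows "alt_residue \<alpha> (-1-\<alpha>) \<gamma> \<delta> \<alpha> = 0"
proof -
  have 1: "residue (\<alpha> - 1) ((-1-\<alpha>) + 1) (\<gamma>) (\<delta> + 1) (\<alpha> - 2) =
      residue (\<alpha> - 2) ((-1-\<alpha>) + 2) (\<gamma>) (\<delta>) (\<alpha> - 1)"
    by (rule trans[OF residue_sigma2 residue_cong]) (use assms in auto)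
  have 2: "residue (\<alpha> - 3) ((-1-\<alpha>) + 1) (\<gamma>) (\<delta>) (\<alpha> + 1) =
      residue (\<alpha> + 1) ((-1-\<alpha>) + 1) (\<gamma>) (\<delta> + 2) (\<alpha> - 3)"
    by (rule trans[OF residue_sigma2 residue_cong]) (use assms in auto)
  have 3: "residue (\<alpha> - 2) ((-1-\<alpha>)) (\<gamma> + 2) (\<delta>) (\<alpha> + 1) =
      residue (\<alpha> + 1) ((-1-\<alpha>) + 1) (\<gamma> + 2) (\<delta> + 1) (\<alpha> - 2)"
    by (rule trans[OF residue_sigma2 residue_cong]) (use assms in auto)
  have 4: "residue (\<alpha> + 1) ((-1-\<alpha>)) (\<gamma> + 1) (\<delta> + 2) (\<alpha> - 1) =
      residue (\<alpha> - 1) ((-1-\<alpha>)) (\<gamma> + 1) (\<delta> + 1) (\<alpha> + 1)"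
    by (rule trans[OF residue_sigma2 residue_cong]) (use assms in auto)
  have 5: "residue (\<alpha> + 1) ((-1-\<alpha>) + 2) (\<gamma> + 1) (\<delta> + 1) (\<alpha> - 3) =
      residue (\<alpha> - 3) ((-1-\<alpha>)) (\<gamma> + 1) (\<delta>) (\<alpha> + 1)"
    by (rule trans[OF residue_sigma2 residue_cong]) (use assms in auto)
  show ?thesis
    unfolding alt_residue_def using 1 2 3 4 5 by simp
qed

text \<open>
  The alternating residue of \<open>w^n y^h z^k\<close> against the form \<open>a / (y^2 z) da db\<close>. This form is
  \<open>(b \<cdot> a / y) \<cdot> da db / (y z b)\<close>, where the first factor is what turns both boundary defects into invariant
  functions.
\<close>

definition tree_poly :: "int \<Rightarrow> int \<Rightarrow> int \<Rightarrow> real" where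
  "tree_poly n h k = alt_residue (1 - n) (n + h - 2) n (n + k - 1) (-n)"

text \<open>
  This holds for every plane wave, since \<open>(1 - 1/y) (1 - y/z) w = z - 1\<close>.
\<close>

lemma tree_poly_bulk:
  "(tree_poly (n + 1) h k - tree_poly (n + 1) (h - 1) k) - (tree_poly (n + 1) (h + 1) (k - 1)
      - tree_poly (n + 1) h (k - 1))
     = tree_poly n h (k + 1) - tree_poly n h k"
  using alt_residue_Pascal_y[of "-n" "n+h-2" "n+1" "n+k" "-1-n"]
    alt_residue_Pascal_y[of "-n" "n+h-1" "n+1" "n+k-1" "-1-n"]
    alt_residue_Pascal_z[of "1-n" "n+h-2" "n+1" "n+k-1" "-1-n"]
    alt_residue_Pascal_y[of "1-n" "n+h-2" "n+1" "n+k-1" "-1-n"]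
    alt_residue_Pascal_d[of "1-n" "n+h-2" "n+1" "n+k-1" "-1-n"]
    alt_residue_Pascal_z[of "1-n" "n+h-2" "n" "n+k-1" "-n"]
  by (simp add: tree_poly_def algebra_simps)

text \<open>
  The defect of a plane wave is \<open>(1 - 1/y) w - z = a z / d\<close>. Together with the factor \<open>b\<close> of the form it gives
  \<open>b \<cdot> \<sigma>1 b\<close>, an invariant of \<open>\<sigma>1\<close>.
\<close>

lemma tree_poly_bottom: "tree_poly (n + 1) h 0 - tree_poly (n + 1) (h - 1) 0 = tree_poly n h 1"
  using alt_residue_Pascal_y[of "-n" "n+h-2" "n+1" "n" "-1-n"]
    alt_residue_Pascal_d[of "1-n" "n+h-2" "n" "n" "-1-n"]
    alt_residue_sigma1[of "2-n" "n+h-2" n]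
  by (simp add: tree_poly_def algebra_simps)

text \<open>
  The defect of a plane wave is \<open>1 - y/z = d/z\<close>. Together with the factor \<open>a / y\<close> of the form it gives
  \<open>a \<cdot> \<sigma>2 a / z\<close>, an invariant of \<open>\<sigma>2\<close>. The exponent of \<open>y\<close> is nonnegative only from \<open>n = 2\<close> on.
\<close>

lemma tree_poly_left:
  assumes "n \<ge> 2"
  shows "tree_poly n 0 k = tree_poly n 1 (k - 1)"
  using alt_residue_Pascal_z[of "1-n" "n-2" n "n+k-2" "-n"]
    alt_residue_Pascal_y[of "1-n" "n-2" n "n+k-2" "-n"]
    alt_residue_Pascal_d[of "1-n" "n-2" n "n+k-2" "-n"]
    alt_residue_sigma2[of "1-n" n "n+k-2"] assms
  by (simp add: tree_poly_def algebra_simps)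

text \<open>
  Here the factor \<open>b \<cdot> a / y\<close> is all that remains beside \<open>w^n\<close>. Writing \<open>b = d + a\<close> splits it into
  \<open>a d / y = a \<cdot> \<sigma>2 a\<close>, an invariant of \<open>\<sigma>2\<close>, and \<open>a^2 / y\<close>, an invariant of \<open>\<sigma>1\<close>.
\<close>

lemma tree_poly_origin:
  assumes "n \<ge> 2"
  shows "tree_poly n 0 0 = 0"
  using alt_residue_Pascal_d[of "1-n" "n-2" "n-1" "n-1" "-n"]
    alt_residue_sigma1[of "2-n" "n-2" "n-1"] alt_residue_sigma2[of "1-n" "n-1" "n-1"] assms
  by (simp add: tree_poly_def algebra_simps)

lemma zbinom_1_right [simp]: "zbinom x 1 = of_int x"
  by (simp add: zbinom_def)

lemma tree_poly_0: "tree_poly 0 h k = 1"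
  unfolding tree_poly_def alt_residue_def
  by (simp add: residue_eq_0 residue_eq_0') (simp add: residue_def)

lemma tree_poly_1: "tree_poly 1 h k = of_int (h + k)"
proof -
  have "{0..1::int} = {0, 1}" "{0..2::int} = {0, 1, 2}" by auto
  then show ?thesis unfolding tree_poly_def alt_residue_def
    by (simp add: residue_eq_0 residue_eq_0') (simp add: residue_def zbinom_0_left)
qed

text \<open>
  The bulk equation and the boundary conditions determine the function: summing along rows
  gives the differences along the diagonals \<open>h + k\<close> constant, and these differences are then summed
  starting from \<open>k = 0\<close>.
\<close>

lemma tree_poly_recursion:
  assumes "n \<ge> 1"
  shows "tree_poly (n + 1) (int h) (int k) =
    (\<Sum>i=1..h. tree_poly n (int i) (int (k + 1))) + (\<Sum>j=1..k. tree_poly n (int (h + j)) (int (k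
        + 1 - j)))"
proof -
  \<comment> \<open>Both sides have the same difference in \<open>h\<close> by the bulk equation and vanish at \<open>h = 0\<close>.\<close>
  have diag: "tree_poly (n + 1) (int h) (int k + 1) - tree_poly (n + 1) (int h + 1) (int k) =
      tree_poly n (int h + 1) (int k + 1) + (\<Sum>i=1..h. tree_poly n (int i) (int k + 2))
        - (\<Sum>i=1..Suc h. tree_poly n (int i) (int k + 1))" for h k
  proof (induction h)
    case 0
    then show ?case using tree_poly_left[of "n + 1" "int k + 1"] assms by simp
  next
    case (Suc h)
    then show ?case using tree_poly_bulk[of n "int h + 1" "int k + 1"]
      by (simp add: add.commute)
  qed
  have bottom: "tree_poly (n + 1) (int h) 0 = (\<Sum>i=1..h. tree_poly n (int i) 1)" for h
  proof (induction h)
    case 0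
    then show ?case using tree_poly_origin[of "n + 1"] assms by simp
  next
    case (Suc h)
    then show ?case using tree_poly_bottom[of n "int h + 1"] by (simp add: add.commute)
  qed
  show ?thesis
  proof (induction k arbitrary: h)
    case 0
    then show ?case using bottom[of h] by simp
  next
    case (Suc k)
    have "(\<Sum>j=1..Suc k. tree_poly n (int (h + j)) (int (Suc k + 1 - j)))
       = tree_poly n (int h + 1) (int k + 1) + (\<Sum>j=1..k. tree_poly n (int (Suc h + j)) (int (k
           + 1 - j)))"
      by (subst sum.atLeast_Suc_atMost)
         (simp_all add: sum.shift_bounds_cl_Suc_ivl algebra_simps del: sum.cl_ivl_Suc)
    then show ?case using diag[of h k] Suc.IH[of "Suc h"] by (simp add: add.commute)
  qed
qed

text \<open>
  The levels 0 and 1 are evaluated directly, because \<open>tree_poly_left\<close> and \<open>tree_poly_origin\<close> need \<open>n \<ge> 2\<close>.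
\<close>

lemma descendants_eq_tree_poly: "real (descendants n h k) = tree_poly (int n) (int h) (int k)"
proof (induction n arbitrary: h k)
  case 0
  then show ?case by (simp add: tree_poly_0)
next
  case (Suc n)
  show ?case
  proof (cases "n = 0")
    case True
    then show ?thesis by (simp add: tree_poly_1)
  next
    case False
    then have "tree_poly (int (Suc n)) (int h) (int k) = (\<Sum>i=1..h. tree_poly (int n) (int i) (int
        (k + 1))) + (\<Sum>j=1..k. tree_poly (int n) (int (h + j)) (int (k + 1 - j)))"
      using tree_poly_recursion[of "int n" h k] by (simp add: add.commute)
    then show ?thesis by (simp add: Suc.IH del: of_nat_Suc)
  qed
qed

lemma SB_eq_tree_poly:
  assumes "n \<ge> 1"
  shows "real (SB n) = tree_poly (int n) 1 0"
proof -
  obtain m where m: "n = Suc m" using assms by (cases n) auto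
  have "SB n = descendants n 1 0" unfolding m SB_eq_descendants by simp
  then show ?thesis using descendants_eq_tree_poly[of n 1 0] by simp
qed

section \<open>Reduction to a single sum\<close>

definition ifact :: "int \<Rightarrow> real" where
  "ifact k = fact (nat k)"

text \<open>
  Reciprocal factorials, continued by 0, satisfy their recurrence at all integers. So identities between
  products of them hold at the ends of the summation ranges as well.
\<close>

definition rfact :: "int \<Rightarrow> real" where
  "rfact k = (if k < 0 then 0 else 1 / fact (nat k))"

lemma ifact_step: "k \<ge> 0 \<Longrightarrow> ifact (k + 1) = (of_int k + 1) * ifact k"
  by (simp add: ifact_def nat_add_distrib)

lemma ifact_pos: "ifact k > 0"
  by (simp add: ifact_def)

lemma rfact_step: "rfact k = (of_int k + 1) * rfact (k + 1)"
proof (cases "k \<ge> 0")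
  case True
  then have "nat (k + 1) = Suc (nat k)" "real (nat k) = of_int k" by simp_all
  then show ?thesis using True
    by (simp add: rfact_def divide_simps del: of_nat_Suc)
next
  case False
  then show ?thesis by (cases "k = -1") (auto simp: rfact_def)
qed

lemma rfact_raise: "rfact (k - int m) = pochhammer (of_int k - of_nat m + 1) m * rfact k"
proof (induction m)
  case (Suc m)
  have "rfact (k - int (Suc m)) = (of_int k - of_nat m) * rfact (k - int m)"
    using rfact_step[of "k - int (Suc m)"] by (simp add: algebra_simps)
  then show ?case using Suc.IH by (simp add: pochhammer_rec algebra_simps)
qed simp

lemma ifact_raise: "k \<ge> 0 \<Longrightarrow> ifact (k + int m) = pochhammer (of_int k + 1) m * ifact k"
proof (induction m)
  case (Suc m)
  then show ?case using ifact_step[of "k + int m"] by (simp add: pochhammer_Suc algebra_simps)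
qed simp

lemma zbinom_rfact:
  assumes "x \<ge> 0"
  shows "zbinom x k = ifact x * rfact k * rfact (x - k)"
proof (cases "0 \<le> k \<and> k \<le> x")
  case True
  then obtain i j where ij: "k = int i" "x = int i + int j"
    by (metis nonneg_int_cases zle_iff_zadd)
  have "zbinom x k = real ((i + j) choose i)"
    using zbinom_of_nat[of "i + j" i] by (simp add: ij)
  also have "\<dots> = fact (i + j) / (fact i * fact j)"
    by (subst binomial_fact) auto
  finally show ?thesis by (simp add: ij ifact_def rfact_def nat_add_distrib)
next
  case False
  then show ?thesis using assms by (auto simp: zbinom_eq_0 rfact_def)
qed

lemma zbinom_neg_rfact:
  assumes "x \<le> -1"
  shows "(-1) powi k * zbinom x k = ifact (k - x - 1) * rfact k / ifact (- x - 1)"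
proof (cases "k \<ge> 0")
  case True
  have "(-1) powi k * zbinom x k = zbinom (k - x - 1) k"
    by (subst zbinom_upper_neg) (use powi_minus_one_sq[of k] in \<open>simp add: mult.assoc[symmetric]\<close>)
  also have "\<dots> = ifact (k - x - 1) * rfact k * rfact (- x - 1)"
    using zbinom_rfact[of "k - x - 1" k] True assms by simp
  finally show ?thesis using assms by (simp add: rfact_def ifact_def)
qed (simp add: rfact_def)

lemma residue_shifted:
  assumes "\<beta> \<ge> 0" "\<delta> \<ge> 0" "\<epsilon> \<le> -1" "lo + t \<le> 0" "-1 - \<alpha> \<le> hi + t"
  shows "residue \<alpha> \<beta> \<gamma> \<delta> \<epsilon> = ifact \<beta> * ifact \<delta> / ifact (- \<epsilon> - 1) *
    (\<Sum>l\<in>{lo..hi}. ifact (l + t - \<epsilon> - 1) * rfact (l + t) * rfact (-1 - \<alpha> - t - l) *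
       rfact (l + t + \<alpha> + \<beta> + 1) * rfact (l + t - 1 - \<gamma> - \<epsilon>) * rfact (\<delta> + \<gamma> + \<epsilon> + 1 - t - l))"
proof -
  have "residue \<alpha> \<beta> \<gamma> \<delta> \<epsilon> = (\<Sum>l\<in>{lo + t..hi + t}. (-1) powi l * zbinom \<epsilon> l *
     zbinom \<beta> (-1-\<alpha>-l) * zbinom \<delta> (l-1-\<gamma>-\<epsilon>))"
    using assms by (intro residue_superset) auto
  also have "\<dots> = (\<Sum>l\<in>{lo..hi}. (-1) powi (l + t) * zbinom \<epsilon> (l + t) *
     zbinom \<beta> (-1-\<alpha>-(l + t)) * zbinom \<delta> (l+t-1-\<gamma>-\<epsilon>))"
    by (rule sum.reindex_bij_witness[of _ "\<lambda>l. l + t" "\<lambda>l. l - t"]) auto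
  also have "\<dots> = (\<Sum>l\<in>{lo..hi}. ifact \<beta> * ifact \<delta> / ifact (- \<epsilon> - 1) * (ifact (l + t - \<epsilon> - 1)
      * rfact (l + t) * rfact (-1 - \<alpha> - t - l) *
       rfact (l + t + \<alpha> + \<beta> + 1) * rfact (l + t - 1 - \<gamma> - \<epsilon>) * rfact (\<delta> + \<gamma> + \<epsilon> + 1 - t - l)))"
    unfolding zbinom_neg_rfact[OF assms(3)] zbinom_rfact[OF assms(1)] zbinom_rfact[OF assms(2)]
    by (intro sum.cong) (auto simp: algebra_simps)
  finally show ?thesis by (simp add: sum_distrib_left)
qed

text \<open>
  A common divisor of the terms of all ten sums, each shifted suitably, so that every term is a polynomial
  multiple of it.
\<close>

definition base_term :: "int \<Rightarrow> int \<Rightarrow> real" where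
  "base_term n l = ifact (n + l - 1) * rfact (l - 1) * rfact (l + 1) * rfact (l + 2) * rfact (n
      - l) * rfact (n + 3 - l)"

text \<open>
  The polynomial by which a term differs from \<open>base_term\<close>, when the arguments of its five reciprocal
  factorials are lower by \<open>m1, m2, m3, k1, k2\<close> and that of its factorial is higher by \<open>e\<close>.
\<close>

definition ratio :: "real \<Rightarrow> nat \<Rightarrow> nat \<Rightarrow> nat \<Rightarrow> nat \<Rightarrow> nat \<Rightarrow> nat \<Rightarrow> real \<Rightarrow> real" where
  "ratio N m1 m2 m3 k1 k2 e x = pochhammer (x - real m1) m1 * pochhammer (x - real m2 + 2) m2 *
     pochhammer (x - real m3 + 3) m3 * pochhammer (N - x - real k1 + 1) k1 *
     pochhammer (N - x - real k2 + 4) k2 * pochhammer (N + x) e"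

text \<open>
  The parameter \<open>t\<close> is the shift of the summation index; \<open>C\<close> collects the factorials that do not depend
  on it, \<open>c\<close> being a common denominator for the ten sums. The range
  \<open>{-1..n + 2}\<close> is wide enough for all shifts that occur.
\<close>

lemma residue_eq_base_sum:
  fixes m1 m2 m3 k1 k2 e :: nat
  assumes n: "n \<ge> 3"
    and le: "\<beta> \<ge> 0" "\<delta> \<ge> 0" "\<epsilon> \<le> -1" "t \<le> 1" "-1 - \<alpha> \<le> n + 2 + t"
    and up: "\<And>l. rfact (l + t) * rfact (l + t + \<alpha> + \<beta> + 1) * rfact (l + t - 1 - \<gamma> - \<epsilon>) =
        rfact (l - 1 - int m1) * rfact (l + 1 - int m2) * rfact (l + 2 - int m3)"
    and down: "\<And>l. rfact (-1 - \<alpha> - t - l) * rfact (\<delta> + \<gamma> + \<epsilon> + 1 - t - l) =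
        rfact (n - l - int k1) * rfact (n + 3 - l - int k2)"
    and num: "t - \<epsilon> - 1 = n - 1 + int e"
    and const: "c * ifact \<beta> * ifact \<delta> = C * ifact n * ifact (- \<epsilon> - 1)"
  shows "c * residue \<alpha> \<beta> \<gamma> \<delta> \<epsilon> = ifact n *
    (\<Sum>l\<in>{-1..n + 2}. C * ratio (of_int n) m1 m2 m3 k1 k2 e (of_int l) * base_term n l)"
proof -
  have "ifact (l + t - \<epsilon> - 1) * rfact (l + t) * rfact (-1 - \<alpha> - t - l) *
       rfact (l + t + \<alpha> + \<beta> + 1) * rfact (l + t - 1 - \<gamma> - \<epsilon>) * rfact (\<delta> + \<gamma> + \<epsilon> + 1 - t - l)
     = ratio (of_int n) m1 m2 m3 k1 k2 e (of_int l) * base_term n l"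
    (is "?L = ?R") if "l \<in> {-1..n + 2}" for l
  proof -
    have f: "ifact (l + t - \<epsilon> - 1) = pochhammer (of_int n + of_int l) e * ifact (n + l - 1)"
      using that n num ifact_raise[of "n + l - 1" e] by (simp add: algebra_simps)
    have u: "rfact (l + t) * rfact (l + t + \<alpha> + \<beta> + 1) * rfact (l + t - 1 - \<gamma> - \<epsilon>) =
        (pochhammer (of_int l - real m1) m1 * rfact (l - 1)) * (pochhammer (of_int l - real m2
            + 2) m2 * rfact (l + 1)) *
        (pochhammer (of_int l - real m3 + 3) m3 * rfact (l + 2))"
      unfolding up using rfact_raise[of "l - 1" m1] rfact_raise[of "l + 1" m2] rfact_raise[of "l
          + 2" m3]
      by (simp add: add.commute add_diff_eq)
    have d: "rfact (-1 - \<alpha> - t - l) * rfact (\<delta> + \<gamma> + \<epsilon> + 1 - t - l) =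
        (pochhammer (of_int n - of_int l - real k1 + 1) k1 * rfact (n - l)) *
        (pochhammer (of_int n - of_int l - real k2 + 4) k2 * rfact (n + 3 - l))"
      unfolding down using rfact_raise[of "n - l" k1] rfact_raise[of "n + 3 - l" k2]
      by (simp add: algebra_simps)
    have "?L = ifact (l + t - \<epsilon> - 1) * (rfact (l + t) * rfact (l + t + \<alpha> + \<beta> + 1) * rfact (l + t
        - 1 - \<gamma> - \<epsilon>)) *
        (rfact (-1 - \<alpha> - t - l) * rfact (\<delta> + \<gamma> + \<epsilon> + 1 - t - l))"
      by (simp only: ac_simps)
    then show ?thesis
      unfolding f u d base_term_def ratio_def by (simp only: ac_simps)
  qed
  then have "residue \<alpha> \<beta> \<gamma> \<delta> \<epsilon> = ifact \<beta> * ifact \<delta> / ifact (- \<epsilon> - 1) *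
    (\<Sum>l\<in>{-1..n + 2}. ratio (of_int n) m1 m2 m3 k1 k2 e (of_int l) * base_term n l)"
    using le by (subst residue_shifted[where lo = "-1" and hi = "n + 2" and t = t])
        (auto intro!: sum.cong)
  moreover have "c * (ifact \<beta> * ifact \<delta> / ifact (- \<epsilon> - 1)) = ifact n * C"
    using const ifact_pos[of "- \<epsilon> - 1"] by (simp add: divide_simps mult_ac)
  ultimately show ?thesis
    by (simp only: mult.assoc[symmetric]) (simp add: sum_distrib_left mult.assoc)
qed

lemma ifact_steps:
  assumes "n \<ge> 3"
  shows "ifact (n - 1) = ifact n / of_int n" "ifact (n - 2) = ifact n / (of_int n * (of_int n - 1))"
    "ifact (n + 1) = (of_int n + 1) * ifact n" "ifact (n + 2) = (of_int n + 2) * (of_int n + 1) *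
        ifact n"
proof -
  have 1: "ifact (n - 1) = (of_int n - 1) * ifact (n - 2)" "ifact n = of_int n * ifact (n - 1)"
    using ifact_step[of "n - 2"] ifact_step[of "n - 1"] assms by simp_all
  show "ifact (n - 1) = ifact n / of_int n" using 1(2) assms by simp
  show "ifact (n - 2) = ifact n / (of_int n * (of_int n - 1))" unfolding 1(2) 1(1) using assms
      by simp
  show 2: "ifact (n + 1) = (of_int n + 1) * ifact n" using ifact_step[of n] assms by simp
  show "ifact (n + 2) = (of_int n + 2) * (of_int n + 1) * ifact n"
  proof -
    have "n + 1 + 1 = n + 2" by simp
    then show ?thesis using ifact_step[of "n + 1"] assms unfolding 2 by (simp add: algebra_simps)
  qed
qed

text \<open>
  The polynomial solution of Gosper's equation for the difference between the ten sums and the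
  single sum in \<open>SB_formula\<close>; it was found by solving a linear system for its coefficients.
\<close>

definition certificate :: "real \<Rightarrow> real \<Rightarrow> real" where
  "certificate N x = (4 * N^3 + 2 * N^4 - 4 * N^5 - 2 * N^6)
     + (18 * N^2 - 12 * N + 4 * N^3 - 14 * N^4 - 6 * N^5 - 2 * N^6) * x
     + (10 * N^2 - 24 - 16 * N - 2 * N^3 - 2 * N^4 - 2 * N^5) * x^2
     + (2 * N^2 - 24 - 4 * N + 2 * N^4) * x^3
     + (2 * N^3 - 2 * N^2) * x^4"

text \<open>
  The first summand is the term of the single sum in \<open>SB_formula\<close>, the other two are the forward difference of
  \<open>certificate N x (x - 1) (x + 1) (x + 2)\<close> times \<open>base_term\<close>, by \<open>base_term_Suc\<close>. The proof
  reduces to an identity between polynomials in \<open>N\<close> and \<open>x\<close>.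
\<close>

lemma tree_poly_eq_base_sum:
  fixes n :: int
  assumes n: "n \<ge> 3"
  defines "N \<equiv> real_of_int n"
  shows "N\<^sup>2 * (N\<^sup>2 - 1) * (N + 2) * tree_poly n 1 0 = ifact n * (\<Sum>l\<in>{-1..n+2}. (let x = of_int l in
     24 * (N + 2) * ((x + 1)*(x + 2)*(N - x)*(N + x)*(N + x + 1))
     + certificate N (x + 1) * (N + x) * (N - x) * (N - x + 3)
     - certificate N x * (x - 1) * (x + 1) * (x + 2)) * base_term n l)"
proof -
  have N: "N \<ge> 3" using n by (simp add: N_def)
  define D where "D = N\<^sup>2 * (N\<^sup>2 - 1) * (N + 2)"
  have D_eq: "D = N * N * (N - 1) * (N + 1) * (N + 2)"
    unfolding D_def by algebra
  have comm: "ifact (1 + n) = (N + 1) * ifact n" "ifact (2 + n) = (N + 2) * (N + 1) * ifact n"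
    using ifact_steps(3,4)[OF n] by (simp_all add: N_def add.commute)
  note steps = comm ifact_steps[OF n, folded N_def] D_eq divide_simps ac_simps add_diff_eq
  have plus: "ifact n * (\<Sum>l\<in>I. f l * h l) + ifact n * (\<Sum>l\<in>I. g l * h l) = ifact n * (\<Sum>l\<in>I. (f l
      + g l) * h l)"
    and minus: "ifact n * (\<Sum>l\<in>I. f l * h l) - ifact n * (\<Sum>l\<in>I. g l * h l) = ifact n * (\<Sum>l\<in>I. (f l
        - g l) * h l)"
    for f g h :: "int \<Rightarrow> real" and I
    by (simp_all add: distrib_right left_diff_distrib distrib_left right_diff_distrib sum.distrib
        sum_subtractf)
  have t0: "D * residue (1 - n - 3) (n - 1) (n + 1) (n - 1) (- n + 1) = ifact n * (\<Sum>l\<in>{-1..n+2}.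
      (N + 1) * (N - 1) * (N + 2) * N * (N - 1) * ratio N 1 2 1 0 2 0 (real_of_int l)
          * base_term n l)"
    unfolding N_def
    by (rule residue_eq_base_sum[OF n, where t = "1"]; (fold N_def D_def)?)
       ((use n N in \<open>simp_all add: steps\<close>), (simp_all add: algebra_simps)?)
  have t1: "D * residue (1 - n - 1) (n - 1 + 1) (n) (n - 1 + 1) (- n - 2) = ifact n * (\<Sum>l\<in>{-1..n+2}.
      N * N * (N - 1) * (N + 2) * ratio N 0 1 2 0 3 1 (real_of_int l) * base_term n l)"
    unfolding N_def
    by (rule residue_eq_base_sum[OF n, where t = "-1"]; (fold N_def D_def)?)
       ((use n N in \<open>simp_all add: steps\<close>), (simp_all add: algebra_simps)?)
  have t2: "D * residue (1 - n - 2) (n - 1 + 2) (n) (n - 1) (- n - 1) = ifact n * (\<Sum>l\<in>{-1..n+2}.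
      N * (N + 1) * (N - 1) * (N + 2) * (N + 1) * ratio N 0 2 2 0 2 0 (real_of_int l)
          * base_term n l)"
    unfolding N_def
    by (rule residue_eq_base_sum[OF n, where t = "-1"]; (fold N_def D_def)?)
       ((use n N in \<open>simp_all add: steps\<close>), (simp_all add: algebra_simps)?)
  have t3: "D * residue (1 - n - 3) (n - 1 + 1) (n) (n - 1) (- n + 1) = ifact n * (\<Sum>l\<in>{-1..n+2}.
      N * (N + 1) * (N - 1) * (N + 2) * N * (N - 1) * ratio N 0 1 1 0 3 0 (real_of_int l)
          * base_term n l)"
    unfolding N_def
    by (rule residue_eq_base_sum[OF n, where t = "1"]; (fold N_def D_def)?)
       ((use n N in \<open>simp_all add: steps\<close>), (simp_all add: algebra_simps)?)
  have t4: "D * residue (1 - n + 1) (n - 1 + 1) (n) (n - 1 + 2) (- n - 3) = ifact n * (\<Sum>l\<in>{-1..n+2}.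
      N * N * (N - 1) * (N + 1) * ratio N 1 1 1 1 2 1 (real_of_int l) * base_term n l)"
    unfolding N_def
    by (rule residue_eq_base_sum[OF n, where t = "-2"]; (fold N_def D_def)?)
       ((use n N in \<open>simp_all add: steps\<close>), (simp_all add: algebra_simps)?)
  have t5: "D * residue (1 - n - 2) (n - 1) (n + 2) (n - 1) (- n + 1) = ifact n * (\<Sum>l\<in>{-1..n+2}.
      (N + 1) * (N - 1) * (N + 2) * N * (N - 1) * ratio N 2 1 1 1 1 0 (real_of_int l)
          * base_term n l)"
    unfolding N_def
    by (rule residue_eq_base_sum[OF n, where t = "1"]; (fold N_def D_def)?)
       ((use n N in \<open>simp_all add: steps\<close>), (simp_all add: algebra_simps)?)
  have t6: "D * residue (1 - n + 1) (n - 1 + 1) (n + 2) (n - 1 + 1) (- n - 2) = ifact n *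
      (\<Sum>l\<in>{-1..n+2}.
      N * N * (N - 1) * (N + 2) * ratio N 1 2 0 2 1 1 (real_of_int l) * base_term n l)"
    unfolding N_def
    by (rule residue_eq_base_sum[OF n, where t = "-1"]; (fold N_def D_def)?)
       ((use n N in \<open>simp_all add: steps\<close>), (simp_all add: algebra_simps)?)
  have t7: "D * residue (1 - n + 1) (n - 1) (n + 1) (n - 1 + 2) (- n - 1) = ifact n * (\<Sum>l\<in>{-1..n+2}.
      N * (N + 1) * (N - 1) * (N + 2) * (N + 1) * ratio N 1 2 1 2 0 0 (real_of_int l)
          * base_term n l)"
    unfolding N_def
    by (rule residue_eq_base_sum[OF n, where t = "-1"]; (fold N_def D_def)?)
       ((use n N in \<open>simp_all add: steps\<close>), (simp_all add: algebra_simps)?)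
  have t8: "D * residue (1 - n - 1) (n - 1) (n + 1) (n - 1 + 1) (- n + 1) = ifact n * (\<Sum>l\<in>{-1..n+2}.
      N * (N + 1) * (N - 1) * (N + 2) * N * (N - 1) * ratio N 1 0 1 2 1 0 (real_of_int l)
          * base_term n l)"
    unfolding N_def
    by (rule residue_eq_base_sum[OF n, where t = "1"]; (fold N_def D_def)?)
       ((use n N in \<open>simp_all add: steps\<close>), (simp_all add: algebra_simps)?)
  have t9: "D * residue (1 - n + 1) (n - 1 + 2) (n + 1) (n - 1 + 1) (- n - 3) = ifact n *
      (\<Sum>l\<in>{-1..n+2}.
      N * N * (N - 1) * (N + 1) * ratio N 1 2 0 1 2 1 (real_of_int l) * base_term n l)"
    unfolding N_def
    by (rule residue_eq_base_sum[OF n, where t = "-2"]; (fold N_def D_def)?)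
       ((use n N in \<open>simp_all add: steps\<close>), (simp_all add: algebra_simps)?)
  have "D * tree_poly n 1 0 = 
        D * residue (1 - n - 3) (n - 1) (n + 1) (n - 1) (- n + 1)
      - D * residue (1 - n - 1) (n - 1 + 1) (n) (n - 1 + 1) (- n - 2)
      + D * residue (1 - n - 2) (n - 1 + 2) (n) (n - 1) (- n - 1)
      - D * residue (1 - n - 3) (n - 1 + 1) (n) (n - 1) (- n + 1)
      + D * residue (1 - n + 1) (n - 1 + 1) (n) (n - 1 + 2) (- n - 3)
      - D * residue (1 - n - 2) (n - 1) (n + 2) (n - 1) (- n + 1)
      + D * residue (1 - n + 1) (n - 1 + 1) (n + 2) (n - 1 + 1) (- n - 2)
      - D * residue (1 - n + 1) (n - 1) (n + 1) (n - 1 + 2) (- n - 1)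
      + D * residue (1 - n - 1) (n - 1) (n + 1) (n - 1 + 1) (- n + 1)
      - D * residue (1 - n + 1) (n - 1 + 2) (n + 1) (n - 1 + 1) (- n - 3)"
    unfolding tree_poly_def alt_residue_def by (simp add: algebra_simps)
  also have "\<dots> = ifact n * (\<Sum>l\<in>{-1..n+2}. (
        (N + 1) * (N - 1) * (N + 2) * N * (N - 1) * ratio N 1 2 1 0 2 0 (real_of_int l)
      - N * N * (N - 1) * (N + 2) * ratio N 0 1 2 0 3 1 (real_of_int l)
      + N * (N + 1) * (N - 1) * (N + 2) * (N + 1) * ratio N 0 2 2 0 2 0 (real_of_int l)
      - N * (N + 1) * (N - 1) * (N + 2) * N * (N - 1) * ratio N 0 1 1 0 3 0 (real_of_int l)
      + N * N * (N - 1) * (N + 1) * ratio N 1 1 1 1 2 1 (real_of_int l)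
      - (N + 1) * (N - 1) * (N + 2) * N * (N - 1) * ratio N 2 1 1 1 1 0 (real_of_int l)
      + N * N * (N - 1) * (N + 2) * ratio N 1 2 0 2 1 1 (real_of_int l)
      - N * (N + 1) * (N - 1) * (N + 2) * (N + 1) * ratio N 1 2 1 2 0 0 (real_of_int l)
      + N * (N + 1) * (N - 1) * (N + 2) * N * (N - 1) * ratio N 1 0 1 2 1 0 (real_of_int l)
      - N * N * (N - 1) * (N + 1) * ratio N 1 2 0 1 2 1 (real_of_int l)) * base_term n l)"
    unfolding t0 t1 t2 t3 t4 t5 t6 t7 t8 t9 by (simp only: plus minus)
  also have "\<dots> = ifact n * (\<Sum>l\<in>{-1..n+2}. (let x = of_int l in
     24 * (N + 2) * ((x + 1)*(x + 2)*(N - x)*(N + x)*(N + x + 1))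
     + certificate N (x + 1) * (N + x) * (N - x) * (N - x + 3)
     - certificate N x * (x - 1) * (x + 1) * (x + 2)) * base_term n l)"
  proof -
    have "
        (N + 1) * (N - 1) * (N + 2) * N * (N - 1) * ratio N 1 2 1 0 2 0 x
      - N * N * (N - 1) * (N + 2) * ratio N 0 1 2 0 3 1 x
      + N * (N + 1) * (N - 1) * (N + 2) * (N + 1) * ratio N 0 2 2 0 2 0 x
      - N * (N + 1) * (N - 1) * (N + 2) * N * (N - 1) * ratio N 0 1 1 0 3 0 x
      + N * N * (N - 1) * (N + 1) * ratio N 1 1 1 1 2 1 x
      - (N + 1) * (N - 1) * (N + 2) * N * (N - 1) * ratio N 2 1 1 1 1 0 x
      + N * N * (N - 1) * (N + 2) * ratio N 1 2 0 2 1 1 x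
      - N * (N + 1) * (N - 1) * (N + 2) * (N + 1) * ratio N 1 2 1 2 0 0 x
      + N * (N + 1) * (N - 1) * (N + 2) * N * (N - 1) * ratio N 1 0 1 2 1 0 x
      - N * N * (N - 1) * (N + 1) * ratio N 1 2 0 1 2 1 x =
     24 * (N + 2) * ((x + 1)*(x + 2)*(N - x)*(N + x)*(N + x + 1))
     + certificate N (x + 1) * (N + x) * (N - x) * (N - x + 3)
     - certificate N x * (x - 1) * (x + 1) * (x + 2)" for x
    proof -
      have e: "ratio N 1 2 1 0 2 0 x = (x - 1) * x * (x + 1) * (x + 2) * (N - x + 2) * (N - x + 3)"
        "ratio N 0 1 2 0 3 1 x = (x + 1) * (x + 1) * (x + 2) * (N - x + 1) * (N - x + 2) * (N - x
            + 3) * (N + x)"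
        "ratio N 0 2 2 0 2 0 x = x * (x + 1) * (x + 1) * (x + 2) * (N - x + 2) * (N - x + 3)"
        "ratio N 0 1 1 0 3 0 x = (x + 1) * (x + 2) * (N - x + 1) * (N - x + 2) * (N - x + 3)"
        "ratio N 1 1 1 1 2 1 x = (x - 1) * (x + 1) * (x + 2) * (N - x) * (N - x + 2) * (N - x
            + 3) * (N + x)"
        "ratio N 2 1 1 1 1 0 x = (x - 2) * (x - 1) * (x + 1) * (x + 2) * (N - x) * (N - x + 3)"
        "ratio N 1 2 0 2 1 1 x = (x - 1) * x * (x + 1) * (N - x - 1) * (N - x) * (N - x + 3) * (N
            + x)"
        "ratio N 1 2 1 2 0 0 x = (x - 1) * x * (x + 1) * (x + 2) * (N - x - 1) * (N - x)"
        "ratio N 1 0 1 2 1 0 x = (x - 1) * (x + 2) * (N - x - 1) * (N - x) * (N - x + 3)"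
        "ratio N 1 2 0 1 2 1 x = (x - 1) * x * (x + 1) * (N - x) * (N - x + 2) * (N - x + 3) * (N
            + x)"
        by (simp_all add: ratio_def eval_nat_numeral pochhammer_Suc ac_simps)
      show ?thesis unfolding e certificate_def by algebra
    qed
    then show ?thesis by (simp only: Let_def)
  qed
  finally show ?thesis unfolding D_def .
qed

lemma base_term_eq_0: "l < 1 \<or> l > n \<Longrightarrow> base_term n l = 0"
  by (auto simp: base_term_def rfact_def)

lemma base_term_Suc:
  assumes "n + l \<ge> 1"
  shows "of_int l * (of_int l + 2) * (of_int l + 3) * base_term n (l + 1) =
    (of_int n + of_int l) * (of_int n - of_int l) * (of_int n - of_int l + 3) * base_term n l"
proof -
  have "ifact (n + l) = (of_int n + of_int l) * ifact (n + l - 1)"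
    using ifact_step[of "n + l - 1"] assms by simp
  moreover have "rfact (l - 1) = of_int l * rfact l" "rfact (l + 1) = (of_int l + 2) * rfact (l
      + 2)"
    "rfact (l + 2) = (of_int l + 3) * rfact (l + 3)"
    using rfact_step[of "l - 1"] rfact_step[of "l + 1"] rfact_step[of "l + 2"] by
        (simp_all add: add.commute)
  moreover have "rfact (n - l - 1) = (of_int n - of_int l) * rfact (n - l)"
    "rfact (n - l + 2) = (of_int n - of_int l + 3) * rfact (n - l + 3)"
    using rfact_step[of "n - l - 1"] rfact_step[of "n - l + 2"] by (simp_all add: add.commute)
  moreover have "base_term n (l + 1) = ifact (n + l) * rfact l * rfact (l + 2) * rfact (l + 3)
      * rfact (n - l - 1) * rfact (n - l + 2)"
    "base_term n l = ifact (n + l - 1) * rfact (l - 1) * rfact (l + 1) * rfact (l + 2) * rfact (n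
        - l) * rfact (n - l + 3)"
    unfolding base_term_def by (simp_all add: algebra_simps)
  ultimately show ?thesis by (simp only: mult_ac)
qed

lemma binomials_eq_base_term:
  assumes "n \<ge> 1"
  shows "real ((n choose (j + 2)) * ((n + 2) choose j) * ((n + j + 2) choose (j + 1))) =
    ifact (int n) * (real n + 2) * ((real j + 2) * (real j + 3) * (real n - real j - 1) * (real n
        + real j + 1) * (real n + real j + 2)) *
      base_term (int n) (int j + 1)"
proof -
  have f: "real (m choose k) = ifact (int m) * rfact (int k) * rfact (int m - int k)" for m k
    using zbinom_rfact[of "int m" "int k"] by (simp add: zbinom_of_nat)
  have "ifact (int n + int j + 2) = (real n + real j + 2) * (real n + real j + 1) * ifact (int n
      + int j)"
    using ifact_step[of "int n + int j"] ifact_step[of "int n + int j + 1"] by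
        (simp add: algebra_simps)
  moreover have "ifact (int n + 2) * rfact (int n + 1) = real n + 2"
  proof -
    have "ifact (int n + 1 + 1) = (real n + 2) * ifact (int n + 1)"
      using ifact_step[of "int n + 1"] by simp
    moreover have "int n + 1 + 1 = int n + 2" "rfact (int n + 1) = 1 / ifact (int n + 1)"
      by (simp_all add: rfact_def ifact_def)
    ultimately show ?thesis using ifact_pos[of "int n + 1"] by simp
  qed
  moreover have "rfact (int j + 1) = (real j + 2) * rfact (int j + 2)" "rfact (int j + 2) =
      (real j + 3) * rfact (int j + 3)"
    using rfact_step[of "int j + 1"] rfact_step[of "int j + 2"] by (simp_all add: add.commute)
  moreover have "rfact (int n - int j - 2) = (real n - real j - 1) * rfact (int n - int j - 1)"
    using rfact_step[of "int n - int j - 2"] by simp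
  moreover have "real ((n choose (j + 2)) * ((n + 2) choose j) * ((n + j + 2) choose (j + 1))) =
      ifact (int n) * rfact (int j + 2) * rfact (int n - int j - 2) *
      (ifact (int n + 2) * rfact (int n + 1)) * rfact (int j) * rfact (int n - int j + 2) *
      ifact (int n + int j + 2) * rfact (int j + 1)"
    unfolding of_nat_mult f by (simp add: algebra_simps)
  moreover have "base_term (int n) (int j + 1) = ifact (int n + int j) * rfact (int j) * rfact
      (int j + 2) * rfact (int j + 3) *
      rfact (int n - int j - 1) * rfact (int n - int j + 2)"
    unfolding base_term_def by (simp add: algebra_simps)
  ultimately show ?thesis by (simp only: mult_ac)
qed

text \<open>
  The differences telescope to 0, since \<open>base_term\<close> vanishes outside \<open>{1..n}\<close>.
\<close>

theorem SB_formula: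
  assumes n: "n \<ge> 3"
  shows "real n ^ 2 * (real n ^ 2 - 1) * (real n + 2) * real (SB n) =
    24 * (\<Sum>j\<le>n. real ((n choose (j + 2)) * ((n + 2) choose j) * ((n + j + 2) choose (j + 1))))"
proof -
  define N where "N = real n"
  define G where "G l = certificate N (of_int l) * (of_int l - 1) * (of_int l + 1) * (of_int l
      + 2) * base_term (int n) l" for l
  have G0: "G l = 0" if "l < 1 \<or> l > int n" for l
    unfolding G_def using base_term_eq_0[OF that] by simp
  define H where "H l = 24 * (N + 2) * ((of_int l + 1) * (of_int l + 2) * (N - of_int l) * (N
      + of_int l) * (N + of_int l + 1)) * base_term (int n) l" for l
  have H0: "H l = 0" if "l < 1 \<or> l > int n" for l
    unfolding H_def using base_term_eq_0[OF that] by simp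
  have "N\<^sup>2 * (N\<^sup>2 - 1) * (N + 2) * tree_poly (int n) 1 0 = ifact (int n) *
      (\<Sum>l\<in>{-1..int n+2}. H l + (G (l + 1) - G l))"
  proof -
    have "(let x = real_of_int l in
     24 * (N + 2) * ((x + 1)*(x + 2)*(N - x)*(N + x)*(N + x + 1))
     + certificate N (x + 1) * (N + x) * (N - x) * (N - x + 3)
     - certificate N x * (x - 1) * (x + 1) * (x + 2)) * base_term (int n) l = H l + (G (l + 1)
         - G l)"
      if "l \<in> {-1..int n + 2}" for l
    proof -
      have "G (l + 1) = certificate N (of_int l + 1) * (of_int l * (of_int l + 2) * (of_int l
          + 3) * base_term (int n) (l + 1))"
        unfolding G_def by (simp add: algebra_simps)
      also have "\<dots> = certificate N (of_int l + 1) * ((N + of_int l) * (N - of_int l) * (N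
          - of_int l + 3) * base_term (int n) l)"
        using base_term_Suc[of "int n" l] that n by (simp add: N_def)
      finally show ?thesis unfolding G_def H_def Let_def by (simp only: distrib_right
          left_diff_distrib mult.assoc add_diff_eq)
    qed
    then show ?thesis using tree_poly_eq_base_sum[of "int n"] n by (simp add: N_def)
  qed
  also have "(\<Sum>l\<in>{-1..int n+2}. H l + (G (l + 1) - G l)) = (\<Sum>l\<in>{-1..int n+2}. H l) +
      ((\<Sum>l\<in>{-1..int n+2}. G (l + 1)) - (\<Sum>l\<in>{-1..int n+2}. G l))"
    by (simp add: sum.distrib sum_subtractf)
  also have "(\<Sum>l\<in>{-1..int n+2}. G (l + 1)) = (\<Sum>l\<in>{0..int n+3}. G l)"
    by (rule sum.reindex_bij_witness[of _ "\<lambda>l. l - 1" "\<lambda>l. l + 1"]) auto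
  also have "\<dots> = (\<Sum>l\<in>{1..int n}. G l)"
    by (rule sum.mono_neutral_right) (auto intro!: G0)
  also have "(\<Sum>l\<in>{-1..int n+2}. G l) = (\<Sum>l\<in>{1..int n}. G l)"
    by (rule sum.mono_neutral_right) (auto intro!: G0)
  also have "(\<Sum>l\<in>{-1..int n+2}. H l) = (\<Sum>l\<in>{1..int n + 1}. H l)"
    by (rule sum.mono_neutral_right) (auto intro!: H0)
  also have "\<dots> = (\<Sum>j\<le>n. H (int j + 1))"
    by (rule sum.reindex_bij_witness[of _ "\<lambda>j. int j + 1" "\<lambda>l. nat (l - 1)"]) auto
  also have "ifact (int n) * (\<dots> + ((\<Sum>l\<in>{1..int n}. G l) - (\<Sum>l\<in>{1..int n}. G l))) = (\<Sum>j\<le>n. ifact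
      (int n) * H (int j + 1))"
    by (simp add: sum_distrib_left)
  also have "\<dots> = (\<Sum>j\<le>n. 24 * real ((n choose (j + 2)) * ((n + 2) choose j) * ((n + j + 2) choose
      (j + 1))))"
  proof (intro sum.cong refl)
    fix j
    have e: "real_of_int (int j + 1) = real j + 1" "real j + 1 + 1 = real j + 2" "real j + 1 + 2
        = real j + 3"
      "N - (real j + 1) = N - real j - 1" "N + (real j + 1) = N + real j + 1" "N + real j + 1 + 1
          = N + real j + 2"
      by simp_all
    show "ifact (int n) * H (int j + 1) = 24 * real ((n choose (j + 2)) * ((n + 2) choose j) *
        ((n + j + 2) choose (j + 1)))"
      using n binomials_eq_base_term[of n j] unfolding H_def e N_def[symmetric] by
          (simp only: mult_ac)
  qed
  finally show ?thesis
    using SB_eq_tree_poly[of n] n by (simp add: N_def sum_distrib_left)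
qed

section \<open>Stirling's formula\<close>

definition stirling :: "nat \<Rightarrow> real" where
  "stirling n = sqrt (2 * pi * n) * (n / exp 1) ^ n"

lemma summable_imp_convergent:
  fixes d :: "nat \<Rightarrow> real"
  assumes "summable (\<lambda>n. d (Suc n) - d n)"
  shows "convergent d"
proof -
  have "convergent (\<lambda>n. \<Sum>i<n. d (Suc i) - d i)"
    using assms by (simp add: summable_iff_convergent)
  then have "convergent (\<lambda>n. (d n - d 0) + d 0)"
    by (intro convergent_add convergent_const) (simp add: sum_lessThan_telescope)
  then show ?thesis by simp
qed

text \<open>
  The logarithm of the quotient has increments of order \<open>1 / n^2\<close>, so it converges.
\<close>

lemma fact_asymp_const:
  obtains C where "C > 0" "(\<lambda>n. fact n / (sqrt n * (n / exp 1) ^ n)) \<longlonglongrightarrow> (C::real)"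
proof -
  define d where "d n = ln (fact n) - (n + 1/2) * ln n + n" for n :: nat
  have "summable (\<lambda>n. d (Suc n) - d n)"
  proof (rule summable_comparison_test_bigo)
    have A: "(\<lambda>n::nat. 1 + (n + 1/2) * ln n - (n + 1/2) * ln (real n + 1)) \<in> O(\<lambda>n. 1 / real n ^ 2)"
      by real_asymp
    have B: "eventually (\<lambda>n. 1 + (n + 1/2) * ln n - (n + 1/2) * ln (real n + 1) = d (Suc n)
        - d n) sequentially"
      using eventually_gt_at_top[of 0]
    proof eventually_elim
      case (elim n)
      have "ln (fact (Suc n) :: real) = ln (n + 1) + ln (fact n)"
        using ln_mult[of "real n + 1" "fact n"] by (simp add: add.commute)
      then show ?case unfolding d_def by (simp add: algebra_simps)
    qed
    show "(\<lambda>n. d (Suc n) - d n) \<in> O(\<lambda>n. 1 / real n ^ 2)"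
      by (rule landau_o.big.in_cong[OF B, THEN iffD1, OF A])
    show "summable (\<lambda>n. norm (1 / real n ^ 2))"
      using inverse_power_summable[of 2, where 'a = real] by (simp add: inverse_eq_divide)
  qed
  then obtain L where L: "d \<longlonglongrightarrow> L" using summable_imp_convergent convergent_def by blast
  have "(\<lambda>n. exp (d n)) \<longlonglongrightarrow> exp L" by (intro tendsto_exp L)
  moreover have "eventually (\<lambda>n. exp (d n) = fact n / (sqrt n * (n / exp 1) ^ n)) sequentially"
    using eventually_gt_at_top[of 0]
  proof eventually_elim
    case (elim n)
    have "exp (d n) = fact n / exp ((n + 1/2) * ln n) * exp n"
      unfolding d_def by (simp add: exp_add exp_diff)
    also have "exp ((n + 1/2) * ln n) = n ^ n * sqrt n"
      using elim by (simp add: distrib_right exp_add exp_of_nat_mult powr_half_sqrt[symmetric]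
          powr_def)
    also have "exp (real n) = exp 1 ^ n" using exp_of_nat_mult[of n "1::real"] by simp
    finally show ?case by (simp add: power_divide)
  qed
  ultimately have "(\<lambda>n. fact n / (sqrt n * (n / exp 1) ^ n)) \<longlonglongrightarrow> exp L"
    by (rule Lim_transform_eventually)
  then show thesis using that[of "exp L"] by simp
qed

lemma wallis_product:
  "(\<Prod>k=1..n. (4 * real k^2) / (4 * real k^2 - 1)) = 16 ^ n * fact n ^ 4 / (fact (2 * n) ^ 2 * (2
      * real n + 1))"
proof (induction n)
  case (Suc n)
  have f: "fact (2 * Suc n) = 2 * (real n + 1) * (2 * real n + 1) * fact (2 * n)" by
      (simp add: algebra_simps)
  have "4 * real (Suc n)^2 - 1 = (2 * real n + 1) * (2 * real n + 3)" by
      (simp add: power2_eq_square algebra_simps)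
  then have e: "4 * real (Suc n)^2 / (4 * real (Suc n)^2 - 1) = 4 * (real n + 1)^2 / ((2 * real n
      + 1) * (2 * real n + 3))"
    by (simp add: add.commute)
  have "(\<Prod>k=1..Suc n. (4 * real k^2) / (4 * real k^2 - 1)) =
      (\<Prod>k=1..n. (4 * real k^2) / (4 * real k^2 - 1)) * (4 * real (Suc n)^2 / (4 * real (Suc n)^2
          - 1))"
    by simp
  then have "(\<Prod>k=1..Suc n. (4 * real k^2) / (4 * real k^2 - 1)) =
     16 ^ n * fact n ^ 4 / (fact (2 * n) ^ 2 * (2 * real n + 1)) * (4 * (real n + 1)^2 / ((2
         * real n + 1) * (2 * real n + 3)))"
    unfolding Suc.IH e .
  also have "\<dots> = 16 ^ Suc n * fact (Suc n) ^ 4 / (fact (2 * Suc n) ^ 2 * (2 * real (Suc n) + 1))"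
  proof -
    have alg: "W * F ^ 4 / (G ^ 2 * b) * (4 * a^2 / (b * c)) = 16 * W * (a * F) ^ 4 / ((2 * a * b
        * G) ^ 2 * c)"
      if "a > 0" "b > 0" "c > 0" "G > 0" for a b c F G W :: real
      using that by (simp add: field_simps power2_eq_square power4_eq_xxxx)
    have F: "fact (Suc n) = (real n + 1) * fact n" by (simp add: algebra_simps)
    have c: "2 * real (Suc n) + 1 = 2 * real n + 3" by simp
    show ?thesis unfolding f F c using alg[of "real n + 1" "2 * real n + 1" "2 * real n
        + 3" "fact (2 * n)" "16 ^ n" "fact n"]
      by (simp add: mult.commute)
  qed
  finally show ?case .
qed simp

text \<open>
  Wallis' product, written with factorials, identifies the constant.
\<close>

theorem stirling_limit: "(\<lambda>n. fact n / stirling n) \<longlonglongrightarrow> 1"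
proof -
  obtain C where C: "C > 0" "(\<lambda>n. fact n / (sqrt n * (n / exp 1) ^ n)) \<longlonglongrightarrow> (C::real)"
    by (rule fact_asymp_const)
  define r where "r n = fact n / (sqrt n * (n / exp 1) ^ n)" for n :: nat
  have r: "r \<longlonglongrightarrow> C" using C unfolding r_def by simp
  have r2: "(\<lambda>n. r (2 * n)) \<longlonglongrightarrow> C"
    using r by (rule LIMSEQ_subseq_LIMSEQ[unfolded o_def]) (auto simp: strict_mono_def)
  have "(\<lambda>n. real n / (2 * (2 * real n + 1))) \<longlonglongrightarrow> 1 / 4" by real_asymp
  moreover have "(\<lambda>n. r n ^ 4 / r (2 * n) ^ 2) \<longlonglongrightarrow> C ^ 4 / C ^ 2"
    using C(1) by (intro tendsto_divide tendsto_power r r2) simp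
  ultimately have "(\<lambda>n. r n ^ 4 / r (2 * n) ^ 2 * (real n / (2 * (2 * real n
      + 1)))) \<longlonglongrightarrow> C ^ 4 / C ^ 2 * (1 / 4)"
    by (intro tendsto_mult)
  moreover have "eventually (\<lambda>n. r n ^ 4 / r (2 * n) ^ 2 * (real n / (2 * (2 * real n + 1))) =
      (\<Prod>k=1..n. (4 * real k^2) / (4 * real k^2 - 1))) sequentially"
    using eventually_gt_at_top[of 0]
  proof eventually_elim
    case (elim n)
    define P where "P = (n / exp 1 :: real) ^ n"
    have P: "P > 0" using elim by (simp add: P_def)
    have "real (2 * n) / exp 1 = 2 * (real n / exp 1)" by simp
    then have "(real (2 * n) / exp 1) ^ (2 * n) = 2 ^ (2 * n) * P ^ 2"
      by (simp only: power_mult_distrib P_def power_mult[symmetric] mult.commute)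
    then have Q: "(real (2 * n) / exp 1) ^ (2 * n) = 4 ^ n * P ^ 2"
      by (simp add: power_mult)
    have "(4::real) ^ n * 4 ^ n = 16 ^ n" by (simp flip: power_mult_distrib)
    then have b: "r (2 * n) ^ 2 = fact (2 * n) ^ 2 / (2 * real n * (16 ^ n * P ^ 4))"
      unfolding r_def Q by (simp add: power_divide power_mult_distrib power2_eq_square
          power4_eq_xxxx mult_ac)
    have a: "r n ^ 4 = fact n ^ 4 / (real n ^ 2 * P ^ 4)"
    proof -
      have "sqrt n ^ 4 = real n ^ 2" using power_mult[of "sqrt n" 2 2] by simp
      then show ?thesis unfolding r_def P_def[symmetric] by (simp add: power_divide
          power_mult_distrib)
    qed
    have alg: "F / (x^2 * p) / (G / (2 * x * (W * p))) * (x / (2 * c)) = W * F / (G * c)"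
      if "x > 0" "p > 0" "G > 0" "c > 0" for F G W x p c :: real
      using that by (simp add: field_simps power2_eq_square)
    show ?case unfolding a b wallis_product using elim P by (intro alg) auto
  qed
  ultimately have "(\<lambda>n. \<Prod>k=1..n. (4 * real k^2) / (4 * real k^2 - 1)) \<longlonglongrightarrow> C ^ 4 / C ^ 2 * (1 / 4)"
    by (rule Lim_transform_eventually)
  then have "C ^ 4 / C ^ 2 * (1 / 4) = pi / 2" using wallis LIMSEQ_unique by blast
  then have "C ^ 2 = 2 * pi" using C(1) by (simp add: field_simps power2_eq_square power4_eq_xxxx)
  then have C2: "C = sqrt (2 * pi)" using C(1) by (metis less_imp_le real_sqrt_unique)
  have "(\<lambda>n. r n / C) \<longlonglongrightarrow> C / C" using C(1) by (intro tendsto_divide r tendsto_const) simp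
  moreover have "r n / C = fact n / stirling n" for n
    unfolding r_def stirling_def C2 by (simp add: real_sqrt_mult mult_ac)
  ultimately show ?thesis using C(1) by simp
qed

section \<open>The binomial distribution near its mean\<close>

text \<open>
  The relative entropy of a coin of bias \<open>u\<close> with respect to one of bias \<open>p\<close>. It is the exponential
  rate at which the binomial distribution decays away from its mean.
\<close>

definition rel_entropy :: "real \<Rightarrow> real \<Rightarrow> real" where
  "rel_entropy p u = u * ln (u / p) + (1 - u) * ln ((1 - u) / (1 - p))"

text \<open>
  The function and its derivative vanish at \<open>p\<close>, and its second derivative is \<open>1 / (u (1 - u))\<close>. With
  \<open>\<xi>\<close> tending to \<open>p\<close> this gives the Gaussian limit, with \<open>\<xi> (1 - \<xi>) \<le> 1/4\<close> a Gaussian upper bound.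
\<close>

lemma rel_entropy_taylor:
  assumes "0 < p" "p < 1" "0 < u" "u < 1"
  obtains \<xi> where "min u p \<le> \<xi>" "\<xi> \<le> max u p" "rel_entropy p u = (u - p)\<^sup>2 / (2 * \<xi> * (1 - \<xi>))"
proof (cases "u = p")
  case True
  then show ?thesis using that[of p] assms by (simp add: rel_entropy_def)
next
  case False
  define D where "D m = (if m = 0 then rel_entropy p else if m = 1 then (\<lambda>u. ln (u / p) - ln ((1
      - u) / (1 - p)))
      else (\<lambda>u. 1 / u + 1 / (1 - u)))" for m :: nat
  have "\<exists>t. (if u < p then u < t \<and> t < p else p < t \<and> t < u) \<and>
      rel_entropy p u = (\<Sum>m<2. (D m p / fact m) * (u - p) ^ m) + (D 2 t / fact 2) * (u - p) ^ 2"
  proof (rule Taylor[of 2 D _ "min u p" "max u p"])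
    show "\<forall>m t. m < 2 \<and> min u p \<le> t \<and> t \<le> max u p \<longrightarrow> DERIV (D m) t :> D (Suc m) t"
    proof (intro allI impI)
      fix m :: nat and t assume *: "m < 2 \<and> min u p \<le> t \<and> t \<le> max u p"
      then have t: "0 < t" "t < 1" using assms by auto
      have [derivative_intros]: "((\<lambda>u. ln (u / p)) has_real_derivative 1 / t) (at t)"
        using t assms by (auto intro!: derivative_eq_intros simp: field_simps)
      have [derivative_intros]: "((\<lambda>u. ln ((1 - u) / (1 - p))) has_real_derivative - 1 / (1 - t))
          (at t)"
        using t assms by (auto intro!: derivative_eq_intros simp: divide_simps)
      consider "m = 0" | "m = 1" using * by linarith
      then show "DERIV (D m) t :> D (Suc m) t"
      proof cases
        case 1
        have "((\<lambda>u. u * ln (u / p) + (1 - u) * ln ((1 - u) / (1 - p))) has_real_derivative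
            ln (t / p) - ln ((1 - t) / (1 - p))) (at t)"
          using t by (auto intro!: derivative_eq_intros)
        then show ?thesis by (simp add: 1 D_def rel_entropy_def[abs_def])
      next
        case 2
        have "((\<lambda>u. ln (u / p) - ln ((1 - u) / (1 - p))) has_real_derivative 1 / t + 1 / (1 - t))
            (at t)"
          using t by (auto intro!: derivative_eq_intros)
        then show ?thesis by (simp add: 2 D_def)
      qed
    qed
  qed (use False in \<open>auto simp: D_def\<close>)
  then obtain t where t: "if u < p then u < t \<and> t < p else p < t \<and> t < u"
      "rel_entropy p u = (\<Sum>m<2. (D m p / fact m) * (u - p) ^ m) + (D 2 t / fact 2) * (u - p) ^ 2"
          by blast
  have t01: "0 < t" "t < 1" using t(1) assms by (auto split: if_splits)
  have "D 0 p = 0" "D 1 p = 0" using assms by (simp_all add: D_def rel_entropy_def)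
  then have "rel_entropy p u = D 2 t / 2 * (u - p) ^ 2"
    using t(2) by (simp add: eval_nat_numeral)
  also have "D 2 t = 1 / (t * (1 - t))" using t01 by (simp add: D_def field_simps)
  finally show ?thesis using that[of t] t(1) t01 by (auto split: if_splits)
qed

lemma rel_entropy_ge:
  assumes "0 < p" "p < 1" "0 < u" "u < 1"
  shows "rel_entropy p u \<ge> 2 * (u - p)\<^sup>2"
proof -
  obtain \<xi> where \<xi>: "min u p \<le> \<xi>" "\<xi> \<le> max u p" "rel_entropy p u = (u - p)\<^sup>2 / (2 * \<xi> * (1 - \<xi>))"
    using rel_entropy_taylor[OF assms] .
  have \<xi>01: "0 < \<xi>" "\<xi> < 1" using \<xi>(1,2) assms by auto
  have "2 * \<xi> * (1 - \<xi>) \<le> 1 / 2"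
    using zero_le_power2[of "2 * \<xi> - 1"] by (simp add: power2_eq_square algebra_simps)
  moreover have "0 < 2 * \<xi> * (1 - \<xi>)" using \<xi>01 by simp
  ultimately have "(u - p)\<^sup>2 / (1 / 2) \<le> (u - p)\<^sup>2 / (2 * \<xi> * (1 - \<xi>))"
    by (intro divide_left_mono) auto
  then show ?thesis using \<xi>(3) by simp
qed

definition stirling_ratio :: "nat \<Rightarrow> real" where
  "stirling_ratio n = fact n / stirling n"

lemma stirling_pos: "n > 0 \<Longrightarrow> stirling n > 0"
  by (simp add: stirling_def)

lemma stirling_ratio_pos: "n > 0 \<Longrightarrow> stirling_ratio n > 0"
  by (simp add: stirling_ratio_def stirling_pos)

text \<open>
  Replacing the factorials by Stirling's approximation leaves exactly the exponential of the relative
  entropy and a prefactor.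
\<close>

lemma Bernstein_stirling:
  assumes "0 < p" "p < 1" "0 < k" "k < M"
  shows "Bernstein M k p = stirling_ratio M / (stirling_ratio k * stirling_ratio (M - k)) *
    sqrt (real M / (2 * pi * real k * real (M - k))) * exp (- real M * rel_entropy p
        (real k / real M))"
proof -
  define m where "m = M - k"
  have M: "M = k + m" "m > 0" "k > 0" using assms by (auto simp: m_def)
  have M0: "M > 0" using assms by simp
  have f: "fact n = stirling_ratio n * stirling n" if "n > 0" for n :: nat
    using stirling_pos[OF that] by (simp add: stirling_ratio_def)
  have e: "exp (- real M * rel_entropy p (real k / real M)) = (M * p / k) ^ k * (M * (1
      - p) / m) ^ m"
  proof -
    have "real m = real M - real k" using M by simp
    then have 1: "1 - real k / real M = real m / real M" using M0 by (simp add: diff_divide_distrib)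
    have "- real M * rel_entropy p (real k / real M) = real k * ln (M * p / k) + real m * ln (M *
        (1 - p) / m)"
    proof -
      have "real k / real M / p = inverse (M * p / k)" "real m / real M / (1 - p) = inverse (M *
          (1 - p) / m)"
        using M0 M assms by (simp_all add: field_simps)
      moreover have "M * p / k > 0" "M * (1 - p) / m > 0" using M0 M assms by simp_all
      ultimately have ln: "ln (real k / real M / p) = - ln (M * p / k)" "ln (real m / real M / (1
          - p)) = - ln (M * (1 - p) / m)"
        by (simp_all only: ln_inverse)
      have "- x * (c / x * (- A) + d / x * (- B)) = c * A + d * B" if "x > 0" for x c d A B :: real
        using that by (simp add: field_simps)
      then show ?thesis unfolding rel_entropy_def 1 ln using M0 by simp
    qed
    then show ?thesis using M assms by (simp add: exp_add exp_of_nat_mult)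
  qed
  have s: "stirling M / (stirling k * stirling m) = sqrt (real M / (2 * pi * real k * real m)) *
      ((M / k) ^ k * (M / m) ^ m)"
  proof -
    have "2 * pi * M / ((2 * pi * k) * (2 * pi * m)) = real M / (2 * pi * real k * real m)"
      by simp
    then have 1: "sqrt (2 * pi * M) / (sqrt (2 * pi * k) * sqrt (2 * pi * m)) = sqrt (real M / (2
        * pi * real k * real m))"
      by (metis real_sqrt_divide real_sqrt_mult)
    have "(M / exp 1) ^ M = (M / exp 1) ^ k * (M / exp 1) ^ m" using M(1) by (metis power_add)
    then have "(M / exp 1) ^ M / ((k / exp 1) ^ k * (m / exp 1) ^ m) =
        (M / exp 1 / (k / exp 1)) ^ k * (M / exp 1 / (m / exp 1)) ^ m"
      by (simp only: power_divide times_divide_times_eq)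
    then have 2: "(M / exp 1) ^ M / ((k / exp 1) ^ k * (m / exp 1) ^ m) = (M / k) ^ k * (M / m) ^ m"
      by simp
    have "(A * P) / ((c * q) * (d * r)) = (A / (c * d)) * (P / (q * r))" for A P c q d r :: real
      by (simp add: times_divide_times_eq mult_ac)
    then show ?thesis unfolding stirling_def 1[symmetric] 2[symmetric] .
  qed
  have "Bernstein M k p = fact M / (fact k * fact m) * (p ^ k * (1 - p) ^ m)"
    unfolding Bernstein_def using binomial_fact[of k M, where 'a = real] assms by (simp add: m_def)
  also have "\<dots> = stirling_ratio M / (stirling_ratio k * stirling_ratio m) * (stirling M /
      (stirling k * stirling m)) * (p ^ k * (1 - p) ^ m)"
    using M by (simp add: f)
  also have "\<dots> = stirling_ratio M / (stirling_ratio k * stirling_ratio m) * sqrt (real M / (2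
      * pi * real k * real m)) * ((M / k) ^ k * (M / m) ^ m * (p ^ k * (1 - p) ^ m))"
    unfolding s by simp
  also have "(M / k) ^ k * (M / m) ^ m * (p ^ k * (1 - p) ^ m) = (M * p / k) ^ k * (M * (1
      - p) / m) ^ m"
    by (simp add: power_divide power_mult_distrib)
  finally show ?thesis unfolding e m_def .
qed

text \<open>
  Gaussian domination, uniform as long as \<open>k / M\<close> stays away from 0 and 1, where the prefactor is of the
  order \<open>1 / sqrt M\<close>.
\<close>

lemma Bernstein_bound:
  assumes p: "0 < p" "p < 1" and a: "0 < a" "b < 1"
  obtains C where "C > 0" "\<And>M k. 0 < M \<Longrightarrow> a * real M \<le> real k \<Longrightarrow> real k \<le> b * real M \<Longrightarrow>
    sqrt M * Bernstein M k p \<le> C * exp (- 2 * ((k - p * M) / sqrt M)\<^sup>2)"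
proof -
  have lim: "stirling_ratio \<longlonglongrightarrow> 1" using stirling_limit by (simp add: stirling_ratio_def[abs_def])
  have bounded_above: "\<exists>B. \<forall>n. f n \<le> B" if "f \<longlonglongrightarrow> L" for f :: "nat \<Rightarrow> real" and L
    using convergent_imp_Bseq[OF convergentI[OF that]] unfolding Bseq_def by
        (metis abs_le_D1 real_norm_def)
  from bounded_above[OF lim] obtain B where B: "\<And>n. stirling_ratio n \<le> B" by blast
  have "(\<lambda>n. inverse (stirling_ratio n)) \<longlonglongrightarrow> inverse 1" by (intro tendsto_inverse lim) simp
  from bounded_above[OF this] obtain B' where B': "\<And>n. inverse (stirling_ratio n) \<le> B'" by blast
  define Q where "Q = 1 / (2 * pi * a * (1 - b))"
  define C where "C = B * (B' * B') * sqrt Q"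
  have "0 < stirling_ratio 1" by (rule stirling_ratio_pos) simp
  moreover from this have "0 < inverse (stirling_ratio 1)" by simp
  ultimately have Bpos: "B > 0" "B' > 0"
    using B[of 1] B'[of 1] by linarith+
  have Qpos: "Q > 0" using a by (simp add: Q_def)
  have "sqrt M * Bernstein M k p \<le> C * exp (- 2 * ((k - p * M) / sqrt M)\<^sup>2)"
    if *: "0 < M" "a * real M \<le> real k" "real k \<le> b * real M" for M k
  proof -
    have "b * real M < 1 * real M" using a * by (intro mult_strict_right_mono) auto
    moreover have "0 < a * real M" using a * by simp
    ultimately have k: "0 < k" "k < M" using * by (simp_all, linarith+)
    have 1: "stirling_ratio M / (stirling_ratio k * stirling_ratio (M - k)) \<le> B * (B' * B')"
    proof -
      have "stirling_ratio M * (inverse (stirling_ratio k) * inverse (stirling_ratio (M - k)))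
          \<le> B * (B' * B')"
        using k stirling_ratio_pos Bpos by (intro mult_mono B B')
            (auto intro!: mult_nonneg_nonneg less_imp_le)
      then show ?thesis by (simp add: divide_inverse)
    qed
    have 2: "sqrt M * sqrt (real M / (2 * pi * real k * real (M - k))) \<le> sqrt Q"
    proof -
      have "(1 - b) * real M \<le> real (M - k)" using * k by (simp add: of_nat_diff algebra_simps)
      then have "(a * real M) * ((1 - b) * real M) \<le> real k * real (M - k)"
        using * a by (intro mult_mono) auto
      then have "real M * real M / (2 * pi * (real k * real (M - k))) \<le> real M * real M / (2 * pi
          * ((a * real M) * ((1 - b) * real M)))"
        using * a k by (intro divide_left_mono mult_left_mono) auto
      also have "\<dots> = Q" using *(1) a by (simp add: Q_def)
      finally have "real M * (real M / (2 * pi * real k * real (M - k))) \<le> Q" by (simp add: mult_ac)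
      then show ?thesis by (simp add: real_sqrt_mult[symmetric])
    qed
    have 3: "exp (- real M * rel_entropy p (real k / real M)) \<le> exp (- 2 * ((k - p
        * M) / sqrt M)\<^sup>2)"
    proof -
      have "2 * (real k / real M - p)\<^sup>2 \<le> rel_entropy p (real k / real M)"
        using k p by (intro rel_entropy_ge) auto
      then have "real M * (2 * (real k / real M - p)\<^sup>2) \<le> real M * rel_entropy p (real k / real M)"
        by (intro mult_left_mono) auto
      moreover have "real M * (2 * (real k / real M - p)\<^sup>2) = 2 * ((k - p * M) / sqrt M)\<^sup>2"
        using k by (simp add: power_divide field_simps power2_eq_square)
      ultimately show ?thesis by simp
    qed
    have "sqrt M * Bernstein M k p = (stirling_ratio M / (stirling_ratio k * stirling_ratio (M
        - k))) *
       (sqrt M * sqrt (real M / (2 * pi * real k * real (M - k)))) * exp (- real M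
           * rel_entropy p (real k / real M))"
      unfolding Bernstein_stirling[OF p k] by (simp add: mult_ac)
    also have "\<dots> \<le> B * (B' * B') * sqrt Q * exp (- 2 * ((k - p * M) / sqrt M)\<^sup>2)"
      using Bpos Qpos k stirling_ratio_pos by (intro mult_mono 1 2 3)
          (auto intro!: mult_nonneg_nonneg divide_nonneg_nonneg less_imp_le)
    finally show ?thesis by (simp add: C_def)
  qed
  moreover have "C > 0" using Bpos Qpos by (simp add: C_def)
  ultimately show thesis using that by blast
qed

text \<open>
  The de Moivre-Laplace local limit theorem, for an arbitrary sequence of sizes and positions.
\<close>

lemma Bernstein_local_limit:
  fixes M k :: "nat \<Rightarrow> nat"
  assumes p: "0 < p" "p < 1"
    and M: "filterlim M at_top sequentially"
    and x: "(\<lambda>n. (real (k n) - p * real (M n)) / sqrt (M n)) \<longlonglongrightarrow> x"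
  shows "(\<lambda>n. sqrt (M n) * Bernstein (M n) (k n) p) \<longlonglongrightarrow>
    exp (- x\<^sup>2 / (2 * p * (1 - p))) / sqrt (2 * pi * p * (1 - p))"
proof -
  have Mr: "filterlim (\<lambda>n. real (M n)) at_top sequentially"
    using filterlim_compose[OF filterlim_real_sequentially M] .
  have "(\<lambda>n. 1 / sqrt (M n)) \<longlonglongrightarrow> 0"
    using tendsto_divide_0[OF tendsto_const filterlim_at_top_imp_at_infinity[OF
        filterlim_compose[OF sqrt_at_top Mr]]] .
  from tendsto_mult[OF x this] have "(\<lambda>n. (real (k n) - p * real (M n)) / sqrt (M n) * (1 / sqrt
      (M n))) \<longlonglongrightarrow> 0"
    by simp
  then have u': "(\<lambda>n. (real (k n) - p * real (M n)) / sqrt (M n) * (1 / sqrt (M n)) + p) \<longlonglongrightarrow> p"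
    using tendsto_add[OF _ tendsto_const[of p]] by fastforce
  define u where "u n = real (k n) / real (M n)" for n
  have Mpos: "eventually (\<lambda>n. M n > 0) sequentially"
    using M unfolding filterlim_at_top by (auto elim: eventually_mono[OF spec[of _ 1]])
  have u: "u \<longlonglongrightarrow> p"
    by (rule Lim_transform_eventually[OF u']) (use Mpos in eventually_elim, simp add: u_def
        field_simps)
  have u01: "eventually (\<lambda>n. 0 < u n \<and> u n < 1) sequentially"
    using order_tendstoD[OF u] p by (auto intro: eventually_conj)
  have good: "eventually (\<lambda>n. 0 < M n \<and> 0 < k n \<and> k n < M n \<and> 0 < u n \<and> u n < 1) sequentially"
    using Mpos u01 by eventually_elim (auto simp: u_def field_simps zero_less_divide_iff)
  have kr: "filterlim (\<lambda>n. real (k n)) at_top sequentially"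
  proof -
    have "filterlim (\<lambda>n. u n * real (M n)) at_top sequentially"
      by (rule filterlim_tendsto_pos_mult_at_top[OF u p(1) Mr])
    then show ?thesis
      by (rule filterlim_mono_eventually) (use Mpos in \<open>auto elim!: eventually_mono simp: u_def\<close>)
  qed
  have mr: "filterlim (\<lambda>n. real (M n - k n)) at_top sequentially"
  proof -
    have "(\<lambda>n. 1 - u n) \<longlonglongrightarrow> 1 - p" by (intro tendsto_intros u)
    then have "filterlim (\<lambda>n. (1 - u n) * real (M n)) at_top sequentially"
      using filterlim_tendsto_pos_mult_at_top[OF _ _ Mr] p by simp
    then show ?thesis
      by (rule filterlim_mono_eventually) (use good in \<open>auto elim!: eventually_mono simp: u_def
          field_simps of_nat_diff\<close>)
  qed
  have lim: "stirling_ratio \<longlonglongrightarrow> 1" using stirling_limit by (simp add: stirling_ratio_def[abs_def])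
  have kn: "filterlim k at_top sequentially" "filterlim (\<lambda>n. M n - k n) at_top sequentially"
    using kr mr by (simp_all add: filterlim_sequentially_iff_filterlim_real)
  have 1: "(\<lambda>n. stirling_ratio (M n) / (stirling_ratio (k n) * stirling_ratio (M n - k n))) \<longlonglongrightarrow> 1 /
      (1 * 1)"
    by (intro tendsto_divide tendsto_mult filterlim_compose[OF lim] M kn) simp
  have 2: "(\<lambda>n. sqrt (1 / (2 * pi * u n * (1 - u n)))) \<longlonglongrightarrow> sqrt (1 / (2 * pi * p * (1 - p)))"
    using p by (intro tendsto_intros u) auto
  have ex: "\<forall>n. \<exists>\<xi>. 0 < u n \<and> u n < 1 \<longrightarrow> min (u n) p \<le> \<xi> \<and> \<xi> \<le> max (u n) p \<and>
      rel_entropy p (u n) = (u n - p)\<^sup>2 / (2 * \<xi> * (1 - \<xi>))"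
    using rel_entropy_taylor[OF p] by metis
  then obtain \<xi> where \<xi>: "\<And>n. 0 < u n \<and> u n < 1 \<Longrightarrow> min (u n) p \<le> \<xi> n \<and> \<xi> n \<le> max (u n) p \<and>
      rel_entropy p (u n) = (u n - p)\<^sup>2 / (2 * \<xi> n * (1 - \<xi> n))" by metis
  have \<xi>p: "\<xi> \<longlonglongrightarrow> p"
  proof (rule tendsto_sandwich)
    show "eventually (\<lambda>n. min (u n) p \<le> \<xi> n) sequentially" "eventually (\<lambda>n. \<xi> n \<le> max
        (u n) p) sequentially"
      using u01 by (eventually_elim, use \<xi> in blast)+
    show "(\<lambda>n. min (u n) p) \<longlonglongrightarrow> p" using tendsto_min[OF u tendsto_const[of p]] by simp
    show "(\<lambda>n. max (u n) p) \<longlonglongrightarrow> p" using tendsto_max[OF u tendsto_const[of p]] by simp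
  qed
  have 3: "(\<lambda>n. exp (- ((real (k n) - p * real (M n)) / sqrt (M n))\<^sup>2 / (2 * \<xi> n * (1
      - \<xi> n)))) \<longlonglongrightarrow> exp (- x\<^sup>2 / (2 * p * (1 - p)))"
    using p by (intro tendsto_intros x \<xi>p) auto
  from tendsto_mult[OF tendsto_mult[OF 1 2] 3]
  have "(\<lambda>n. stirling_ratio (M n) / (stirling_ratio (k n) * stirling_ratio (M n - k n)) * sqrt
      (1 / (2 * pi * u n * (1 - u n))) *
      exp (- ((real (k n) - p * real (M n)) / sqrt (M n))\<^sup>2 / (2 * \<xi> n * (1 - \<xi> n)))) \<longlonglongrightarrow>
      exp (- x\<^sup>2 / (2 * p * (1 - p))) / sqrt (2 * pi * p * (1 - p))"
    by (simp add: real_sqrt_divide)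
  moreover have "eventually (\<lambda>n. stirling_ratio (M n) / (stirling_ratio (k n) * stirling_ratio
      (M n - k n)) * sqrt (1 / (2 * pi * u n * (1 - u n))) *
      exp (- ((real (k n) - p * real (M n)) / sqrt (M n))\<^sup>2 / (2 * \<xi> n * (1 - \<xi> n))) = sqrt (M n)
          * Bernstein (M n) (k n) p) sequentially"
    using good
  proof eventually_elim
    case (elim n)
    have "sqrt (M n) * sqrt (real (M n) / (2 * pi * real (k n) * real (M n - k n))) = sqrt (1 /
        (2 * pi * u n * (1 - u n)))"
      unfolding real_sqrt_mult[symmetric] using elim by (simp add: u_def field_simps of_nat_diff)
    moreover have "real (M n) * rel_entropy p (u n) = ((real (k n) - p * real (M n)) / sqrt
        (M n))\<^sup>2 / (2 * \<xi> n * (1 - \<xi> n))"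
    proof -
      have "real (M n) * (u n - p)\<^sup>2 = ((real (k n) - p * real (M n)) / sqrt (M n))\<^sup>2"
        using elim by (simp add: u_def power_divide field_simps power2_eq_square)
      moreover have "rel_entropy p (u n) = (u n - p)\<^sup>2 / (2 * \<xi> n * (1 - \<xi> n))" using \<xi> elim
          by blast
      ultimately show ?thesis by (metis times_divide_eq_right)
    qed
    ultimately show ?case
      using Bernstein_stirling[OF p, of "k n" "M n"] elim unfolding u_def by (simp add: mult_ac)
  qed
  ultimately show ?thesis by (rule Lim_transform_eventually)
qed

section \<open>The single sum as a product of three distributions\<close>

lemma Bernstein_le_1:
  assumes "0 \<le> p" "p \<le> 1"
  shows "Bernstein M k p \<le> 1"
proof (cases "k \<le> M")
  case True
  have "Bernstein M k p \<le> (\<Sum>k\<le>M. Bernstein M k p)"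
    using True assms by (intro member_le_sum) (auto intro: Bernstein_nonneg)
  then show ?thesis by simp
qed (simp add: Bernstein_def binomial_eq_0)

lemma Bernstein_variance:
  "(\<Sum>k\<le>M. (real k - real M * p)\<^sup>2 * Bernstein M k p) = real M * p * (1 - p)"
proof -
  have "(real k - real M * p)\<^sup>2 * Bernstein M k p =
      real k * (real k - 1) * Bernstein M k p + (1 - 2 * real M * p) * (real k * Bernstein M k p)
          + (real M * p)\<^sup>2 * Bernstein M k p" for k
    by (simp add: power2_eq_square algebra_simps)
  then have "(\<Sum>k\<le>M. (real k - real M * p)\<^sup>2 * Bernstein M k p) =
      real M * (real M - 1) * p\<^sup>2 + (1 - 2 * real M * p) * (real M * p) + (real M * p)\<^sup>2"
    by (simp add: sum.distrib flip: sum_distrib_left)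
  then show ?thesis by (simp add: power2_eq_square algebra_simps)
qed

text \<open>
  Chebyshev's inequality for the binomial distribution, with the variance estimated by \<open>M\<close>.
\<close>

lemma Bernstein_Chebyshev:
  assumes p: "0 \<le> p" "p \<le> 1" and K: "finite K" "\<And>k. k \<in> K \<Longrightarrow> d \<le> \<bar>real k - real M
      * p\<bar>" and d: "d > 0"
  shows "(\<Sum>k\<in>K. Bernstein M k p) \<le> real M / d\<^sup>2"
proof -
  have "d\<^sup>2 * (\<Sum>k\<in>K. Bernstein M k p) = (\<Sum>k\<in>K. d\<^sup>2 * Bernstein M k p)"
    by (simp add: sum_distrib_left)
  also have "\<dots> \<le> (\<Sum>k\<in>K. (real k - real M * p)\<^sup>2 * Bernstein M k p)"
  proof (intro sum_mono mult_right_mono)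
    fix k assume "k \<in> K"
    then have "d\<^sup>2 \<le> \<bar>real k - real M * p\<bar>\<^sup>2" using K d by (intro power_mono) auto
    then show "d\<^sup>2 \<le> (real k - real M * p)\<^sup>2" by simp
  qed (use p Bernstein_nonneg in auto)
  also have "\<dots> \<le> (\<Sum>k\<in>K \<union> {..M}. (real k - real M * p)\<^sup>2 * Bernstein M k p)"
    using K p by (intro sum_mono2) (auto intro: Bernstein_nonneg mult_nonneg_nonneg)
  also have "\<dots> = (\<Sum>k\<le>M. (real k - real M * p)\<^sup>2 * Bernstein M k p)"
    using K by (intro sum.mono_neutral_right) (auto simp: Bernstein_def)
  also have "\<dots> = real M * (p * (1 - p))" by (simp add: Bernstein_variance)
  also have "\<dots> \<le> real M * 1"
  proof (intro mult_left_mono)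
    have "p * (1 - p) \<le> 1 * 1" using p by (intro mult_mono) auto
    then show "p * (1 - p) \<le> 1" by simp
  qed simp
  finally show ?thesis using d by (simp add: field_simps)
qed

text \<open>
  This number is written \<open>\<lambda>\<close> in the comments.
\<close>

definition golden :: real where "golden = (sqrt 5 - 1) / 2"

lemma golden_sq: "golden\<^sup>2 = 1 - golden"
  by (simp add: golden_def power2_eq_square field_simps)

lemma golden_bounds: "3/5 < golden" "golden < 31/50"
proof -
  have "2.2 < sqrt 5" by (rule real_less_rsqrt) (simp add: power2_eq_square)
  moreover have "sqrt 5 < 2.24" by (rule real_less_lsqrt) (simp_all add: power2_eq_square)
  ultimately show "3/5 < golden" "golden < 31/50" by (simp_all add: golden_def)
qed

lemma golden_cube: "golden ^ 3 = sqrt 5 - 2"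
proof -
  have "golden ^ 3 = golden * golden\<^sup>2" by (simp add: power2_eq_square power3_eq_cube)
  also have "\<dots> = golden - golden\<^sup>2" unfolding golden_sq by (simp add: power2_eq_square[symmetric]
      right_diff_distrib golden_sq)
  also have "\<dots> = 2 * golden - 1" unfolding golden_sq by simp
  also have "\<dots> = sqrt 5 - 2" by (simp add: golden_def field_simps)
  finally show ?thesis .
qed

text \<open>
  Three binomial probabilities, with means \<open>\<lambda> n\<close>, \<open>\<lambda> (n + 2)\<close> and \<open>\<lambda>^2 (n + j + 2)\<close>. Because of
  \<open>\<lambda>^2 (1 + \<lambda>) = \<lambda>\<close> all three are near their maximum when \<open>j\<close> is near \<open>\<lambda> n\<close>.
\<close>

definition pmf_term :: "nat \<Rightarrow> nat \<Rightarrow> real" where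
  "pmf_term n j = Bernstein n (j + 2) golden * Bernstein (n + 2) j golden * Bernstein (n + j + 2)
      (j + 1) (golden\<^sup>2)"

text \<open>
  By \<open>1 - \<lambda> = \<lambda>^2\<close> and \<open>1 - \<lambda>^2 = \<lambda>\<close> all weights are powers of \<open>\<lambda>\<close>, and the exponents that depend on \<open>j\<close>
  cancel.
\<close>

lemma pmf_term_eq_binomials:
  "pmf_term n j = golden ^ (5 * n + 5) * real ((n choose (j + 2)) * ((n + 2) choose j) * ((n + j
      + 2) choose (j + 1)))"
proof (cases "j + 2 \<le> n")
  case True
  have e: "1 - golden = golden\<^sup>2" "1 - golden\<^sup>2 = golden" using golden_sq by auto
  have "golden ^ (j + 2) * (golden\<^sup>2) ^ (n - (j + 2)) * (golden ^ j * (golden\<^sup>2) ^ (n + 2 - j)) *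
      ((golden\<^sup>2) ^ (j + 1) * golden ^ (n + j + 2 - (j + 1))) = golden ^ (5 * n + 5)"
    unfolding power_mult[symmetric] power_add[symmetric]
    by (rule arg_cong[of _ _ "\<lambda>k. golden ^ k"]) (use True in simp)
  moreover have "pmf_term n j = (golden ^ (j + 2) * (golden\<^sup>2) ^ (n - (j + 2)) * (golden ^ j *
      (golden\<^sup>2) ^ (n + 2 - j)) *
      ((golden\<^sup>2) ^ (j + 1) * golden ^ (n + j + 2 - (j + 1)))) *
      real ((n choose (j + 2)) * ((n + 2) choose j) * ((n + j + 2) choose (j + 1)))"
    unfolding pmf_term_def Bernstein_def e of_nat_mult by (simp only: mult_ac)
  ultimately show ?thesis by simp
next
  case False
  then have "n choose (j + 2) = 0" by simp
  then show ?thesis by (simp add: pmf_term_def Bernstein_def)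
qed

lemma pmf_term_nonneg: "pmf_term n j \<ge> 0"
  unfolding pmf_term_eq_binomials using golden_bounds by simp

text \<open>
  Far from the mean Chebyshev's inequality bounds a single probability by a multiple of \<open>1 / n\<close>, and
  also the sum of all of them. The product of two such bounds is of the order \<open>1 / n^2\<close>, which
  is negligible.
\<close>

lemma pmf_term_far:
  assumes \<eta>: "0 < \<eta>"
  shows "(\<lambda>n. real n * (\<Sum>j | j \<le> n \<and> \<eta> * real n \<le> \<bar>real j - golden * real n\<bar>. pmf_term n j)) \<longlonglongrightarrow> 0"
proof (rule tendsto_sandwich)
  show "eventually (\<lambda>n. 0 \<le> real n * (\<Sum>j | j \<le> n \<and> \<eta> * real n \<le> \<bar>real j - golden
      * real n\<bar>. pmf_term n j)) sequentially"
    by (intro always_eventually allI mult_nonneg_nonneg sum_nonneg pmf_term_nonneg) simp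
  have "eventually (\<lambda>n. real n \<ge> 4 / \<eta>) sequentially"
    using filterlim_real_sequentially by (simp add: filterlim_at_top)
  then show "eventually (\<lambda>n. real n * (\<Sum>j | j \<le> n \<and> \<eta> * real n \<le> \<bar>real j - golden
      * real n\<bar>. pmf_term n j) \<le>
      real n * (real (n + 2) / (\<eta> * real n / 2)\<^sup>2 * (real n / (\<eta> * real n / 2)\<^sup>2))) sequentially"
    using eventually_gt_at_top[of 0]
  proof eventually_elim
    case (elim n)
    let ?J = "{j. j \<le> n \<and> \<eta> * real n \<le> \<bar>real j - golden * real n\<bar>}"
    have lam01: "0 \<le> golden" "golden \<le> 1" "0 \<le> golden\<^sup>2" "golden\<^sup>2 \<le> 1"
        using golden_bounds golden_sq by auto
    \<comment> \<open>Half of the distance \<open>\<eta> n\<close> absorbs the shifts by 2 in the index and in the size.\<close>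
    have big: "2 \<le> \<eta> * real n / 2" using elim \<eta> by (simp add: field_simps)
    have pos: "0 < \<eta> * real n / 2" using elim \<eta> by simp
    have B: "Bernstein (n + 2) j golden \<le> real (n + 2) / (\<eta> * real n / 2)\<^sup>2" if "j \<in> ?J" for j
    proof -
      have "\<eta> * real n / 2 \<le> \<bar>real j - real (n + 2) * golden\<bar>"
        using that big golden_bounds by (auto simp: algebra_simps abs_if split: if_splits)
      then show ?thesis using Bernstein_Chebyshev[of golden "{j}" "\<eta> * real n / 2" "n
          + 2"] lam01 pos by simp
    qed
    have A: "(\<Sum>j\<in>?J. Bernstein n (j + 2) golden) \<le> real n / (\<eta> * real n / 2)\<^sup>2"
    proof -
      have "(\<Sum>j\<in>?J. Bernstein n (j + 2) golden) = (\<Sum>k\<in>(\<lambda>j. j + 2) ` ?J. Bernstein n k golden)"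
        by (subst sum.reindex) (auto simp: inj_on_def)
      also have "\<dots> \<le> real n / (\<eta> * real n / 2)\<^sup>2"
      proof (rule Bernstein_Chebyshev)
        fix k assume "k \<in> (\<lambda>j. j + 2) ` ?J"
        then show "\<eta> * real n / 2 \<le> \<bar>real k - real n * golden\<bar>"
          using big by (auto simp: algebra_simps abs_if split: if_splits)
      qed (use lam01 pos in auto)
      finally show ?thesis .
    qed
    have "(\<Sum>j\<in>?J. pmf_term n j) \<le> (\<Sum>j\<in>?J. real (n + 2) / (\<eta> * real n / 2)\<^sup>2 * Bernstein n (j
        + 2) golden)"
    proof (intro sum_mono)
      fix j assume j: "j \<in> ?J"
      have "pmf_term n j \<le> Bernstein n (j + 2) golden * (real (n + 2) / (\<eta> * real n / 2)\<^sup>2) * 1"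
        unfolding pmf_term_def using lam01 j
        by (intro mult_mono B Bernstein_le_1 mult_nonneg_nonneg Bernstein_nonneg) auto
      then show "pmf_term n j \<le> real (n + 2) / (\<eta> * real n / 2)\<^sup>2 * Bernstein n (j + 2) golden"
          by (simp add: mult.commute)
    qed
    also have "\<dots> \<le> real (n + 2) / (\<eta> * real n / 2)\<^sup>2 * (real n / (\<eta> * real n / 2)\<^sup>2)"
      unfolding sum_distrib_left[symmetric] by (intro mult_left_mono A) simp
    finally show ?case by (intro mult_left_mono) auto
  qed
  show "(\<lambda>n. real n * (real (n + 2) / (\<eta> * real n / 2)\<^sup>2 * (real n / (\<eta> * real n / 2)\<^sup>2))) \<longlonglongrightarrow> 0"
    using \<eta> by real_asymp
qed simp

text \<open>
  The product of the limiting densities of the three factors. Their exponents add up to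
  \<open>(1 / \<lambda>^3 + 1 / 2) x^2\<close>, and \<open>\<lambda>^3 + 2 = sqrt 5\<close>.
\<close>

definition gauss_limit :: "real \<Rightarrow> real" where
  "gauss_limit x = sqrt golden / (2 * pi * golden ^ 3 * sqrt (2 * pi * golden ^ 3)) * exp (-
      (sqrt 5 / (2 * golden ^ 3)) * x\<^sup>2)"

lemma gauss_limit_integral:
  "integrable lborel gauss_limit" "(\<integral>x. gauss_limit x \<partial>lborel) = sqrt golden / (2 * pi
      * golden ^ 3 * sqrt (sqrt 5))"
proof -
  have golden: "golden > 0" using golden_bounds by simp
  define \<sigma> where "\<sigma> = sqrt (golden ^ 3 / sqrt 5)"
  have \<sigma>: "\<sigma> > 0" "\<sigma>\<^sup>2 = golden ^ 3 / sqrt 5" using golden by (simp_all add: \<sigma>_def)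
  define c where "c = sqrt golden / (2 * pi * golden ^ 3 * sqrt (sqrt 5))"
  have g: "gauss_limit x = c * normal_density 0 \<sigma> x" for x
  proof -
    have S: "sqrt (2 * pi * golden ^ 3) = sqrt (2 * pi * \<sigma>\<^sup>2) * sqrt (sqrt 5)"
      unfolding \<sigma>(2) by (simp flip: real_sqrt_mult)
    have E: "- (x - 0)\<^sup>2 / (2 * \<sigma>\<^sup>2) = - (sqrt 5 / (2 * golden ^ 3)) * x\<^sup>2"
      unfolding \<sigma>(2) by simp
    show ?thesis unfolding gauss_limit_def normal_density_def c_def S E by (simp add: mult_ac)
  qed
  show "integrable lborel gauss_limit" unfolding g[abs_def] using \<sigma>(1) by simp
  show "(\<integral>x. gauss_limit x \<partial>lborel) = sqrt golden / (2 * pi * golden ^ 3 * sqrt (sqrt 5))"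
    unfolding g using \<sigma>(1) by (simp add: c_def)
qed

text \<open>
  The index \<open>j\<close> at distance about \<open>x sqrt n\<close> from \<open>\<lambda> n\<close>.
\<close>

definition site :: "nat \<Rightarrow> real \<Rightarrow> nat" where
  "site n x = nat \<lfloor>golden * real n + x * sqrt n\<rfloor>"

lemma site_limit: "(\<lambda>n. (real (site n x) - golden * real n) / sqrt n) \<longlonglongrightarrow> x"
proof (rule tendsto_sandwich)
  have "eventually (\<lambda>n::nat. golden * real n + x * sqrt n \<ge> 0) sequentially"
    using golden_bounds by real_asymp
  then have ev: "eventually (\<lambda>n. n > 0 \<and> golden * real n + x * sqrt n \<ge> 0) sequentially"
    using eventually_gt_at_top[of 0] by eventually_elim auto
  have fl: "z - 1 \<le> real (nat \<lfloor>z\<rfloor>) \<and> real (nat \<lfloor>z\<rfloor>) \<le> z" if "z \<ge> 0" for z :: real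
    using that by linarith
  show "eventually (\<lambda>n. x - 1 / sqrt n \<le> (real (site n x) - golden * real n) / sqrt n) sequentially"
    using ev
  proof eventually_elim
    case (elim n)
    then have "golden * real n + x * sqrt n - 1 \<le> real (site n x)" using fl unfolding site_def
        by blast
    then show ?case using elim by (simp add: pos_le_divide_eq left_diff_distrib)
  qed
  show "eventually (\<lambda>n. (real (site n x) - golden * real n) / sqrt n \<le> x) sequentially"
    using ev
  proof eventually_elim
    case (elim n)
    then have "real (site n x) \<le> golden * real n + x * sqrt n" using fl unfolding site_def by blast
    then show ?case using elim by (simp add: field_simps)
  qed
  show "(\<lambda>n. x - 1 / sqrt (real n)) \<longlonglongrightarrow> x" by real_asymp
qed simp

lemma site_ratio_limit: "(\<lambda>n. real (site n x) / real n) \<longlonglongrightarrow> golden"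
proof -
  have "(\<lambda>n. (real (site n x) - golden * real n) / sqrt n * (1 / sqrt n) + golden) \<longlonglongrightarrow> x * 0 + golden"
    by (intro tendsto_add tendsto_mult site_limit tendsto_const) real_asymp
  moreover have "eventually (\<lambda>n. (real (site n x) - golden * real n) / sqrt n * (1 / sqrt n)
      + golden = real (site n x) / real n) sequentially"
    using eventually_gt_at_top[of 0] by eventually_elim (simp add: field_simps)
  ultimately show ?thesis using Lim_transform_eventually by fastforce
qed

text \<open>
  The local limit theorem is applied to each factor. The third distribution has size
  \<open>n + j + 2\<close>, which is asymptotic to \<open>n / \<lambda>\<close>, and in its own scale the deviation \<open>x\<close> becomes
  \<open>\<lambda> x sqrt \<lambda>\<close>.
\<close>

lemma pmf_term_local_limit:
  "(\<lambda>n. real n * sqrt n * pmf_term n (site n x)) \<longlonglongrightarrow> gauss_limit x"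
proof -
  have golden: "0 < golden" "golden < 1" using golden_bounds by auto
  have l2: "0 < golden\<^sup>2" "golden\<^sup>2 < 1" using golden golden_sq by auto
  have e: "1 - golden = golden\<^sup>2" "1 - golden\<^sup>2 = golden" using golden_sq by auto
  have v: "golden * (1 - golden) = golden ^ 3" "golden\<^sup>2 * (1 - golden\<^sup>2) = golden ^ 3"
    unfolding e by (simp_all add: power2_eq_square power3_eq_cube)
  define j where "j n = site n x" for n
  have j: "(\<lambda>n. (real (j n) - golden * real n) / sqrt n) \<longlonglongrightarrow> x" unfolding j_def by (rule site_limit)
  have jr: "(\<lambda>n. real (j n) / real n) \<longlonglongrightarrow> golden" unfolding j_def by (rule site_ratio_limit)
  have A: "(\<lambda>n. sqrt n * Bernstein n (j n + 2) golden) \<longlonglongrightarrow> exp (- x\<^sup>2 / (2 * golden * (1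
      - golden))) / sqrt (2 * pi * golden * (1 - golden))"
  proof (rule Bernstein_local_limit[OF golden, where M = "\<lambda>n. n"])
    have "(\<lambda>n. (real (j n) - golden * real n) / sqrt n + 2 / sqrt n) \<longlonglongrightarrow> x + 0"
      by (intro tendsto_add j) real_asymp
    then show "(\<lambda>n. (real (j n + 2) - golden * real n) / sqrt n) \<longlonglongrightarrow> x"
      by (simp add: add_divide_distrib diff_divide_distrib add_ac add_diff_eq diff_add_eq)
  qed (rule filterlim_ident)
  have B: "(\<lambda>n. sqrt (real (n + 2)) * Bernstein (n + 2) (j n) golden) \<longlonglongrightarrow> exp (- x\<^sup>2 / (2 * golden
      * (1 - golden))) / sqrt (2 * pi * golden * (1 - golden))"
  proof (rule Bernstein_local_limit[OF golden, where M = "\<lambda>n. n + 2"])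
    have "(\<lambda>n. ((real (j n) - golden * real n) / sqrt n - golden * 2 / sqrt n) * (sqrt n / sqrt
        (real n + 2))) \<longlonglongrightarrow> (x - 0) * 1"
      by (intro tendsto_mult tendsto_diff j; real_asymp)
    moreover have "eventually (\<lambda>n. ((real (j n) - golden * real n) / sqrt n - golden
        * 2 / sqrt n) * (sqrt n / sqrt (real n + 2)) =
        (real (j n) - golden * real (n + 2)) / sqrt (real (n + 2))) sequentially"
      using eventually_gt_at_top[of 0] by eventually_elim (simp add: field_simps)
    ultimately show "(\<lambda>n. (real (j n) - golden * real (n + 2)) / sqrt (real (n + 2))) \<longlonglongrightarrow> x"
      using Lim_transform_eventually by fastforce
  qed (rule filterlim_add_const_nat_at_top)
  define M where "M n = n + j n + 2" for n
  have Mr: "(\<lambda>n. real (M n) / real n) \<longlonglongrightarrow> 1 / golden"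
  proof -
    have "(\<lambda>n. 1 + real (j n) / real n + 2 / real n) \<longlonglongrightarrow> 1 + golden + 0"
      by (intro tendsto_add jr tendsto_const) real_asymp
    moreover have "eventually (\<lambda>n. 1 + real (j n) / real n + 2 / real n = real
        (M n) / real n) sequentially"
      using eventually_gt_at_top[of 0] by eventually_elim (simp add: M_def field_simps)
    moreover have "1 + golden + 0 = 1 / golden" using golden golden_sq by
        (simp add: field_simps power2_eq_square)
    ultimately show ?thesis using Lim_transform_eventually by fastforce
  qed
  then have s: "(\<lambda>n. sqrt (real (M n) / real n)) \<longlonglongrightarrow> sqrt (1 / golden)" by (intro tendsto_real_sqrt)
  have s': "(\<lambda>n. sqrt n / sqrt (M n)) \<longlonglongrightarrow> sqrt golden"
    using tendsto_inverse[OF s] golden by (simp add: real_sqrt_divide inverse_eq_divide)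
  have C: "(\<lambda>n. sqrt (real (M n)) * Bernstein (M n) (j n + 1) (golden\<^sup>2)) \<longlonglongrightarrow>
      exp (- (golden * x * sqrt golden)\<^sup>2 / (2 * golden\<^sup>2 * (1 - golden\<^sup>2))) / sqrt (2 * pi
          * golden\<^sup>2 * (1 - golden\<^sup>2))"
  proof (rule Bernstein_local_limit[OF l2])
    show "filterlim M at_top sequentially"
      unfolding M_def by (rule filterlim_at_top_mono[OF filterlim_ident])
          (simp add: always_eventually)
    have "(\<lambda>n. (golden * ((real (j n) - golden * real n) / sqrt n) + (1 - 2 * golden\<^sup>2) / sqrt n)
        * (sqrt n / sqrt (M n))) \<longlonglongrightarrow> (golden * x + 0) * sqrt golden"
      by (intro tendsto_mult tendsto_add j s' tendsto_const) real_asymp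
    moreover have "eventually (\<lambda>n. (golden * ((real (j n) - golden * real n) / sqrt n) + (1 - 2
        * golden\<^sup>2) / sqrt n) * (sqrt n / sqrt (M n)) =
        (real (j n + 1) - golden\<^sup>2 * real (M n)) / sqrt (M n)) sequentially"
      using eventually_gt_at_top[of 0]
    proof eventually_elim
      case (elim n)
      have eq: "real (j n + 1) - golden\<^sup>2 * real (M n) = golden * (real (j n) - golden * real n)
          + (1 - 2 * golden\<^sup>2)"
      proof -
        have "real (j n) = golden\<^sup>2 * real (j n) + golden * real (j n)" by
            (simp add: golden_sq algebra_simps)
        then show ?thesis by (simp add: M_def algebra_simps power2_eq_square)
      qed
      have alg: "(golden * (D / s) + c / s) * (s / m) = (golden * D + c) / m" if "s \<noteq> 0"
          for D s c m :: real
        using that by (simp add: add_divide_distrib[symmetric])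
      show ?case unfolding eq using elim by (intro alg) simp
    qed
    ultimately show "(\<lambda>n. (real (j n + 1) - golden\<^sup>2 * real (M n)) / sqrt (real (M n))) \<longlonglongrightarrow> golden
        * x * sqrt golden"
      using Lim_transform_eventually by fastforce
  qed
  have t: "(\<lambda>n::nat. sqrt n / sqrt (real n + 2)) \<longlonglongrightarrow> 1" by real_asymp
  have "(\<lambda>n. (sqrt n * Bernstein n (j n + 2) golden) * (sqrt (real (n + 2)) * Bernstein (n + 2)
      (j n) golden * (sqrt n / sqrt (real n + 2))) *
      (sqrt (real (M n)) * Bernstein (M n) (j n + 1) (golden\<^sup>2) * (sqrt n / sqrt (M n)))) \<longlonglongrightarrow>
      (exp (- x\<^sup>2 / (2 * golden * (1 - golden))) / sqrt (2 * pi * golden * (1 - golden))) *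
      (exp (- x\<^sup>2 / (2 * golden * (1 - golden))) / sqrt (2 * pi * golden * (1 - golden)) * 1) *
      (exp (- (golden * x * sqrt golden)\<^sup>2 / (2 * golden\<^sup>2 * (1 - golden\<^sup>2))) / sqrt (2 * pi
          * golden\<^sup>2 * (1 - golden\<^sup>2)) * sqrt golden)"
    by (intro tendsto_mult A B C t s')
  also have "(\<lambda>n. (sqrt n * Bernstein n (j n + 2) golden) * (sqrt (real (n + 2)) * Bernstein (n
      + 2) (j n) golden * (sqrt n / sqrt (real n + 2))) *
      (sqrt (real (M n)) * Bernstein (M n) (j n + 1) (golden\<^sup>2) * (sqrt n / sqrt (M n)))) =
          (\<lambda>n. real n * sqrt n * pmf_term n (j n))"
  proof
    fix n
    have 1: "sqrt (real (n + 2)) * b * (sqrt n / sqrt (real n + 2)) = sqrt n * b" for b by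
        (simp add: add.commute)
    have 2: "sqrt (real (M n)) * b * (sqrt n / sqrt (M n)) = sqrt n * b" for b by (simp add: M_def)
    have "real n * sqrt n = sqrt n * sqrt n * sqrt n" by simp
    then show "(sqrt n * Bernstein n (j n + 2) golden) * (sqrt (real (n + 2)) * Bernstein (n + 2)
        (j n) golden * (sqrt n / sqrt (real n + 2))) *
      (sqrt (real (M n)) * Bernstein (M n) (j n + 1) (golden\<^sup>2) * (sqrt n / sqrt (M n))) = real n
          * sqrt n * pmf_term n (j n)"
      unfolding 1 2 unfolding pmf_term_def M_def by (simp only: mult_ac)
  qed
  also have "(exp (- x\<^sup>2 / (2 * golden * (1 - golden))) / sqrt (2 * pi * golden * (1 - golden))) *
      (exp (- x\<^sup>2 / (2 * golden * (1 - golden))) / sqrt (2 * pi * golden * (1 - golden)) * 1) *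
      (exp (- (golden * x * sqrt golden)\<^sup>2 / (2 * golden\<^sup>2 * (1 - golden\<^sup>2))) / sqrt (2 * pi
          * golden\<^sup>2 * (1 - golden\<^sup>2)) * sqrt golden) = gauss_limit x"
  proof -
    have e1: "2 * golden * (1 - golden) = 2 * golden ^ 3" "2 * golden\<^sup>2 * (1 - golden\<^sup>2) = 2
        * golden ^ 3"
      "2 * pi * golden * (1 - golden) = 2 * pi * golden ^ 3" "2 * pi * golden\<^sup>2 * (1 - golden\<^sup>2)
          = 2 * pi * golden ^ 3"
      using v by (simp_all only: mult.assoc)
    have e2: "(golden * x * sqrt golden)\<^sup>2 = golden ^ 3 * x\<^sup>2" using golden by
        (simp add: power_mult_distrib power2_eq_square power3_eq_cube)
    have "- x\<^sup>2 / (2 * golden ^ 3) + - x\<^sup>2 / (2 * golden ^ 3) + - (golden ^ 3 * x\<^sup>2) / (2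
        * golden ^ 3) = - (sqrt 5 / (2 * golden ^ 3)) * x\<^sup>2"
    proof -
      have "golden ^ 3 > 0" using golden by simp
      moreover have "sqrt 5 = golden ^ 3 + 2" using golden_cube by simp
      ultimately show ?thesis by (simp only: field_simps) (simp add: field_simps)
    qed
    then have e3: "exp (- x\<^sup>2 / (2 * golden ^ 3)) * exp (- x\<^sup>2 / (2 * golden ^ 3)) * exp (-
        (golden ^ 3 * x\<^sup>2) / (2 * golden ^ 3)) =
        exp (- (sqrt 5 / (2 * golden ^ 3)) * x\<^sup>2)" by (simp flip: exp_add)
    have "sqrt (2 * pi * golden ^ 3) * sqrt (2 * pi * golden ^ 3) = 2 * pi * golden ^ 3"
        using golden by simp
    then have "(a / sqrt (2 * pi * golden ^ 3)) * (b / sqrt (2 * pi * golden ^ 3) * 1) *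
        (c / sqrt (2 * pi * golden ^ 3) * sqrt golden) =
      sqrt golden / (2 * pi * golden ^ 3 * sqrt (2 * pi * golden ^ 3)) * (a * b * c)" for a b c
      by (simp add: times_divide_times_eq mult_ac)
    then show ?thesis unfolding e1 e2 gauss_limit_def e3[symmetric] .
  qed
  finally show ?thesis unfolding j_def .
qed

text \<open>
  For these \<open>j\<close>, the quotient \<open>j / n\<close> lies between \<open>7/20\<close> and \<open>87/100\<close>; so for \<open>n \<ge> 40\<close> the quotients of
  position and size in all three distributions lie between \<open>1/10\<close> and \<open>19/20\<close>, where \<open>Bernstein_bound\<close> applies.
\<close>

definition central :: "nat \<Rightarrow> nat set" where
  "central n = {j. j \<le> n \<and> \<bar>real j - golden * real n\<bar> < real n / 4}"

lemma pmf_term_central_bound: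
  obtains C where "C > 0" "\<And>n j. n \<ge> 40 \<Longrightarrow> j \<in> central n \<Longrightarrow>
    real n * sqrt n * pmf_term n j \<le> C * exp (- 2 * ((real j + 2 - golden * real n) / sqrt n)\<^sup>2)"
proof -
  have golden: "0 < golden" "golden < 1" using golden_bounds by auto
  have l2: "0 < golden\<^sup>2" "golden\<^sup>2 < 1" using golden golden_sq by auto
  obtain C where C: "C > 0" "\<And>M k. 0 < M \<Longrightarrow> 1/10 * real M \<le> real k \<Longrightarrow> real k \<le> 19/20 * real M \<Longrightarrow>
    sqrt M * Bernstein M k golden \<le> C * exp (- 2 * ((k - golden * M) / sqrt M)\<^sup>2)"
    using Bernstein_bound[OF golden, of "1/10" "19/20"] by auto
  obtain C' where C': "C' > 0" "\<And>M k. 0 < M \<Longrightarrow> 1/10 * real M \<le> real k \<Longrightarrow> real k \<le> 19/20 * real M \<Longrightarrow>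
    sqrt M * Bernstein M k (golden\<^sup>2) \<le> C' * exp (- 2 * ((k - golden\<^sup>2 * M) / sqrt M)\<^sup>2)"
    using Bernstein_bound[OF l2, of "1/10" "19/20"] by auto
  have "real n * sqrt n * pmf_term n j \<le> C * C * C' * exp (- 2 * ((real j + 2 - golden
      * real n) / sqrt n)\<^sup>2)"
    if n: "n \<ge> 40" and "j \<in> central n" for n j
  proof -
    have j: "j \<le> n" "real j \<ge> golden * real n - real n / 4" "real j \<le> golden * real n + real n / 4"
    proof -
      have "j \<le> n" "\<bar>real j - golden * real n\<bar> < real n / 4" using that(2) by
          (simp_all add: central_def)
      then show "j \<le> n" "real j \<ge> golden * real n - real n / 4" "real j \<le> golden * real n
          + real n / 4"
        by linarith+
    qed
    have "3/5 * real n \<le> golden * real n" "golden * real n \<le> 31/50 * real n"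
      using mult_right_mono[OF less_imp_le[OF golden_bounds(1)], of "real n"]
        mult_right_mono[OF less_imp_le[OF golden_bounds(2)], of "real n"] by simp_all
    then have j': "real j \<ge> 7/20 * real n" "real j \<le> 87/100 * real n" using j by linarith+
    have n': "real n \<ge> 40" using n by simp
    have 1: "sqrt n * Bernstein n (j + 2) golden \<le> C * exp (- 2 * ((real j + 2 - golden
        * real n) / sqrt n)\<^sup>2)"
      using C(2)[of n "j + 2"] j' n' n by (simp add: add.commute)
    have le1: "c * exp (- 2 * y\<^sup>2) \<le> c" if "c > 0" for c y :: real
      using that by simp
    have 2: "sqrt n * Bernstein (n + 2) j golden \<le> C"
    proof -
      have "sqrt n * Bernstein (n + 2) j golden \<le> sqrt (n + 2) * Bernstein (n + 2) j golden"
        using golden by (intro mult_right_mono Bernstein_nonneg) auto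
      also have "\<dots> \<le> C * exp (- 2 * ((j - golden * real (n + 2)) / sqrt (real (n + 2)))\<^sup>2)"
        using C(2)[of "n + 2" j] j' n' by simp
      also have "\<dots> \<le> C" by (rule le1[OF C(1)])
      finally show ?thesis .
    qed
    have 3: "sqrt n * Bernstein (n + j + 2) (j + 1) (golden\<^sup>2) \<le> C'"
    proof -
      have "sqrt n * Bernstein (n + j + 2) (j + 1) (golden\<^sup>2) \<le> sqrt (n + j + 2) * Bernstein (n
          + j + 2) (j + 1) (golden\<^sup>2)"
        using l2 by (intro mult_right_mono Bernstein_nonneg) auto
      also have "\<dots> \<le> C' * exp (- 2 * ((real (j + 1) - golden\<^sup>2 * real (n + j + 2)) / sqrt (real
          (n + j + 2)))\<^sup>2)"
        using C'(2)[of "n + j + 2" "j + 1"] j' n' by simp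
      also have "\<dots> \<le> C'" by (rule le1[OF C'(1)])
      finally show ?thesis .
    qed
    have "real n * sqrt n * pmf_term n j = (sqrt n * Bernstein n (j + 2) golden) * (sqrt n
        * Bernstein (n + 2) j golden) * (sqrt n * Bernstein (n + j + 2) (j + 1) (golden\<^sup>2))"
    proof -
      have "real n * sqrt n = sqrt n * sqrt n * sqrt n" by simp
      then show ?thesis unfolding pmf_term_def by (simp only: mult_ac)
    qed
    also have "\<dots> \<le> C * exp (- 2 * ((real j + 2 - golden * real n) / sqrt n)\<^sup>2) * C * C'"
      using C(1) C'(1) golden l2 by (intro mult_mono 1 2 3 mult_nonneg_nonneg Bernstein_nonneg) auto
    finally show ?thesis by (simp only: mult_ac)
  qed
  then show thesis using that[of "C * C * C'"] C(1) C'(1) by auto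
qed

text \<open>
  The step function whose integral is the rescaled sum over \<open>central n\<close>: after rescaling, the term
  with index \<open>j\<close> occupies an interval of length \<open>1 / sqrt n\<close>. Small \<open>n\<close> are cut off to have a bound that
  is uniform in \<open>n\<close>.
\<close>

definition step_fun :: "nat \<Rightarrow> real \<Rightarrow> real" where
  "step_fun n x = (if n < 40 then 0 else \<Sum>j\<in>central n. real n * sqrt n * pmf_term n j *
     indicator {(real j - golden * real n) / sqrt n ..< (real j + 1 - golden * real n) / sqrt n} x)"

lemma finite_central: "finite (central n)"
  by (rule finite_subset[of _ "{..n}"]) (auto simp: central_def)

lemma step_fun_integral:
  assumes "n \<ge> 40"
  shows "(\<integral>x. step_fun n x \<partial>lborel) = real n * (\<Sum>j\<in>central n. pmf_term n j)"
proof -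
  have "(\<integral>x. step_fun n x \<partial>lborel) = (\<Sum>j\<in>central n. \<integral>x. real n * sqrt n * pmf_term n j *
     indicator {(real j - golden * real n) / sqrt n ..< (real j + 1 - golden
         * real n) / sqrt n} x \<partial>lborel)"
    unfolding step_fun_def using assms
    by (subst Bochner_Integration.integral_sum[symmetric])
       (auto intro!: integrable_mult_right integrable_real_indicator simp: divide_right_mono)
  also have "\<dots> = (\<Sum>j\<in>central n. real n * pmf_term n j)"
  proof (intro sum.cong refl)
    fix j
    have "(real j + 1 - golden * real n) / sqrt n - (real j - golden * real n) / sqrt n
        = 1 / sqrt n"
      by (simp add: diff_divide_distrib[symmetric])
    then have "measure lborel {(real j - golden * real n) / sqrt n ..< (real j + 1 - golden
        * real n) / sqrt n} = 1 / sqrt n"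
      using assms by (subst measure_lborel_Ico) (auto intro: divide_right_mono)
    then show "(\<integral>x. real n * sqrt n * pmf_term n j * indicator {(real j - golden
        * real n) / sqrt n ..< (real j + 1 - golden * real n) / sqrt n} x \<partial>lborel)
       = real n * pmf_term n j"
      using assms by simp
  qed
  finally show ?thesis by (simp add: sum_distrib_left)
qed

lemma step_fun_eq:
  assumes "n \<ge> 40"
  shows "step_fun n x = (if site n x \<in> central n \<and> 0 \<le> golden * real n + x * sqrt n then real n
      * sqrt n * pmf_term n (site n x) else 0)"
proof -
  have ind: "x \<in> {(real j - golden * real n) / sqrt n ..< (real j + 1 - golden * real n) / sqrt n} \<longleftrightarrow>
      j = site n x \<and> 0 \<le> golden * real n + x * sqrt n" for j
  proof -
    have "x \<in> {(real j - golden * real n) / sqrt n ..< (real j + 1 - golden * real n) / sqrt n} \<longleftrightarrow>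
       real j \<le> golden * real n + x * sqrt n \<and> golden * real n + x * sqrt n < real j + 1"
      using assms by (auto simp: pos_divide_le_eq pos_less_divide_eq)
    also have "\<dots> \<longleftrightarrow> j = site n x \<and> 0 \<le> golden * real n + x * sqrt n"
      unfolding site_def by (auto simp: le_nat_floor nat_floor_neg) linarith+
    finally show ?thesis .
  qed
  have "step_fun n x = (\<Sum>j\<in>central n. if j = site n x then
      (if 0 \<le> golden * real n + x * sqrt n then real n * sqrt n * pmf_term n
          (site n x) else 0) else 0)"
    unfolding step_fun_def indicator_def ind using assms by (auto intro!: sum.cong)
  then show ?thesis using finite_central by (auto simp: sum.delta)
qed

lemma step_fun_limit: "(\<lambda>n. step_fun n x) \<longlonglongrightarrow> gauss_limit x"
proof (rule Lim_transform_eventually[OF pmf_term_local_limit])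
  have "eventually (\<lambda>n. \<bar>real (site n x) / real n - golden\<bar> < 1 / 4) sequentially"
    using tendstoD[OF site_ratio_limit, of "1/4" x] by (simp add: dist_real_def)
  moreover have "eventually (\<lambda>n::nat. 0 \<le> golden * real n + x * sqrt n) sequentially"
    using golden_bounds by real_asymp
  ultimately show "eventually (\<lambda>n. real n * sqrt n * pmf_term n (site n x)
      = step_fun n x) sequentially"
    using eventually_ge_at_top[of 40]
  proof eventually_elim
    case (elim n)
    have n: "real n > 0" using elim by simp
    have "real (site n x) - golden * real n = (real (site n x) / real n - golden) * real n"
      using n by (simp add: field_simps)
    then have *: "\<bar>real (site n x) - golden * real n\<bar> < real n / 4"
      using elim(1) n by (simp add: abs_mult)
    moreover have "golden * real n \<le> 31/50 * real n" using golden_bounds by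
        (intro mult_right_mono) auto
    ultimately have "real (site n x) \<le> real n" using n by linarith
    then show ?case using elim * by (simp add: step_fun_eq central_def)
  qed
qed

text \<open>
  Dominated convergence, with \<open>pmf_term_central_bound\<close> as the domination.
\<close>

lemma pmf_term_central_limit: "(\<lambda>n. real n * (\<Sum>j\<in>central n. pmf_term n j)) \<longlonglongrightarrow>
    (\<integral>x. gauss_limit x \<partial>lborel)"
proof -
  obtain C where C: "C > 0" "\<And>n j. n \<ge> 40 \<Longrightarrow> j \<in> central n \<Longrightarrow>
    real n * sqrt n * pmf_term n j \<le> C * exp (- 2 * ((real j + 2 - golden * real n) / sqrt n)\<^sup>2)"
    using pmf_term_central_bound by blast
  \<comment> \<open>The bound is centred at a point \<open>y\<close> with \<open>\<bar>y - x\<bar> \<le> 2\<close>, and then \<open>2 y^2 \<ge> x^2 - 8\<close>.\<close>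
  define w where "w x = C * exp 8 * (sqrt pi * normal_density 0 (1 / sqrt 2) x)" for x
  have w: "w x = C * exp (8 - x\<^sup>2)" for x
    by (simp add: w_def normal_density_def exp_diff exp_minus power_divide real_sqrt_divide
        field_simps)
  have wint: "integrable lborel w"
    unfolding w_def by (intro integrable_mult_right integrable_normal_density) simp
  have "(\<lambda>n. \<integral>x. step_fun n x \<partial>lborel) \<longlonglongrightarrow> (\<integral>x. gauss_limit x \<partial>lborel)"
  proof (rule integral_dominated_convergence[where w = w])
    show "gauss_limit \<in> borel_measurable lborel"
      using gauss_limit_integral(1) by (rule borel_measurable_integrable)
    show "step_fun n \<in> borel_measurable lborel" for n
      unfolding step_fun_def[abs_def] by measurable
    show "AE x in lborel. norm (step_fun n x) \<le> w x" for n
    proof (intro AE_I2)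
      fix x
      have w0: "w x \<ge> 0" unfolding w using C(1) by simp
      show "norm (step_fun n x) \<le> w x"
      proof (cases "n \<ge> 40 \<and> site n x \<in> central n \<and> 0 \<le> golden * real n + x * sqrt n")
        case True
        define y where "y = (real (site n x) + 2 - golden * real n) / sqrt n"
        have fl: "z - 1 \<le> real (nat \<lfloor>z\<rfloor>) \<and> real (nat \<lfloor>z\<rfloor>) \<le> z" if "z \<ge> 0" for z :: real
          using that by linarith
        have s1: "sqrt n \<ge> 1" using True by simp
        have "y - x = (real (site n x) + 2 - golden * real n - x * sqrt n) / sqrt n"
          using s1 by (simp add: y_def field_simps)
        moreover have "\<bar>real (site n x) + 2 - golden * real n - x * sqrt n\<bar> \<le> 2"
          using fl[of "golden * real n + x * sqrt n"] True unfolding site_def by linarith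
        ultimately have "\<bar>y - x\<bar> \<le> 2 / sqrt n" using s1 by (simp add: abs_divide divide_right_mono)
        also have "\<dots> \<le> 2" using s1 by (simp add: divide_le_eq)
        finally have "(y - x)\<^sup>2 \<le> 2\<^sup>2" using abs_le_square_iff[of "y - x" 2] by simp
        moreover have "x\<^sup>2 \<le> 2 * y\<^sup>2 + 2 * (y - x)\<^sup>2"
          using zero_le_power2[of "2 * y - x"] by (simp add: power2_eq_square algebra_simps)
        ultimately have "- 2 * y\<^sup>2 \<le> 8 - x\<^sup>2" by simp
        then have "C * exp (- 2 * y\<^sup>2) \<le> C * exp (8 - x\<^sup>2)" using C(1) by simp
        moreover have "step_fun n x \<le> C * exp (- 2 * y\<^sup>2)"
          using C(2)[of n "site n x"] True by (simp add: step_fun_eq y_def)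
        moreover have "step_fun n x \<ge> 0" using True by (simp add: step_fun_eq pmf_term_nonneg)
        ultimately show ?thesis by (simp add: w)
      next
        case False
        then have "step_fun n x = 0"
          by (cases "n \<ge> 40") (auto simp: step_fun_eq, simp add: step_fun_def)
        then show ?thesis using w0 by simp
      qed
    qed
  qed (use step_fun_limit wint in auto)
  then show ?thesis
    by (rule Lim_transform_eventually)
       (use eventually_ge_at_top[of 40] in eventually_elim, simp add: step_fun_integral)
qed

lemma pmf_term_sum_limit:
  "(\<lambda>n. real n * (\<Sum>j\<le>n. pmf_term n j)) \<longlonglongrightarrow> sqrt golden / (2 * pi * golden ^ 3 * sqrt (sqrt 5))"
proof -
  have "real n * (\<Sum>j\<le>n. pmf_term n j) = real n * (\<Sum>j\<in>central n. pmf_term n j) +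
      real n * (\<Sum>j | j \<le> n \<and> 1/4 * real n \<le> \<bar>real j - golden * real n\<bar>. pmf_term n j)" for n
  proof -
    have "{..n} = central n \<union> {j. j \<le> n \<and> 1/4 * real n \<le> \<bar>real j - golden * real n\<bar>}"
      by (auto simp: central_def)
    moreover have "central n \<inter> {j. j \<le> n \<and> 1/4 * real n \<le> \<bar>real j - golden * real n\<bar>} = {}"
      by (auto simp: central_def)
    ultimately have "(\<Sum>j\<le>n. pmf_term n j) = (\<Sum>j\<in>central n. pmf_term n j) + (\<Sum>j | j \<le> n \<and> 1/4
        * real n \<le> \<bar>real j - golden * real n\<bar>. pmf_term n j)"
      using finite_central by (simp add: sum.union_disjoint)
    then show ?thesis by (simp add: distrib_left)
  qed
  moreover have "(\<lambda>n. real n * (\<Sum>j\<in>central n. pmf_term n j) +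
      real n * (\<Sum>j | j \<le> n \<and> 1/4 * real n \<le> \<bar>real j - golden * real n\<bar>. pmf_term n j)) \<longlonglongrightarrow>
          (\<integral>x. gauss_limit x \<partial>lborel) + 0"
    by (intro tendsto_add pmf_term_central_limit pmf_term_far) simp
  ultimately show ?thesis by (simp only: gauss_limit_integral add_0_right)
qed

section \<open>The asymptotic formula\<close>

lemma SB_eq_pmf_term:
  assumes "n \<ge> 3"
  shows "real (SB n) * (real n ^ 2 * (real n ^ 2 - 1) * (real n + 2)) = 24 *
      (\<Sum>j\<le>n. pmf_term n j) / golden ^ (5 * n + 5)"
proof -
  have "(\<Sum>j\<le>n. pmf_term n j) = golden ^ (5 * n + 5) * (\<Sum>j\<le>n. real ((n choose (j + 2)) * ((n
      + 2) choose j) * ((n + j + 2) choose (j + 1))))"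
    by (simp only: pmf_term_eq_binomials sum_distrib_left)
  then show ?thesis using SB_formula[OF assms] golden_bounds by (simp add: mult_ac)
qed

lemma SB_normalised_limit:
  "(\<lambda>n. real (SB n) * golden ^ (5 * n) * real n ^ 6) \<longlonglongrightarrow> 24 / golden ^ 5 * (sqrt golden / (2 * pi
      * golden ^ 3 * sqrt (sqrt 5)))"
proof -
  have golden: "golden > 0" using golden_bounds by simp
  have "(\<lambda>n. 24 / golden ^ 5 * (real n * (\<Sum>j\<le>n. pmf_term n j)) * (real n ^ 5 / (real n ^ 2 *
      (real n ^ 2 - 1) * (real n + 2))))
      \<longlonglongrightarrow> 24 / golden ^ 5 * (sqrt golden / (2 * pi * golden ^ 3 * sqrt (sqrt 5))) * 1"
    by (intro tendsto_mult tendsto_const pmf_term_sum_limit) real_asymp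
  moreover have "eventually (\<lambda>n. 24 / golden ^ 5 * (real n * (\<Sum>j\<le>n. pmf_term n j)) *
      (real n ^ 5 / (real n ^ 2 * (real n ^ 2 - 1) * (real n + 2))) =
      real (SB n) * golden ^ (5 * n) * real n ^ 6) sequentially"
    using eventually_ge_at_top[of 3]
  proof eventually_elim
    case (elim n)
    define D S where "D = real n ^ 2 * (real n ^ 2 - 1) * (real n + 2)" and "S =
        (\<Sum>j\<le>n. pmf_term n j)"
    have "1 < real n ^ 2" using elim by (intro one_less_power) auto
    then have D: "D > 0" using elim by (simp add: D_def)
    have "real (SB n) * D = 24 * S / golden ^ (5 * n + 5)"
      using SB_eq_pmf_term[OF elim] unfolding D_def S_def .
    then have "real (SB n) = 24 * S / golden ^ (5 * n + 5) / D"
      using D by (simp only: eq_divide_eq) simp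
    then have "real (SB n) * golden ^ (5 * n) = 24 / golden ^ 5 * S / D"
      using golden by (simp add: power_add)
    moreover have "real n ^ 6 = real n * real n ^ 5" by (simp add: eval_nat_numeral)
    ultimately show ?case unfolding D_def[symmetric] S_def[symmetric] by simp
  qed
  ultimately show ?thesis using Lim_transform_eventually by fastforce
qed

lemma golden_inverse: "1 / golden = golden + 1"
  using golden_bounds golden_sq by (simp add: field_simps power2_eq_square)

lemma golden_pow5: "1 / golden ^ 5 = (11 + 5 * sqrt 5) / 2"
proof -
  have "1 / golden ^ 5 = (1 / golden) ^ 5" by (simp add: power_divide)
  also have "\<dots> = ((sqrt 5 + 1) / 2) ^ 5" unfolding golden_inverse by
      (simp add: golden_def field_simps)
  also have "\<dots> = (11 + 5 * sqrt 5) / 2"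
  proof -
    have 2: "(sqrt 5 + 1)\<^sup>2 = 6 + 2 * sqrt 5" by (simp add: power2_eq_square algebra_simps)
    have "(sqrt 5 + 1) ^ 5 = (sqrt 5 + 1)\<^sup>2 * (sqrt 5 + 1)\<^sup>2 * (sqrt 5 + 1)"
      by (simp add: eval_nat_numeral)
    also have "\<dots> = 16 * (11 + 5 * sqrt 5)" unfolding 2 by (simp add: algebra_simps)
    finally have "(sqrt 5 + 1) ^ 5 = 16 * (11 + 5 * sqrt 5)" .
    then show ?thesis by (simp add: power_divide)
  qed
  finally show ?thesis .
qed

lemma amplitude_eq:
  "(12 / pi) * 5 powr (- 1 / 4) * golden powr (- 15 / 2) =
    24 / golden ^ 5 * (sqrt golden / (2 * pi * golden ^ 3 * sqrt (sqrt 5)))"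
proof -
  have golden: "golden > 0" using golden_bounds by simp
  have "golden powr (- 15 / 2) = golden powr (1 / 2 - 8)" by simp
  also have "\<dots> = golden powr (1 / 2) / golden powr 8" by (rule powr_diff)
  also have "\<dots> = sqrt golden / golden ^ 8"
    using golden powr_realpow[of golden 8] by (simp add: powr_half_sqrt)
  finally have 1: "golden powr (- 15 / 2) = sqrt golden / golden ^ 8" .
  have "sqrt (sqrt 5) = (5 powr (1 / 2)) powr (1 / 2 :: real)"
    by (simp add: powr_half_sqrt)
  also have "\<dots> = 5 powr (1 / 4 :: real)" unfolding powr_powr by simp
  finally have 2: "5 powr (- 1 / 4 :: real) = 1 / sqrt (sqrt 5)"
    using powr_minus_divide[of "5::real" "1 / 4"] by simp
  have 3: "golden ^ 8 = golden ^ 5 * golden ^ 3" by (simp flip: power_add)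
  show ?thesis unfolding 1 2 3 by simp
qed

text \<open>
  In \<open>A^2 \<pi>^2\<close> only \<open>sqrt 5\<close> is left, as \<open>\<lambda>^(-15) = 682 + 305 sqrt 5\<close>.
\<close>

lemma amplitude_bounds:
  assumes A: "A = (12 / pi) * 5 powr (- 1 / 4) * golden powr (- 15 / 2)"
  shows "\<bar>A - 94.34\<bar> < 0.005"
proof -
  have golden: "golden > 0" using golden_bounds by simp
  have pos: "A > 0" unfolding A using golden by simp
  have A2: "A\<^sup>2 * pi\<^sup>2 = 144 * (305 + 682 / 5 * sqrt 5)"
  proof -
    have pow: "golden ^ 8 = golden ^ 5 * golden ^ 3" "golden ^ 16 = golden * golden ^ 15"
      by (simp_all flip: power_add power_Suc)
    have "A = 12 / pi * (sqrt golden / golden ^ 8) / sqrt (sqrt 5)"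
      unfolding A amplitude_eq pow(1) by simp
    then have "A\<^sup>2 = (12 / pi)\<^sup>2 * ((sqrt golden)\<^sup>2 / (golden ^ 8)\<^sup>2) / (sqrt (sqrt 5))\<^sup>2"
      by (simp only: power_mult_distrib power_divide)
    also have "(sqrt golden)\<^sup>2 = golden" using golden by simp
    also have "(golden ^ 8)\<^sup>2 = golden * golden ^ 15" unfolding pow(2)[symmetric] by
        (simp flip: power_mult)
    also have "golden / (golden * golden ^ 15) = (1 / golden ^ 5) ^ 3"
      using golden by (simp add: power_divide flip: power_mult)
    also have "\<dots> = 682 + 305 * sqrt 5"
    proof -
      have "(11 + 5 * sqrt 5) ^ 3 = 8 * (682 + 305 * sqrt 5)"
        by (simp add: power3_eq_cube algebra_simps)
      then show ?thesis unfolding golden_pow5 by (simp add: power_divide)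
    qed
    also have "(sqrt (sqrt 5))\<^sup>2 = sqrt 5" by simp
    finally have "A\<^sup>2 * pi\<^sup>2 = 144 * ((682 + 305 * sqrt 5) / sqrt 5)"
      by (simp add: power_divide)
    also have "(682 + 305 * sqrt 5) / sqrt 5 = 305 + 682 / 5 * sqrt 5"
      by (simp add: divide_eq_eq algebra_simps)
    finally show ?thesis .
  qed
  \<comment> \<open>In fact \<open>A\<close> is about \<open>94.34007\<close>, so these bounds for \<open>sqrt 5\<close> and \<open>\<pi>\<close> leave enough room.\<close>
  have s5: "2.23606 < sqrt 5" "sqrt 5 < 2.23607"
    by (rule real_less_rsqrt, simp add: power2_eq_square) (rule real_less_lsqrt; simp add:
        power2_eq_square)
  have p: "3.14159 < pi" "pi < 3.1416" using pi_approx by simp_all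
  have "A < 94.345"
  proof (rule ccontr)
    assume "\<not> A < 94.345"
    then have "94.345\<^sup>2 * 3.14159\<^sup>2 \<le> A\<^sup>2 * pi\<^sup>2" using p by (intro mult_mono power_mono) auto
    moreover have "144 * (305 + 682 / 5 * 2.23607) < (94.345\<^sup>2 * 3.14159\<^sup>2 :: real)" by
        (simp add: power2_eq_square)
    ultimately show False unfolding A2 using s5 by simp
  qed
  moreover have "A > 94.335"
  proof (rule ccontr)
    assume "\<not> A > 94.335"
    then have "A\<^sup>2 * pi\<^sup>2 \<le> 94.335\<^sup>2 * 3.1416\<^sup>2" using p pos by (intro mult_mono power_mono) auto
    moreover have "(94.335\<^sup>2 * 3.1416\<^sup>2 :: real) < 144 * (305 + 682 / 5 * 2.23606)" by
        (simp add: power2_eq_square)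
    ultimately show False unfolding A2 using s5 by simp
  qed
  ultimately show ?thesis by (simp add: abs_if)
qed

theorem corollary17:
  fixes lam A \<mu> :: real
  assumes "lam = (1 / 2) * (sqrt 5 - 1)"
    and "A = (12 / pi) * 5 powr (- 1 / 4) * lam powr (- 15 / 2)"
    and "\<mu> = lam powi (- 5)"
  shows "((\<lambda>n. real (SB n)) \<sim>[sequentially] (\<lambda>n. A * (\<mu> ^ n / real n ^ 6)))
    \<and> \<bar>A - 94.34\<bar> < 0.005
    \<and> \<mu> = (11 + 5 * sqrt 5) / 2"
proof -
  have l: "lam = golden" using assms(1) by (simp add: golden_def)
  have lam: "lam > 0" using golden_bounds by (simp add: l)
  have \<mu>: "\<mu> = 1 / lam ^ 5" using assms(3) by (simp add: power_int_minus divide_inverse)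
  have A0: "A > 0" unfolding assms(2) using lam by simp
  have A: "A = 24 / lam ^ 5 * (sqrt lam / (2 * pi * lam ^ 3 * sqrt (sqrt 5)))"
    unfolding assms(2) l by (rule amplitude_eq)
  have "(\<lambda>n. real (SB n) * lam ^ (5 * n) * real n ^ 6) \<longlonglongrightarrow> A"
    unfolding A unfolding l by (rule SB_normalised_limit)
  then have "(\<lambda>n. real (SB n) * lam ^ (5 * n) * real n ^ 6 / A) \<longlonglongrightarrow> A / A"
    using A0 by (intro tendsto_divide tendsto_const) simp_all
  moreover have "real (SB n) / (A * (\<mu> ^ n / real n ^ 6)) = real (SB n) * lam ^ (5 * n)
      * real n ^ 6 / A" for n
    unfolding \<mu> by (simp add: power_divide flip: power_mult)
  ultimately have "(\<lambda>n. real (SB n)) \<sim>[sequentially] (\<lambda>n. A * (\<mu> ^ n / real n ^ 6))"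
    using A0 by (intro asymp_equivI') simp
  moreover have "\<bar>A - 94.34\<bar> < 0.005" using amplitude_bounds assms(2) unfolding l by blast
  moreover have "\<mu> = (11 + 5 * sqrt 5) / 2" unfolding \<mu> l by (rule golden_pow5)
  ultimately show ?thesis by blast
qed

end
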